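(* Let $K\ge 1$ and $p\ge 3$ be fixed integers. Then for all sufficiently large $n$ (depending on $K$ and $p$), for every tree $T_n$ of order $n$ with vertex set $[n]$ and every vector of integers $\mathbf{k}=(k_1,\ldots,k_n)$ with $0<k_i\le K$ for all $i\in[n]$, the graph $T_n^{\mathbf{k}}$ is $p$-good.
   Context: All graphs are finite and simple; $[n]=\{1,\ldots,n\}$. Given a graph $G$ with vertex set $[n]$ and a vector of positive integers $\mathbf{k}=(k_1,\ldots,k_n)$, $G^{\mathbf{k}}$ is the graph obtained from $G$ by replacing each vertex $i\in[n]$ with a clique of order $k_i$ and every edge $ij\in E(G)$ with a complete bipartite graph $K_{k_i,k_j}$ between the corresponding cliques. The Ramsey number $r(H_1,H_2)$ is the least $m$ such that for every partition $E(K_m)=E(R)\cup E(B)$ into the edge sets of two graphs $R,B$ on $V(K_m)$, either $H_1\subset R$ or $H_2\subset B$. A connected graph $H$ is $p$-good if $r(K_p,H)=(p-1)(|H|-1)+1$, where $|H|$ is the order of $H$. *)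

theory Defs
  imports "Graph_Theory.Graph_Theory"
begin

text \<open>
  A finite simple graph is a \<^locale>\<open>pair_graph\<close>: a finite, loop-free, symmetric digraph
  whose arcs are pairs of vertices.  An edge \<open>uv\<close> is represented by the two arcs
  \<open>(u, v)\<close> and \<open>(v, u)\<close>.
\<close>

definition complete_graph :: "'a set \<Rightarrow> 'a pair_pre_digraph" where
  "complete_graph V = \<lparr> pverts = V, parcs = {(u, v). u \<in> V \<and> v \<in> V \<and> u \<noteq> v} \<rparr>"

text \<open>
  The library constant \<^const>\<open>tree\<close> cannot be used for symmetric digraphs:
  there the walk \<open>u, v, u\<close> counts as a cycle, so that no graph with an edge would be a tree.
  The cycles of the undirected graph are the directed cycles of length at least 3.
\<close>

definition tree_graph :: "'a pair_pre_digraph \<Rightarrow> bool" where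
  "tree_graph T \<longleftrightarrow>
     pair_graph T \<and> connected T \<and> \<not> (\<exists>c. pre_digraph.cycle T c \<and> 3 \<le> length c)"

definition blowup :: "'a pair_pre_digraph \<Rightarrow> ('a \<Rightarrow> nat) \<Rightarrow> ('a \<times> nat) pair_pre_digraph" where
  "blowup G k = (let V = (SIGMA i : pverts G. {1..k i}) in
     \<lparr> pverts = V,
       parcs = {(x, y). x \<in> V \<and> y \<in> V \<and>
                  (fst x = fst y \<and> snd x \<noteq> snd y \<or> (fst x, fst y) \<in> parcs G)} \<rparr>)"

text \<open>\<open>H \<subset> G\<close> in the sense of Ramsey theory: some subgraph of \<open>G\<close>, not necessarily induced,
  is isomorphic to \<open>H\<close>.\<close>

definition contains_copy :: "'a pair_pre_digraph \<Rightarrow> 'b pair_pre_digraph \<Rightarrow> bool" where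
  "contains_copy G H \<longleftrightarrow>
     (\<exists>H' :: 'a pair_pre_digraph. subgraph H' G \<and> digraph_iso H H')"

definition edge_partition ::
  "'a pair_pre_digraph \<Rightarrow> 'a pair_pre_digraph \<Rightarrow> 'a pair_pre_digraph \<Rightarrow> bool" where
  "edge_partition G R B \<longleftrightarrow>
     pair_graph R \<and> pair_graph B \<and> pverts R = pverts G \<and> pverts B = pverts G \<and>
     parcs R \<union> parcs B = parcs G \<and> parcs R \<inter> parcs B = {}"

definition ramsey_number :: "'a pair_pre_digraph \<Rightarrow> 'b pair_pre_digraph \<Rightarrow> nat" where
  "ramsey_number H1 H2 =
     (LEAST m. \<forall>R B. edge_partition (complete_graph {1..m}) R B \<longrightarrow>
                 contains_copy R H1 \<or> contains_copy B H2)"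

definition p_good :: "nat \<Rightarrow> 'a pair_pre_digraph \<Rightarrow> bool" where
  "p_good p H \<longleftrightarrow>
     pair_graph H \<and> connected H \<and>
     ramsey_number (complete_graph {1..p}) H = (p - 1) * (card (pverts H) - 1) + 1"

end

(*
  Proof idea.  The lower bound comes from p - 1 disjoint blue cliques of order N - 1, where N is the
  order of the blown-up tree H.  For the upper bound let a colouring of order (p - 1)(N - 1) + 1 have
  no red K_p and no blue H.

  If every large subset S of a set U contained a blue K-clique with more than (1 + e) N common blue
  neighbours in U, then H could be embedded greedily.  So some S is bad, every K-clique in it having
  few common neighbours, and by averaging all but (1 + e) N vertices have a positive density of red
  edges to S.  Shrinking S as long as the set of exceptional vertices grows, one may assume that the
  remaining set has few red K_{p-1}, and iterating p - 2 times yields a set of about N vertices with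
  few red edges, i.e. a blue near-clique C.  If more than boundedly many vertices of C (or vertices
  blue to most of C) had many blue neighbours outside C, a K-clique Q of such vertices would have
  many common ones; placing a suitable cut vertex of the tree into Q, a small part of the tree outside
  C and the rest inside C would give H.  Hence almost all of C is red to almost everything outside C,
  and induction on p yields p - 1 blue cliques of order about N with almost only red edges between
  them.

  Since there is no red K_p, each vertex is blue to almost all of some of these cliques, so
  one of the resulting p - 1 classes has at least N vertices.  Again by K_p-freeness it is a clique
  apart from vertices with many blue neighbours in other classes.  There are boundedly many of those, and
  they can be used for tree vertices of small degree.
*)
theory Submission
  imports Defs "HOL-Library.Ramsey"
begin

section \<open>Red and blue neighbourhoods\<close>

text \<open>The obstacle is exactness. Greedy embedding needs room beyond the order N of the blow-up
  in every common neighbourhood, while a near-extremal colouring offers only blocks of about N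
  vertices. Two devices close the gap: with many surplus vertices a linear part of the tree leaves
  the block, so the remainder fits with slack; with boundedly many, the block is an exact blue
  clique, where only the neighbours of the surplus vertices need care. Constants are fixed in the
  order \<open>s\<close>, then the number \<open>L\<close> of surplus vertices that forces a clique
  with many common neighbours, then \<open>\<gamma>\<close> (exponentially small in
  \<open>L\<close>), then \<open>\<epsilon>\<close>, then \<open>\<delta>\<close>. All precede the
  colouring, the tree and \<open>k\<close>, hence the long quantifier prefixes.\<close>

text \<open>A red-blue colouring of a complete graph is encoded by its red relation \<open>R\<close>; the blue
  neighbours of a vertex are the other vertices that are not red neighbours.\<close>

definition red_graph :: "('a \<Rightarrow> 'a \<Rightarrow> bool) \<Rightarrow> bool" where
  "red_graph R \<longleftrightarrow> (\<forall>x y. R x y \<longrightarrow> R y x) \<and> (\<forall>x. \<not> R x x)"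

definition blue_clique :: "('a \<Rightarrow> 'a \<Rightarrow> bool) \<Rightarrow> 'a set \<Rightarrow> bool" where
  "blue_clique R Q \<longleftrightarrow> (\<forall>x\<in>Q. \<forall>y\<in>Q. \<not> R x y)"

definition red_clique :: "('a \<Rightarrow> 'a \<Rightarrow> bool) \<Rightarrow> 'a set \<Rightarrow> bool" where
  "red_clique R A \<longleftrightarrow> (\<forall>x\<in>A. \<forall>y\<in>A. x \<noteq> y \<longrightarrow> R x y)"

text \<open>A vertex of \<open>Q\<close> may belong to \<open>blue_nbs R Q U\<close>: only non-red-adjacency is asked for.\<close>

definition blue_nbs :: "('a \<Rightarrow> 'a \<Rightarrow> bool) \<Rightarrow> 'a set \<Rightarrow> 'a set \<Rightarrow> 'a set" where
  "blue_nbs R Q U = {w \<in> U. \<forall>q\<in>Q. \<not> R q w}"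

definition red_nbs :: "('a \<Rightarrow> 'a \<Rightarrow> bool) \<Rightarrow> 'a \<Rightarrow> 'a set \<Rightarrow> 'a set" where
  "red_nbs R x U = {w \<in> U. R x w}"

definition red_free :: "('a \<Rightarrow> 'a \<Rightarrow> bool) \<Rightarrow> nat \<Rightarrow> 'a set \<Rightarrow> bool" where
  "red_free R p V \<longleftrightarrow> \<not> (\<exists>A\<subseteq>V. finite A \<and> card A = p \<and> red_clique R A)"

definition blue_cliques_from :: "('a \<Rightarrow> 'a \<Rightarrow> bool) \<Rightarrow> nat \<Rightarrow> nat \<Rightarrow> 'a set \<Rightarrow> bool" where
  "blue_cliques_from R K s V \<longleftrightarrow>
     (\<forall>S\<subseteq>V. s \<le> card S \<longrightarrow> (\<exists>Q\<subseteq>S. card Q = K \<and> blue_clique R Q))"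

lemma red_graphD: "red_graph R \<Longrightarrow> R x y \<Longrightarrow> R y x" "red_graph R \<Longrightarrow> \<not> R x x"
  unfolding red_graph_def by auto

lemma blue_clique_subset: "blue_clique R Q \<Longrightarrow> P \<subseteq> Q \<Longrightarrow> blue_clique R P"
  unfolding blue_clique_def by blast

lemma blue_nbs_mono: "P \<subseteq> Q \<Longrightarrow> U \<subseteq> V \<Longrightarrow> blue_nbs R Q U \<subseteq> blue_nbs R P V"
  unfolding blue_nbs_def by blast

lemma blue_nbs_sub: "blue_nbs R Q U \<subseteq> U"
  unfolding blue_nbs_def by blast

lemma red_nbs_sub: "red_nbs R x U \<subseteq> U"
  unfolding red_nbs_def by blast

lemma finite_nbs [simp]: "finite U \<Longrightarrow> finite (blue_nbs R Q U)" "finite U \<Longrightarrow> finite (red_nbs R x U)"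
  unfolding blue_nbs_def red_nbs_def by auto

lemma red_free_subset: "red_free R p V \<Longrightarrow> W \<subseteq> V \<Longrightarrow> red_free R p W"
  unfolding red_free_def by blast

lemma blue_cliques_from_subset: "blue_cliques_from R K s V \<Longrightarrow> W \<subseteq> V \<Longrightarrow> blue_cliques_from R K s W"
  unfolding blue_cliques_from_def by blast

lemma red_free_red_nbs:
  assumes "red_graph R" "x \<in> V" "W \<subseteq> red_nbs R x V" "red_free R (Suc p) V"
  shows "red_free R p W"
  unfolding red_free_def
proof
  assume "\<exists>A\<subseteq>W. finite A \<and> card A = p \<and> red_clique R A"
  then obtain A where A: "A \<subseteq> W" "finite A" "card A = p" "red_clique R A" by blast
  have "\<forall>a\<in>A. R x a" using A(1) assms(3) unfolding red_nbs_def by blast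
  then have "x \<notin> A" "\<forall>a\<in>A. R a x" using red_graphD[OF assms(1)] by metis+
  then have "x \<notin> A" "red_clique R (insert x A)"
    using A(4) \<open>\<forall>a\<in>A. R x a\<close> unfolding red_clique_def by simp_all
  moreover have "insert x A \<subseteq> V" using A(1) assms(2,3) unfolding red_nbs_def by auto
  ultimately show False using A assms(4) unfolding red_free_def by (metis card_insert_disjoint finite_insert)
qed

text \<open>Ramsey's theorem for a red clique of order \<open>p\<close> against a blue one of order
  \<open>K\<close>. What matters is that one \<open>s\<close> serves all colourings and vertex
  sets.\<close>

lemma blue_cliques_exist:
  "\<exists>s\<ge>1. \<forall>(R::'a \<Rightarrow> 'a \<Rightarrow> bool) V. red_graph R \<and> finite V \<and> red_free R p V \<longrightarrow> blue_cliques_from R K s V"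
proof -
  obtain s where s: "s \<ge> 1" "\<And>(V::'a set) (E::'a set set). finite V \<and> card V \<ge> s \<Longrightarrow>
    (\<exists>R \<subseteq> V. card R = p \<and> clique R E \<or> card R = K \<and> indep R E)"
    using ramsey2[of p K] by metis
  have "blue_cliques_from R K s V" if R: "red_graph R" "finite V" "red_free R p V"
    for R :: "'a \<Rightarrow> 'a \<Rightarrow> bool" and V
    unfolding blue_cliques_from_def
  proof (intro allI impI)
    fix S assume S: "S \<subseteq> V" "s \<le> card S"
    define E where "E = {{x,y} |x y. R x y}"
    have E: "{x,y} \<in> E \<longleftrightarrow> R x y" for x y
      unfolding E_def using R(1) unfolding red_graph_def by (auto simp: doubleton_eq_iff)
    have fS: "finite S" using S R finite_subset by blast
    obtain Q where Q: "Q \<subseteq> S" "card Q = p \<and> clique Q E \<or> card Q = K \<and> indep Q E"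
      using s(2)[of S E] S fS by blast
    have "\<not> (card Q = p \<and> clique Q E)"
    proof
      assume a: "card Q = p \<and> clique Q E"
      then have "red_clique R Q" unfolding red_clique_def clique_def E by blast
      moreover have "Q \<subseteq> V" "finite Q" using Q(1) S(1) fS finite_subset by auto
      ultimately show False using a R(3) unfolding red_free_def by blast
    qed
    then have Q': "card Q = K" "indep Q E" using Q(2) by auto
    then have "blue_clique R Q"
      using red_graphD(2)[OF R(1)] unfolding indep_def E blue_clique_def by metis
    then show "\<exists>Q\<subseteq>S. card Q = K \<and> blue_clique R Q" using Q(1) Q' by blast
  qed
  then show ?thesis using s(1) by blast
qed

lemma card_blue_nbs_ge:
  assumes "finite U" "finite Q" "\<And>q. q \<in> Q \<Longrightarrow> real (card (red_nbs R q U)) \<le> b"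
  shows "real (card (blue_nbs R Q U)) \<ge> real (card U) - real (card Q) * b"
proof -
  have "U = blue_nbs R Q U \<union> (\<Union>q\<in>Q. red_nbs R q U)"
    unfolding blue_nbs_def red_nbs_def by blast
  then have "card U \<le> card (blue_nbs R Q U) + card (\<Union>q\<in>Q. red_nbs R q U)"
    by (metis card_Un_le)
  also have "\<dots> \<le> card (blue_nbs R Q U) + (\<Sum>q\<in>Q. card (red_nbs R q U))"
    using card_UN_le[OF assms(2)] by (rule add_left_mono)
  finally have "real (card U) \<le> real (card (blue_nbs R Q U) + (\<Sum>q\<in>Q. card (red_nbs R q U)))"
    by (rule of_nat_mono)
  also have "\<dots> = real (card (blue_nbs R Q U)) + (\<Sum>q\<in>Q. real (card (red_nbs R q U)))" by simp
  also have "(\<Sum>q\<in>Q. real (card (red_nbs R q U))) \<le> real (card Q) * b"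
    using sum_bounded_above[of Q "\<lambda>q. real (card (red_nbs R q U))" b] assms(3) by simp
  finally show ?thesis by linarith
qed

section \<open>Greedy embedding of trees of cliques\<close>

text \<open>The value \<open>par r\<close> is irrelevant.\<close>

definition rooted :: "'v set \<Rightarrow> ('v \<Rightarrow> 'v \<Rightarrow> bool) \<Rightarrow> 'v \<Rightarrow> ('v \<Rightarrow> 'v) \<Rightarrow> ('v \<Rightarrow> nat) \<Rightarrow> bool" where
  "rooted I E r par ord \<longleftrightarrow> r \<in> I \<and> (\<forall>v\<in>I - {r}. par v \<in> I \<and> ord (par v) < ord v) \<and>
     (\<forall>u v. E u v \<longleftrightarrow> u \<in> I \<and> v \<in> I \<and> (u \<noteq> r \<and> v = par u \<or> v \<noteq> r \<and> u = par v))"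

text \<open>A parent map with a rank decreasing towards the root stands for acyclicity. All roots
  are allowed because \<open>excess_embedding\<close> re-roots the tree at its cut vertex.\<close>

definition rootable :: "'v set \<Rightarrow> ('v \<Rightarrow> 'v \<Rightarrow> bool) \<Rightarrow> bool" where
  "rootable I E \<longleftrightarrow> finite I \<and> I \<noteq> {} \<and> (\<forall>r\<in>I. \<exists>par ord. rooted I E r par ord)"

text \<open>Members of one blown-up tree vertex are interchangeable, so sets of the right size
  suffice; \<open>D\<close> holds the tree vertices placed so far. Bijections are chosen only in
  \<open>embeds_blob_embedding\<close>.\<close>

definition blob_embedding ::
  "('a \<Rightarrow> 'a \<Rightarrow> bool) \<Rightarrow> ('v \<Rightarrow> 'v \<Rightarrow> bool) \<Rightarrow> ('v \<Rightarrow> nat) \<Rightarrow> 'a set \<Rightarrow> 'v set \<Rightarrow> ('v \<Rightarrow> 'a set) \<Rightarrow> bool" where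
  "blob_embedding R E k V D \<phi> \<longleftrightarrow>
     (\<forall>v\<in>D. \<phi> v \<subseteq> V \<and> card (\<phi> v) = k v \<and> blue_clique R (\<phi> v)) \<and>
     (\<forall>v\<in>D. \<forall>v'\<in>D. v \<noteq> v' \<longrightarrow> \<phi> v \<inter> \<phi> v' = {}) \<and>
     (\<forall>v\<in>D. \<forall>v'\<in>D. E v v' \<longrightarrow> (\<forall>x\<in>\<phi> v. \<forall>y\<in>\<phi> v'. \<not> R x y))"

definition embeds ::
  "('a \<Rightarrow> 'a \<Rightarrow> bool) \<Rightarrow> 'v set \<Rightarrow> ('v \<Rightarrow> 'v \<Rightarrow> bool) \<Rightarrow> ('v \<Rightarrow> nat) \<Rightarrow> 'a set \<Rightarrow> bool" where
  "embeds R I E k V \<longleftrightarrow> (\<exists>f :: 'v \<times> nat \<Rightarrow> 'a.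
     inj_on f (SIGMA i:I. {1..k i}) \<and> f ` (SIGMA i:I. {1..k i}) \<subseteq> V \<and>
     (\<forall>x\<in>(SIGMA i:I. {1..k i}). \<forall>y\<in>(SIGMA i:I. {1..k i}).
        x \<noteq> y \<and> (fst x = fst y \<or> E (fst x) (fst y)) \<longrightarrow> \<not> R (f x) (f y)))"

lemma embeds_mono: "embeds R I E k V \<Longrightarrow> V \<subseteq> W \<Longrightarrow> embeds R I E k W"
  unfolding embeds_def by (meson subset_trans)

lemma embeds_blob_embedding:
  assumes "blob_embedding R E k V I \<phi>" "finite V"
  shows "embeds R I E k V"
proof -
  have "\<exists>g. bij_betw g {1..k i} (\<phi> i)" if "i \<in> I" for i
  proof -
    have "\<phi> i \<subseteq> V" "card (\<phi> i) = k i" using assms(1) that unfolding blob_embedding_def by auto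
    then have "finite (\<phi> i)" "card {1..k i} = card (\<phi> i)" using assms(2) finite_subset by auto
    then show ?thesis using finite_same_card_bij by blast
  qed
  then obtain g where g: "\<And>i. i \<in> I \<Longrightarrow> bij_betw (g i) {1..k i} (\<phi> i)" by metis
  define f where "f = (\<lambda>x. g (fst x) (snd x))"
  have f: "f x \<in> \<phi> (fst x)" if "x \<in> (SIGMA i:I. {1..k i})" for x
    using that bij_betwE[OF g] unfolding f_def by auto
  have "inj_on f (SIGMA i:I. {1..k i})"
  proof (rule inj_onI)
    fix x y assume xy: "x \<in> (SIGMA i:I. {1..k i})" "y \<in> (SIGMA i:I. {1..k i})" "f x = f y"
    then have "f x \<in> \<phi> (fst x) \<inter> \<phi> (fst y)" using f by (metis IntI)
    moreover have "fst x \<in> I" "fst y \<in> I" using xy by auto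
    ultimately have 1: "fst x = fst y" using assms(1) unfolding blob_embedding_def by blast
    have "g (fst x) (snd x) = g (fst x) (snd y)" using xy(3) 1 unfolding f_def by simp
    moreover have "inj_on (g (fst x)) {1..k (fst x)}" using g \<open>fst x \<in> I\<close> bij_betw_imp_inj_on by blast
    moreover have "snd x \<in> {1..k (fst x)}" "snd y \<in> {1..k (fst x)}" using xy(1,2) 1 by (cases x; cases y; simp)+
    ultimately have "snd x = snd y" by (metis inj_onD)
    then show "x = y" using 1 by (simp add: prod_eq_iff)
  qed
  moreover have "f ` (SIGMA i:I. {1..k i}) \<subseteq> V"
  proof
    fix a assume "a \<in> f ` (SIGMA i:I. {1..k i})"
    then obtain x where x: "x \<in> (SIGMA i:I. {1..k i})" "a = f x" by blast
    then have "fst x \<in> I" by auto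
    then show "a \<in> V" using f[OF x(1)] x(2) assms(1) unfolding blob_embedding_def by blast
  qed
  moreover have "\<not> R (f x) (f y)" if xy: "x \<in> (SIGMA i:I. {1..k i})" "y \<in> (SIGMA i:I. {1..k i})"
     "fst x = fst y \<or> E (fst x) (fst y)" for x y
  proof -
    have I: "fst x \<in> I" "fst y \<in> I" using xy by auto
    from xy(3) show ?thesis
    proof
      assume "fst x = fst y"
      then show ?thesis
        using I f[OF xy(1)] f[OF xy(2)] assms(1) unfolding blob_embedding_def blue_clique_def by auto
    next
      assume "E (fst x) (fst y)"
      then show ?thesis
        using I f[OF xy(1)] f[OF xy(2)] assms(1) unfolding blob_embedding_def by blast
    qed
  qed
  ultimately show ?thesis unfolding embeds_def by blast
qed

lemma obtain_subset_card:
  assumes "n \<le> card Q" obtains P where "P \<subseteq> Q" "card P = n"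
  using assms by (metis obtain_subset_with_card_n)

text \<open>The invariant is that each placed clique has at least \<open>W + s\<close> common blue
  neighbours in \<open>U\<close>. At most \<open>W\<close> of them are ever occupied, so
  \<open>s\<close> remain, and \<open>big\<close> finds among these a clique with the same property.
  Vertices are placed by increasing \<open>ord\<close>, after their parents.\<close>

lemma greedy_extension:
  fixes s :: real
  assumes R: "red_graph R" and T: "rooted I E r par ord"
    and pe: "blob_embedding R E k V D \<phi>" and D: "D \<subseteq> I" and U: "U \<subseteq> V" "finite V"
    and UD: "\<And>d. d \<in> D \<Longrightarrow> U \<inter> \<phi> d = {}"
    and big: "\<And>S. S \<subseteq> U \<Longrightarrow> s \<le> real (card S) \<Longrightarrow>
        \<exists>P\<subseteq>S. card P = K \<and> blue_clique R P \<and> real W + s \<le> real (card (blue_nbs R P U))"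
    and U2: "real W + s \<le> real (card U)"
    and A: "finite A" "A \<subseteq> I" "A \<inter> D = {}" "sum k A \<le> W" "\<And>v. v \<in> A \<Longrightarrow> k v \<le> K"
    and H3: "\<And>d v. d \<in> D \<Longrightarrow> v \<in> A \<Longrightarrow> E d v \<Longrightarrow> real W + s \<le> real (card (blue_nbs R (\<phi> d) U))"
    and H4: "\<And>d v. d \<in> D \<Longrightarrow> v \<in> A \<Longrightarrow> d \<noteq> r \<Longrightarrow> par d \<noteq> v"
  shows "\<exists>\<phi>'. blob_embedding R E k V (D \<union> A) \<phi>' \<and> (\<forall>d\<in>D. \<phi>' d = \<phi> d) \<and>
           (\<forall>v\<in>A. \<phi>' v \<subseteq> U \<and> real W + s \<le> real (card (blue_nbs R (\<phi>' v) U)))"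
  using A H3 H4
proof (induction A rule: finite_ranking_induct[where f=ord])
  case empty then show ?case using pe by auto
next
  case (insert v A)
  show ?case
  proof (cases "v \<in> A")
    case True
    then have "insert v A = A" by blast
    then show ?thesis using insert by simp
  next
    case vA: False
    have sumA: "sum k A + k v \<le> W" using insert.prems(3) vA insert.hyps by (simp add: add.commute)
    have "\<exists>\<phi>'. blob_embedding R E k V (D \<union> A) \<phi>' \<and> (\<forall>d\<in>D. \<phi>' d = \<phi> d) \<and>
           (\<forall>v\<in>A. \<phi>' v \<subseteq> U \<and> real W + s \<le> real (card (blue_nbs R (\<phi>' v) U)))"
      by (rule insert.IH) (use insert.prems sumA in auto)
    then obtain \<phi>1 where p1: "blob_embedding R E k V (D \<union> A) \<phi>1" "\<And>d. d \<in> D \<Longrightarrow> \<phi>1 d = \<phi> d"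
      "\<And>v. v \<in> A \<Longrightarrow> \<phi>1 v \<subseteq> U" "\<And>v. v \<in> A \<Longrightarrow> real W + s \<le> real (card (blue_nbs R (\<phi>1 v) U))"
      by blast
    have vI: "v \<in> I" "v \<notin> D" using insert.prems by auto
    \<comment> \<open>Candidates for \<open>v\<close>: the common blue neighbours of the parent's
      clique, or all of \<open>U\<close> when the parent is not placed.\<close>
    define X where "X = (if v \<noteq> r \<and> par v \<in> D \<union> A then blue_nbs R (\<phi>1 (par v)) U else U)"
    have XU: "X \<subseteq> U" unfolding X_def blue_nbs_def by auto
    have fU: "finite U" using U finite_subset by blast
    have X: "real W + s \<le> real (card X)"
    proof (cases "v \<noteq> r \<and> par v \<in> D \<union> A")
      case True
      then have "E (par v) v" using T vI unfolding rooted_def by auto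
      then show ?thesis using True insert.prems(5)[of "par v" v] p1 unfolding X_def by auto
    qed (use U2 in \<open>auto simp: X_def\<close>)
    define S where "S = X - (\<Union>a\<in>A. \<phi>1 a)"
    have "card (\<Union>a\<in>A. \<phi>1 a) \<le> (\<Sum>a\<in>A. card (\<phi>1 a))" using insert.hyps by (intro card_UN_le)
    also have "\<dots> = sum k A" using p1(1) unfolding blob_embedding_def by (intro sum.cong) auto
    finally have "card (\<Union>a\<in>A. \<phi>1 a) \<le> W" using sumA by simp
    moreover have "card X - card (\<Union>a\<in>A. \<phi>1 a) \<le> card S" unfolding S_def
      using p1(3) fU by (intro diff_card_le_card_Diff finite_subset[OF _ fU]) blast
    ultimately have "s \<le> real (card S)" using X by linarith
    then obtain P0 where P0: "P0 \<subseteq> S" "card P0 = K" "blue_clique R P0"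
        "real W + s \<le> real (card (blue_nbs R P0 U))"
      using big[of S] XU unfolding S_def by blast
    \<comment> \<open>A clique of order \<open>K\<close> is found first and then cut to
      \<open>k v\<close> vertices; shrinking a set can only enlarge its common blue
      neighbourhood.\<close>
    obtain P where P: "P \<subseteq> P0" "card P = k v" using insert.prems(4) P0(2) obtain_subset_card by (metis insertI1)
    have PX: "P \<subseteq> X" "\<And>a. a \<in> A \<Longrightarrow> P \<inter> \<phi>1 a = {}" using P P0 unfolding S_def by blast+
    have PD: "P \<inter> \<phi>1 d = {}" if "d \<in> D" for d using UD that p1(2) PX XU by blast
    have "card (blue_nbs R P0 U) \<le> card (blue_nbs R P U)"
      using fU P by (intro card_mono blue_nbs_mono) auto
    then have Pg: "real W + s \<le> real (card (blue_nbs R P U))" using P0(4) by linarith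
    \<comment> \<open>The parent is the only possible placed neighbour: a child in \<open>A\<close>
      would have larger rank than \<open>v\<close>, and \<open>H4\<close> excludes a child in
      \<open>D\<close>.\<close>
    have Eadj: "v \<noteq> r \<and> d = par v" if "E d v \<or> E v d" "d \<in> D \<union> A" for d
    proof -
      have "(d \<noteq> r \<and> v = par d) \<or> (v \<noteq> r \<and> d = par v)" "d \<in> I"
        using T that unfolding rooted_def by blast+
      moreover have "\<not> (d \<noteq> r \<and> v = par d)"
      proof
        assume d: "d \<noteq> r \<and> v = par d"
        then have "ord v < ord d" using T \<open>d \<in> I\<close> unfolding rooted_def by blast
        then have "d \<notin> A" using insert.hyps by force
        then show False using that(2) insert.prems(6)[of d v] d by auto
      qed
      ultimately show ?thesis by blast
    qed
    have bl: "\<not> R x y" "\<not> R y x" if "x \<in> \<phi>1 d" "y \<in> P" "d \<in> D \<union> A" "E d v \<or> E v d" for x y d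
    proof -
      have "v \<noteq> r \<and> d = par v" using Eadj that by blast
      then have "P \<subseteq> blue_nbs R (\<phi>1 d) U" using PX(1) that(3) unfolding X_def by auto
      then show "\<not> R x y" "\<not> R y x" using that R unfolding blue_nbs_def red_graph_def by blast+
    qed
    define \<phi>2 where "\<phi>2 = \<phi>1(v := P)"
    have nv: "d \<noteq> v" if "d \<in> D \<union> A" for d using that vA vI by blast
    have nE: "\<not> E v v" using T unfolding rooted_def by (metis insertE insert_Diff nat_neq_iff)
    have c1: "blob_embedding R E k V (D \<union> insert v A) \<phi>2"
      unfolding blob_embedding_def
    proof (intro conjI ballI impI)
      fix a assume a: "a \<in> D \<union> insert v A"
      have "\<phi>2 a \<subseteq> V \<and> card (\<phi>2 a) = k a \<and> blue_clique R (\<phi>2 a)"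
      proof (cases "a = v")
        case True
        have "P \<subseteq> V" using PX XU U by blast
        then show ?thesis using True P blue_clique_subset[OF P0(3) P(1)] unfolding \<phi>2_def by simp
      next
        case False
        then have "a \<in> D \<union> A" using a by blast
        then show ?thesis using False p1(1) unfolding \<phi>2_def blob_embedding_def by simp
      qed
      then show "\<phi>2 a \<subseteq> V" "card (\<phi>2 a) = k a" "blue_clique R (\<phi>2 a)" by blast+
      fix b assume b: "b \<in> D \<union> insert v A"
      show "\<phi>2 a \<inter> \<phi>2 b = {}" if "a \<noteq> b"
      proof (cases "a = v \<or> b = v")
        case True
        have "P \<inter> \<phi>1 d = {}" if "d \<in> D \<union> A" for d using that PD PX(2) by blast
        moreover have "a = v \<and> b \<in> D \<union> A \<and> b \<noteq> v \<or> b = v \<and> a \<in> D \<union> A \<and> a \<noteq> v"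
          using True that a b by blast
        ultimately show ?thesis unfolding \<phi>2_def by (auto simp: Int_commute)
      next
        case False
        then have "a \<in> D \<union> A" "b \<in> D \<union> A" using a b by blast+
        then have "\<phi>1 a \<inter> \<phi>1 b = {}" using p1(1) that unfolding blob_embedding_def by blast
        then show ?thesis using False unfolding \<phi>2_def by simp
      qed
      show "\<not> R x y" if "E a b" "x \<in> \<phi>2 a" "y \<in> \<phi>2 b" for x y
      proof (cases "a = v")
        case True
        then have bv: "b \<noteq> v" using that(1) nE by blast
        then have "b \<in> D \<union> A" using b by blast
        then show ?thesis using that bv True bl(2)[of y b x] unfolding \<phi>2_def by simp
      next
        case False
        then have aD: "a \<in> D \<union> A" using a by blast
        show ?thesis
        proof (cases "b = v")
          case True
          then show ?thesis using that bl(1)[of x a y] aD False unfolding \<phi>2_def by simp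
        next
          case bv: False
          then have "b \<in> D \<union> A" using b by blast
          then have "\<forall>x\<in>\<phi>1 a. \<forall>y\<in>\<phi>1 b. \<not> R x y" using that(1) p1(1) aD unfolding blob_embedding_def by blast
          then show ?thesis using that False bv unfolding \<phi>2_def by simp
        qed
      qed
    qed
    have c2: "\<forall>d\<in>D. \<phi>2 d = \<phi> d" using p1(2) nv unfolding \<phi>2_def by simp
    have c3: "\<forall>a\<in>insert v A. \<phi>2 a \<subseteq> U \<and> real W + s \<le> real (card (blue_nbs R (\<phi>2 a) U))"
    proof
      fix a assume a: "a \<in> insert v A"
      have "P \<subseteq> U" using PX XU by blast
      then show "\<phi>2 a \<subseteq> U \<and> real W + s \<le> real (card (blue_nbs R (\<phi>2 a) U))"
        using p1(3)[of a] p1(4)[of a] Pg a unfolding \<phi>2_def by (cases "a = v") simp_all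
    qed
    show ?thesis by (rule exI[of _ \<phi>2], intro conjI c1 c2 c3)
  qed
qed

text \<open>If some vertex has large red degree, pass to its red neighbourhood, where the forbidden
  red clique is smaller. Otherwise all red degrees are below \<open>(K+1)^p * m\<close>, and
  \<open>K\<close> of them leave at least one such share of \<open>Y\<close>.\<close>

lemma robust_subset:
  assumes "red_graph R" "m \<ge> 1"
  shows "finite Y \<Longrightarrow> red_free R p Y \<Longrightarrow> (K+1)^p * m \<le> card Y \<Longrightarrow>
    \<exists>Y'\<subseteq>Y. m \<le> card Y' \<and> (\<forall>Q\<subseteq>Y'. card Q \<le> K \<longrightarrow> m \<le> card (blue_nbs R Q Y'))"
proof (induction p arbitrary: Y)
  case 0
  have "\<exists>A\<subseteq>Y. finite A \<and> card A = 0 \<and> red_clique R A"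
    by (rule exI[of _ "{}"]) (simp add: red_clique_def)
  then show ?case using 0 unfolding red_free_def by simp
next
  case (Suc p)
  show ?case
  proof (cases "\<exists>y\<in>Y. (K+1)^p * m \<le> card (red_nbs R y Y)")
    case True
    then obtain y where y: "y \<in> Y" "(K+1)^p * m \<le> card (red_nbs R y Y)" by blast
    have "red_free R p (red_nbs R y Y)" using red_free_red_nbs[OF assms(1) y(1) _ Suc.prems(2)] by blast
    then obtain Y' where "Y' \<subseteq> red_nbs R y Y" "m \<le> card Y' \<and> (\<forall>Q\<subseteq>Y'. card Q \<le> K \<longrightarrow> m \<le> card (blue_nbs R Q Y'))"
      using Suc.IH[of "red_nbs R y Y"] y(2) Suc.prems(1) by auto
    then show ?thesis by (meson red_nbs_sub subset_trans)
  next
    case False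
    define M where "M = (K+1)^p * m"
    have mM: "m \<le> M" unfolding M_def by simp
    have Y: "K * M + M \<le> card Y" using Suc.prems(3) unfolding M_def by (simp add: algebra_simps)
    have small: "card (red_nbs R y Y) < M" if "y \<in> Y" for y using False that unfolding M_def by force
    have big: "m \<le> card (blue_nbs R Q Y)" if Q: "Q \<subseteq> Y" "card Q \<le> K" for Q
    proof -
      have "real (card (red_nbs R q Y)) \<le> real M" if "q \<in> Q" for q
        using small[of q] that Q(1) by auto
      then have "real (card Y) - real (card Q) * real M \<le> real (card (blue_nbs R Q Y))"
        using Suc.prems(1) finite_subset[OF Q(1)] by (intro card_blue_nbs_ge) auto
      moreover have "real (card Q) * real M \<le> real K * real M" using Q(2) by (intro mult_right_mono) auto
      moreover have "real (K * M + M) \<le> real (card Y)" using Y by (rule of_nat_mono)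
      ultimately have "real M \<le> real (card (blue_nbs R Q Y))" by simp
      then show ?thesis using mM by linarith
    qed
    have "m \<le> card Y" using mM Y by linarith
    then show ?thesis using big by (intro exI[of _ Y]) simp
  qed
qed

section \<open>Cutting the tree and embedding a part of it outside a near-clique\<close>

lemma rooted_split:
  fixes k :: "'v \<Rightarrow> nat"
  assumes T: "rooted I E r par ord" and fI: "finite I" and kK: "\<And>i. i \<in> I \<Longrightarrow> k i \<le> K"
    and a: "K \<le> a" "1 \<le> a" "a + K \<le> sum k I"
  shows "\<exists>u\<in>I. \<exists>A\<subseteq>I. u \<notin> A \<and> a \<le> sum k A \<and> sum k A < 2 * a \<and>
           (\<forall>x\<in>A. \<forall>y. E x y \<longrightarrow> y \<in> A \<or> y = u)"
proof -
  \<comment> \<open>\<open>A\<close> is a union of subtrees hanging off \<open>u\<close>; a smallest one of weight at least \<open>a\<close> has weight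
    below \<open>2a\<close>, since otherwise one could split off a subtree or descend to the only child.\<close>
  define ok where "ok = (\<lambda>(u,A). u \<in> I \<and> A \<subseteq> I \<and> u \<notin> A \<and> r \<notin> A \<and> a \<le> sum k A \<and>
    (\<forall>z\<in>A. par z \<in> A \<or> par z = u) \<and> (\<forall>z\<in>I - {r}. par z \<in> A \<longrightarrow> z \<in> A))"
  have rI: "r \<in> I" and par: "\<And>v. v \<in> I \<Longrightarrow> v \<noteq> r \<Longrightarrow> par v \<in> I \<and> ord (par v) < ord v"
    using T unfolding rooted_def by auto
  have "sum k I = k r + sum k (I - {r})" using rI fI by (simp add: sum.remove)
  then have "a \<le> sum k (I - {r})" using a kK[OF rI] by linarith
  then have ex: "ok (r, I - {r})" unfolding ok_def using rI par by auto
  obtain x where x: "ok x" "\<And>y. ok y \<Longrightarrow> card (snd x) \<le> card (snd y)"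
    using ex_has_least_nat[of ok "(r, I - {r})" "\<lambda>x. card (snd x)"] ex by blast
  obtain u A where uA: "x = (u,A)" by (cases x)
  have ok: "u \<in> I" "A \<subseteq> I" "u \<notin> A" "r \<notin> A" "a \<le> sum k A"
      "\<And>z. z \<in> A \<Longrightarrow> par z \<in> A \<or> par z = u" "\<And>z. z \<in> I \<Longrightarrow> z \<noteq> r \<Longrightarrow> par z \<in> A \<Longrightarrow> z \<in> A"
    using x(1) unfolding ok_def uA by auto
  have least: "\<not> ok (u', A')" if "A' \<subset> A" for u' A'
  proof
    assume "ok (u', A')"
    then have "card A \<le> card A'" using x(2)[of "(u',A')"] uA by simp
    moreover have "finite A" using ok(2) fI finite_subset by blast
    ultimately show False using psubset_card_mono[of A A'] that by linarith
  qed
  have fA: "finite A" using ok(2) fI finite_subset by blast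
  have Ane: "A \<noteq> {}" using ok(5) a by auto
  have "sum k A < 2 * a"
  proof (rule ccontr)
    assume "\<not> sum k A < 2 * a"
    then have big: "2 * a \<le> sum k A" by simp
    \<comment> \<open>A topmost vertex of \<open>A\<close>: its parent lies outside
      \<open>A\<close>, hence is \<open>u\<close>.\<close>
    obtain v where v: "v \<in> A" "\<And>z. z \<in> A \<Longrightarrow> ord v \<le> ord z"
      using ex_min_if_finite[of "ord ` A"] fA Ane arg_min_if_finite(1)[OF fA Ane, of ord]
        arg_min_least[OF fA Ane, of _ ord] by metis
    have vI: "v \<in> I" "v \<noteq> r" using v(1) ok(2,4) by auto
    have pv: "par v = u"
    proof (rule ccontr)
      assume "par v \<noteq> u"
      then have "par v \<in> A" using ok(6) v(1) by blast
      then show False using v(2)[of "par v"] par[OF vI] by simp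
    qed
    define S where "S = {(z, par z) |z. z \<in> A}"
    \<comment> \<open>The subtree of \<open>A\<close> below \<open>v\<close>, as the vertices whose
      chain of parents leads to \<open>v\<close>.\<close>
    define D where "D = {z \<in> A. (z, v) \<in> S\<^sup>*}"
    have vD: "v \<in> D" unfolding D_def using v by simp
    have up: "par z \<in> D" if z: "z \<in> D" "z \<noteq> v" for z
    proof -
      obtain y where y: "(z, y) \<in> S" "(y, v) \<in> S\<^sup>*"
        using z unfolding D_def by (auto elim: converse_rtranclE)
      have yp: "y = par z" using y(1) unfolding S_def by auto
      have "y \<noteq> u"
      proof
        assume "y = u"
        then have "u \<noteq> v" "(u, v) \<in> S\<^sup>*" using y(2) v(1) ok(3) by auto
        then obtain y' where "(u, y') \<in> S" by (auto elim: converse_rtranclE)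
        then show False using ok(3) unfolding S_def by auto
      qed
      then have "y \<in> A" using ok(6)[of z] z(1) yp unfolding D_def by auto
      then show ?thesis using y(2) yp unfolding D_def by auto
    qed
    have down: "z \<in> D" if z: "z \<in> A" "par z \<in> D" for z
    proof -
      have "(z, par z) \<in> S" using z unfolding S_def by auto
      then show ?thesis using z unfolding D_def by (auto intro: converse_rtrancl_into_rtrancl)
    qed
    have DA: "D \<subseteq> A" unfolding D_def by auto
    show False
    proof (cases "D = A")
      case True
      \<comment> \<open>\<open>A\<close> is a single subtree, so its root \<open>v\<close> can take
        the place of \<open>u\<close>; the weight lost is at most \<open>K \<le> a\<close>, which
        leaves at least \<open>a\<close>.\<close>
      have "ok (v, A - {v})"
        unfolding ok_def prod.case
      proof (intro conjI ballI impI)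
        have "sum k A = k v + sum k (A - {v})" using v(1) fA by (simp add: sum.remove)
        then show "a \<le> sum k (A - {v})" using big kK[OF vI(1)] a by linarith
        show "par z \<in> A - {v} \<or> par z = v" if "z \<in> A - {v}" for z
          using up[of z] that True by auto
        show "z \<in> A - {v}" if "z \<in> I - {r}" "par z \<in> A - {v}" for z
          using ok(7)[of z] that pv ok(3) by auto
      qed (use vI ok in auto)
      then show False using least[of "A - {v}" v] v(1) by auto
    next
      case False
      \<comment> \<open>Both \<open>D\<close> and \<open>A - D\<close> are proper unions of subtrees
        at \<open>u\<close>, so by minimality each weighs less than \<open>a\<close>.\<close>
      have s: "sum k A = sum k D + sum k (A - D)"
        using sum.subset_diff[OF DA fA, of k] by simp
      have "ok (u, D)" if "a \<le> sum k D"
        unfolding ok_def prod.case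
      proof (intro conjI ballI impI)
        show "par z \<in> D \<or> par z = u" if "z \<in> D" for z using up[of z] that pv by auto
        show "z \<in> D" if "z \<in> I - {r}" "par z \<in> D" for z
          using ok(7)[of z] that down[of z] DA by auto
      qed (use ok DA that in auto)
      then have 1: "sum k D < a" using least[of D u] False DA by force
      have "ok (u, A - D)" if "a \<le> sum k (A - D)"
        unfolding ok_def prod.case
      proof (intro conjI ballI impI)
        show "par z \<in> A - D \<or> par z = u" if "z \<in> A - D" for z using down[of z] ok(6)[of z] that by auto
        show "z \<in> A - D" if z: "z \<in> I - {r}" "par z \<in> A - D" for z
        proof -
          have "z \<in> A" using ok(7)[of z] z by auto
          moreover have "z \<noteq> v" using pv z(2) ok(3) by auto
          then have "z \<notin> D" using up[of z] z(2) by blast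
          ultimately show ?thesis by blast
        qed
      qed (use ok DA that in auto)
      then have "sum k (A - D) < a" using least[of "A - D" u] vD v(1) by force
      then show False using 1 s big by linarith
    qed
  qed
  moreover have "y \<in> A \<or> y = u" if xy: "x \<in> A" "E x y" for x y
  proof -
    have "x \<noteq> r \<and> y = par x \<or> y \<noteq> r \<and> x = par y" "y \<in> I"
      using T xy(2) unfolding rooted_def by blast+
    then show ?thesis using ok(6)[of x] ok(7)[of y] xy(1) by auto
  qed
  ultimately show ?thesis using ok by (intro bexI[of _ u] exI[of _ A]) auto
qed

text \<open>The contrapositive of \<open>greedy_extension\<close> with nothing placed yet and
  \<open>U = V\<close>: were no such \<open>S\<close> present, the greedy procedure would never get
  stuck.\<close>

lemma not_embeds_imp_bad_set:
  fixes s :: real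
  assumes R: "red_graph R" and V: "finite V" and T: "rootable I E" and k: "\<And>i. i \<in> I \<Longrightarrow> k i \<le> K"
    and ne: "\<not> embeds R I E k V" and big: "real (sum k I) + s \<le> real (card V)"
  shows "\<exists>S\<subseteq>V. s \<le> real (card S) \<and>
    (\<forall>Q\<subseteq>S. card Q = K \<and> blue_clique R Q \<longrightarrow> real (card (blue_nbs R Q V)) < real (sum k I) + s)"
proof (rule ccontr)
  assume neg: "\<not> ?thesis"
  obtain r par ord where r: "rooted I E r par ord" using T unfolding rootable_def by blast
  have "\<exists>\<phi>'. blob_embedding R E k V ({} \<union> I) \<phi>' \<and> (\<forall>d\<in>{}. \<phi>' d = (\<lambda>_. {}) d) \<and>
           (\<forall>v\<in>I. \<phi>' v \<subseteq> V \<and> real (sum k I) + s \<le> real (card (blue_nbs R (\<phi>' v) V)))"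
  proof (rule greedy_extension[OF R r])
    show "blob_embedding R E k V {} (\<lambda>_. {})" unfolding blob_embedding_def by simp
    show "\<exists>P\<subseteq>S. card P = K \<and> blue_clique R P \<and> real (sum k I) + s \<le> real (card (blue_nbs R P V))"
      if "S \<subseteq> V" "s \<le> real (card S)" for S
      using neg that by (meson not_le)
  qed (use V T k big in \<open>auto simp: rootable_def\<close>)
  then show False using embeds_blob_embedding[of R E k V I] V ne by auto
qed

text \<open>A tree vertex \<open>u\<close> is placed into \<open>Q\<close>, a few branches at \<open>u\<close> of total weight between \<open>a\<close>
  and \<open>2a\<close> outside \<open>C\<close>, and everything else inside \<open>C\<close>, which may be slightly too small for the
  whole graph.\<close>

lemma excess_embedding:
  fixes d :: real
  assumes R: "red_graph R" and V: "finite V" and T: "rootable I E" and k: "\<And>i. i \<in> I \<Longrightarrow> k i \<le> K"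
    and p: "red_free R p V" and cl: "blue_cliques_from R K s V"
    and C: "C \<subseteq> V" and Q: "Q \<subseteq> V" "card Q = K" "blue_clique R Q"
    and d: "\<And>x. x \<in> C \<Longrightarrow> real (card (red_nbs R x C)) \<le> d"
    and a: "K \<le> a" "1 \<le> a" "a + K \<le> sum k I"
    and h1: "real (sum k I - a) + real s + real K \<le> real (card (blue_nbs R Q C))"
    and h2: "real (sum k I - a) + real s + real K \<le> real (card C) - real K * d"
    and h3: "(K+1)^p * (2 * a + s) + K \<le> card (blue_nbs R Q (V - C))"
  shows "embeds R I E k V"
proof -
  obtain r0 par0 ord0 where T0: "rooted I E r0 par0 ord0" using T unfolding rootable_def by blast
  have fI: "finite I" using T unfolding rootable_def by blast
  obtain u A where uA: "u \<in> I" "A \<subseteq> I" "u \<notin> A" "a \<le> sum k A" "sum k A < 2 * a"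
      "\<And>x y. x \<in> A \<Longrightarrow> E x y \<Longrightarrow> y \<in> A \<or> y = u"
    using rooted_split[OF T0 fI k a] by blast
  \<comment> \<open>Rooting at \<open>u\<close> makes both \<open>A\<close> and the rest of the tree
    hang below the one clique placed by hand.\<close>
  obtain par ord where Tu: "rooted I E u par ord" using T uA(1) unfolding rootable_def by blast
  have Esym: "E x y \<longleftrightarrow> E y x" for x y using Tu unfolding rooted_def by blast
  have nE: "\<not> E u u" using Tu unfolding rooted_def by blast
  obtain Q' where Q': "Q' \<subseteq> Q" "card Q' = k u" using obtain_subset_card k uA(1) Q(2) by metis
  have fQ: "finite Q" using Q(1) V finite_subset by blast
  \<comment> \<open>\<open>2 * a\<close> bounds the weight of \<open>A\<close>, so \<open>m\<close>
    is the room that the greedy invariant requires outside \<open>C\<close>.\<close>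
  define m where "m = 2 * a + s"
  define Y where "Y = blue_nbs R Q (V - C) - Q"
  have YV: "Y \<subseteq> V" "Y \<inter> C = {}" "Y \<inter> Q = {}" unfolding Y_def blue_nbs_def by auto
  have fY: "finite Y" using YV V finite_subset by blast
  have "card (blue_nbs R Q (V - C)) - card Q \<le> card Y" unfolding Y_def
    by (rule diff_card_le_card_Diff[OF fQ])
  then have "(K+1)^p * m \<le> card Y" using h3 Q(2) unfolding m_def by linarith
  moreover have "1 \<le> m" using a unfolding m_def by simp
  moreover have "red_free R p Y" using p YV red_free_subset by blast
  ultimately obtain Y' where Y': "Y' \<subseteq> Y" "m \<le> card Y'"
      "\<And>P. P \<subseteq> Y' \<Longrightarrow> card P \<le> K \<Longrightarrow> m \<le> card (blue_nbs R P Y')"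
    using robust_subset[OF R _ fY] by metis
  have Y'V: "Y' \<subseteq> V" using Y'(1) YV by blast
  define \<phi>0 where "\<phi>0 = (\<lambda>_::'b. Q')"
  have "\<exists>\<phi>'. blob_embedding R E k V ({u} \<union> A) \<phi>' \<and> (\<forall>d\<in>{u}. \<phi>' d = \<phi>0 d) \<and>
           (\<forall>v\<in>A. \<phi>' v \<subseteq> Y' \<and> real (2 * a) + real s \<le> real (card (blue_nbs R (\<phi>' v) Y')))"
  proof (rule greedy_extension[OF R Tu])
    show "blob_embedding R E k V {u} \<phi>0"
      using Q' Q blue_clique_subset[OF Q(3) Q'(1)] nE unfolding blob_embedding_def \<phi>0_def by auto
    show "{u} \<subseteq> I" using uA(1) by simp
    show "\<exists>P\<subseteq>S. card P = K \<and> blue_clique R P \<and> real (2 * a) + real s \<le> real (card (blue_nbs R P Y'))"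
      if S: "S \<subseteq> Y'" "real s \<le> real (card S)" for S
    proof -
      have "S \<subseteq> V" using S Y'V by blast
      then obtain P where P: "P \<subseteq> S" "card P = K" "blue_clique R P"
        using cl S(2) unfolding blue_cliques_from_def by auto
      have "P \<subseteq> Y'" using P(1) S(1) by blast
      then have "m \<le> card (blue_nbs R P Y')" using Y'(3) P(2) by simp
      then show ?thesis using P unfolding m_def by (intro exI[of _ P]) auto
    qed
    show "real (2 * a) + real s \<le> real (card Y')" using Y'(2) unfolding m_def by auto
    show "Y' \<inter> \<phi>0 d = {}" if "d \<in> {u}" for d using Y'(1) YV(3) Q'(1) unfolding \<phi>0_def by blast
    show "real (2 * a) + real s \<le> real (card (blue_nbs R (\<phi>0 d) Y'))" if "d \<in> {u}" for d
    proof -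
      have "Y' \<subseteq> blue_nbs R (\<phi>0 d) Y'" using Y'(1) Q'(1) unfolding \<phi>0_def Y_def blue_nbs_def by blast
      then have "blue_nbs R (\<phi>0 d) Y' = Y'" unfolding blue_nbs_def by blast
      then show ?thesis using Y'(2) unfolding m_def by auto
    qed
    show "finite A" using uA(2) fI finite_subset by blast
    show "sum k A \<le> 2 * a" using uA(5) by simp
  qed (use V Y'V uA k in auto)
  then obtain \<phi>1 where p1: "blob_embedding R E k V ({u} \<union> A) \<phi>1" "\<phi>1 u = Q'" "\<And>v. v \<in> A \<Longrightarrow> \<phi>1 v \<subseteq> Y'"
    unfolding \<phi>0_def by auto
  define U where "U = C - Q"
  have fU: "finite C" using C V finite_subset by blast
  \<comment> \<open>\<open>Q\<close> may meet \<open>C\<close>, and vertices of \<open>Q\<close>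
    must not be used again; this costs at most \<open>K\<close> candidates.\<close>
  have lose: "real (card (blue_nbs R P C)) - real K \<le> real (card (blue_nbs R P U))" for P
  proof -
    have "card (blue_nbs R P C) - card Q \<le> card (blue_nbs R P C - Q)"
      by (rule diff_card_le_card_Diff[OF fQ])
    also have "blue_nbs R P C - Q = blue_nbs R P U" unfolding U_def blue_nbs_def by auto
    finally show ?thesis using Q(2) by linarith
  qed
  define Z where "Z = I - A - {u}"
  have IZ: "I = ({u} \<union> A) \<union> Z" unfolding Z_def using uA by blast
  have "sum k I = sum k A + sum k (I - A)" using sum.subset_diff[OF uA(2) fI, of k] by simp
  moreover have "sum k Z \<le> sum k (I - A)" unfolding Z_def using fI by (intro sum_mono2) auto
  ultimately have wZ: "sum k Z \<le> sum k I - a" using uA(4) by linarith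
  have "\<exists>\<phi>'. blob_embedding R E k V (({u} \<union> A) \<union> Z) \<phi>' \<and> (\<forall>d\<in>{u} \<union> A. \<phi>' d = \<phi>1 d) \<and>
           (\<forall>v\<in>Z. \<phi>' v \<subseteq> U \<and> real (sum k I - a) + real s \<le> real (card (blue_nbs R (\<phi>' v) U)))"
  proof (rule greedy_extension[OF R Tu p1(1)])
    show "{u} \<union> A \<subseteq> I" using uA by blast
    show "U \<subseteq> V" unfolding U_def using C by blast
    show "U \<inter> \<phi>1 d = {}" if "d \<in> {u} \<union> A" for d
    proof (cases "d = u")
      case True then show ?thesis using p1(2) Q'(1) unfolding U_def by blast
    next
      case False
      then have "\<phi>1 d \<subseteq> Y'" using that p1(3) by blast
      then show ?thesis using Y'(1) YV(2) unfolding U_def by blast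
    qed
    show "\<exists>P\<subseteq>S. card P = K \<and> blue_clique R P \<and> real (sum k I - a) + real s \<le> real (card (blue_nbs R P U))"
      if S: "S \<subseteq> U" "real s \<le> real (card S)" for S
    proof -
      have "S \<subseteq> V" using S C unfolding U_def by blast
      then obtain P where P: "P \<subseteq> S" "card P = K" "blue_clique R P"
        using cl S(2) unfolding blue_cliques_from_def by auto
      have PC: "P \<subseteq> C" using P(1) S(1) unfolding U_def by blast
      have "real (card C) - real (card P) * d \<le> real (card (blue_nbs R P C))"
        using fU finite_subset[OF PC fU] d PC by (intro card_blue_nbs_ge) auto
      then have "real (sum k I - a) + real s \<le> real (card (blue_nbs R P U))"
        using lose[of P] h2 unfolding P(2) by linarith
      then show ?thesis using P by (intro exI[of _ P]) auto
    qed
    have QC: "real (sum k I - a) + real s \<le> real (card (blue_nbs R Q U))" using lose[of Q] h1 by linarith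
    moreover have "card (blue_nbs R Q U) \<le> card U"
      using fU unfolding U_def by (intro card_mono blue_nbs_sub) auto
    ultimately show "real (sum k I - a) + real s \<le> real (card U)" by linarith
    show "finite Z" "Z \<subseteq> I" "Z \<inter> ({u} \<union> A) = {}" unfolding Z_def using fI by auto
    show "k v \<le> K" if "v \<in> Z" for v using that k unfolding Z_def by auto
    show "real (sum k I - a) + real s \<le> real (card (blue_nbs R (\<phi>1 d) U))"
      if dv: "d \<in> {u} \<union> A" "v \<in> Z" "E d v" for d v
    proof -
      have "d = u" using dv uA(6)[of d v] unfolding Z_def by auto
      have "card (blue_nbs R Q U) \<le> card (blue_nbs R Q' U)"
        using fU Q'(1) unfolding U_def by (intro card_mono blue_nbs_mono) auto
      then show ?thesis using QC \<open>d = u\<close> p1(2) by simp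
    qed
    \<comment> \<open>The branches in \<open>A\<close> have no neighbour besides \<open>u\<close>
      outside \<open>A\<close>, so none of them has its parent among the vertices still to be
      placed.\<close>
    show "par x \<noteq> v" if dv: "x \<in> {u} \<union> A" "v \<in> Z" "x \<noteq> u" for x v
    proof
      assume "par x = v"
      then have "E x v" using Tu dv uA(2) unfolding rooted_def Z_def by blast
      then show False using dv uA(6)[of x v] unfolding Z_def by auto
    qed
  qed (use V wZ in auto)
  then obtain \<phi>2 where "blob_embedding R E k V I \<phi>2" using IZ by auto
  then show ?thesis using embeds_blob_embedding V by blast
qed

lemma common_blue_nbs:
  fixes d :: real
  assumes fX: "finite X" and fZ: "finite Z" and cl: "blue_cliques_from R K t X" and d0: "0 < d"
    and d: "\<And>x. x \<in> X \<Longrightarrow> d \<le> real (card (blue_nbs R {x} Z))" and X: "X \<noteq> {}"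
    and XZ: "2 * real t * real (card Z) \<le> d * real (card X)"
  shows "\<exists>Q\<subseteq>X. card Q = K \<and> blue_clique R Q \<and> d / 2 / 2 ^ card X \<le> real (card (blue_nbs R Q Z))"
proof -
  \<comment> \<open>Many \<open>z \<in> Z\<close> have at least \<open>t\<close> blue neighbours in \<open>X\<close>, hence a clique \<open>q z\<close> among them;
    there are at most \<open>2 ^ card X\<close> possibilities for \<open>q z\<close>.\<close>
  define N where "N z = {x \<in> X. \<not> R x z}" for z
  define L where "L = card X"
  have L: "0 < L" unfolding L_def using fX X by (simp add: card_gt_0_iff)
  define Z1 where "Z1 = {z \<in> Z. t \<le> card (N z)}"
  have fZ1: "finite Z1" unfolding Z1_def using fZ by simp
  have "(\<Sum>x\<in>X. card {z\<in>Z. \<not> R x z}) = (\<Sum>z\<in>Z. card {x\<in>X. \<not> R x z})"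
    using sum_multicount_gen[OF fX fZ, of "\<lambda>x z. \<not> R x z" "\<lambda>z. card {x\<in>X. \<not> R x z}"] by simp
  moreover have "blue_nbs R {x} Z = {z\<in>Z. \<not> R x z}" for x unfolding blue_nbs_def by auto
  ultimately have dc: "(\<Sum>x\<in>X. real (card (blue_nbs R {x} Z))) = (\<Sum>z\<in>Z. real (card (N z)))"
    unfolding N_def by (metis (no_types, lifting) of_nat_sum sum.cong)
  have "real L * d \<le> (\<Sum>x\<in>X. real (card (blue_nbs R {x} Z)))"
    unfolding L_def using sum_bounded_below[of X d "\<lambda>x. real (card (blue_nbs R {x} Z))"] d by simp
  also have "\<dots> = (\<Sum>z\<in>Z1. real (card (N z))) + (\<Sum>z\<in>Z - Z1. real (card (N z)))"
    unfolding dc using sum.subset_diff[of Z1 Z "\<lambda>z. real (card (N z))"] fZ by (simp add: Z1_def)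
  also have "\<dots> \<le> real (card Z1) * real L + real (card Z) * real t"
  proof (rule add_mono)
    have "card (N z) \<le> L" for z unfolding N_def L_def using fX by (intro card_mono) auto
    then show "(\<Sum>z\<in>Z1. real (card (N z))) \<le> real (card Z1) * real L"
      using sum_bounded_above[of Z1 "\<lambda>z. real (card (N z))" "real L"] by simp
    have "(\<Sum>z\<in>Z - Z1. real (card (N z))) \<le> real (card (Z - Z1)) * real t"
    proof (rule sum_bounded_above)
      fix z assume "z \<in> Z - Z1"
      then show "real (card (N z)) \<le> real t" unfolding Z1_def by auto
    qed
    also have "\<dots> \<le> real (card Z) * real t"
      using fZ by (intro mult_right_mono of_nat_mono card_mono) auto
    finally show "(\<Sum>z\<in>Z - Z1. real (card (N z))) \<le> real (card Z) * real t" .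
  qed
  finally have "real L * d \<le> real (card Z1) * real L + real (card Z) * real t" .
  \<comment> \<open>By \<open>XZ\<close> the vertices with fewer than \<open>t\<close> blue
    neighbours in \<open>X\<close> account for at most half of the total count.\<close>
  moreover have "2 * (real (card Z) * real t) \<le> real L * d"
    using XZ unfolding L_def by (simp add: ac_simps)
  ultimately have "real L * d \<le> real (card Z1) * real L + real L * d / 2" by linarith
  then have "real L * (d / 2) \<le> real L * real (card Z1)" by (simp add: algebra_simps)
  then have Z1: "d / 2 \<le> real (card Z1)" using L by simp
  have "\<exists>Q\<subseteq>N z. card Q = K \<and> blue_clique R Q" if "z \<in> Z1" for z
    using cl that unfolding blue_cliques_from_def Z1_def N_def by auto
  then obtain q where q: "\<And>z. z \<in> Z1 \<Longrightarrow> q z \<subseteq> N z \<and> card (q z) = K \<and> blue_clique R (q z)" by metis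
  have qX: "q ` Z1 \<subseteq> Pow X" using q unfolding N_def by blast
  have fq: "finite (q ` Z1)" using fZ1 by simp
  have cq: "card (q ` Z1) \<le> 2 ^ L"
    using card_mono[OF _ qX] fX unfolding L_def by (simp add: card_Pow)
  \<comment> \<open>Every \<open>z\<close> with \<open>q z = Q\<close> is blue to all of
    \<open>Q\<close>, so a large fibre of \<open>q\<close> is a large common neighbourhood.\<close>
  have fib: "card {z\<in>Z1. q z = Q} \<le> card (blue_nbs R Q Z)" for Q
    using fZ q unfolding Z1_def N_def blue_nbs_def by (intro card_mono) auto
  show ?thesis
  proof (rule ccontr)
    assume neg: "\<not> ?thesis"
    have small: "real (card {z\<in>Z1. q z = Q}) < d / 2 / 2 ^ L" if Q: "Q \<in> q ` Z1" for Q
    proof -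
      have "Q \<subseteq> X \<and> card Q = K \<and> blue_clique R Q" using Q q qX by auto
      then have "\<not> d / 2 / 2 ^ L \<le> real (card (blue_nbs R Q Z))" using neg unfolding L_def by blast
      then show ?thesis using fib[of Q] by linarith
    qed
    have "Z1 \<noteq> {}" using Z1 d0 by auto
    have "Z1 = (\<Union>Q\<in>q ` Z1. {z\<in>Z1. q z = Q})" by auto
    then have "card Z1 \<le> (\<Sum>Q\<in>q ` Z1. card {z\<in>Z1. q z = Q})" using card_UN_le[OF fq] by metis
    then have "real (card Z1) \<le> real (\<Sum>Q\<in>q ` Z1. card {z\<in>Z1. q z = Q})" by (rule of_nat_mono)
    also have "\<dots> = (\<Sum>Q\<in>q ` Z1. real (card {z\<in>Z1. q z = Q}))" by simp
    also have "\<dots> < (\<Sum>Q\<in>q ` Z1. d / 2 / 2 ^ L)"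
      using small fq \<open>Z1 \<noteq> {}\<close> by (intro sum_strict_mono) auto
    also have "\<dots> = real (card (q ` Z1)) * (d / 2 / 2 ^ L)" by simp
    also have "\<dots> \<le> 2 ^ L * (d / 2 / 2 ^ L)"
    proof (rule mult_right_mono)
      show "real (card (q ` Z1)) \<le> 2 ^ L" using of_nat_mono[OF cq, where 'a=real] by simp
    qed (use d0 in simp)
    also have "\<dots> = d / 2" by simp
    finally show False using Z1 by simp
  qed
qed

section \<open>Sets with few red cliques\<close>

text \<open>A substitute for ``many red cliques of order \<open>r\<close>'' that avoids counting tuples.\<close>

fun rich :: "('a \<Rightarrow> 'a \<Rightarrow> bool) \<Rightarrow> real \<Rightarrow> nat \<Rightarrow> 'a set \<Rightarrow> bool" where
  "rich R c 0 U \<longleftrightarrow> True"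
| "rich R c (Suc r) U \<longleftrightarrow> c \<le> real (card {x\<in>U. rich R c r (red_nbs R x U)})"

text \<open>For large \<open>S\<close> inside a bad set these are the exceptional vertices that get
  deleted; all others have red density at least \<open>\<theta>\<close> into
  \<open>S\<close>.\<close>

definition sparse_to :: "('a \<Rightarrow> 'a \<Rightarrow> bool) \<Rightarrow> real \<Rightarrow> 'a set \<Rightarrow> 'a set \<Rightarrow> 'a set" where
  "sparse_to R \<theta> S V = {w\<in>V. real (card (red_nbs R w S)) < \<theta> * real (card S)}"

lemma rich_mono: "finite V \<Longrightarrow> U \<subseteq> V \<Longrightarrow> rich R c r U \<Longrightarrow> rich R c r V"
proof (induction r arbitrary: U V)
  case (Suc r)
  have "{x\<in>U. rich R c r (red_nbs R x U)} \<subseteq> {x\<in>V. rich R c r (red_nbs R x V)}"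
  proof
    fix x assume x: "x \<in> {x\<in>U. rich R c r (red_nbs R x U)}"
    have "red_nbs R x U \<subseteq> red_nbs R x V" using Suc.prems(2) unfolding red_nbs_def by auto
    then have "rich R c r (red_nbs R x V)"
      using Suc.IH[of "red_nbs R x V" "red_nbs R x U"] Suc.prems(1) x by auto
    then show "x \<in> {x\<in>V. rich R c r (red_nbs R x V)}" using x Suc.prems(2) by auto
  qed
  then have "card {x\<in>U. rich R c r (red_nbs R x U)} \<le> card {x\<in>V. rich R c r (red_nbs R x V)}"
    using Suc.prems(1) by (intro card_mono) auto
  then show ?case using Suc.prems(3) by simp
qed simp

lemma rich_not_red_free:
  assumes "red_graph R" "0 < c"
  shows "rich R c r U \<Longrightarrow> \<not> red_free R r U"
proof (induction r arbitrary: U)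
  case 0
  have "\<exists>A\<subseteq>U. finite A \<and> card A = 0 \<and> red_clique R A"
    by (rule exI[of _ "{}"]) (simp add: red_clique_def)
  then show ?case unfolding red_free_def by simp
next
  case (Suc r)
  then have "0 < real (card {x\<in>U. rich R c r (red_nbs R x U)})" using assms(2) by simp
  then have "{x\<in>U. rich R c r (red_nbs R x U)} \<noteq> {}" by (metis card.empty of_nat_0 less_irrefl)
  then obtain x where x: "x \<in> U" "rich R c r (red_nbs R x U)" by blast
  show ?case using Suc.IH[OF x(2)] red_free_red_nbs[OF assms(1) x(1) subset_refl] by metis
qed

text \<open>Red cliques of order \<open>r\<close> in \<open>V2\<close> gain one more vertex in
  \<open>S0\<close>. Choosing a clique vertex that is not sparse to the current \<open>S\<close>
  replaces \<open>S\<close> by its red neighbours there, a fraction at least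
  \<open>\<theta>\<close>; after \<open>r\<close> choices \<open>\<theta> ^ r * card S0\<close>
  candidates remain for the last vertex. Discarding sparse vertices costs less than \<open>g\<close>
  at each level.\<close>

lemma rich_extend:
  fixes \<theta> c c' g :: real
  assumes V: "finite V" "V2 \<subseteq> V" "S0 \<subseteq> V" and \<theta>: "0 < \<theta>" "\<theta> \<le> 1"
    and c: "c' \<le> c - g" "c' \<le> \<theta> ^ r * real (card S0)"
    and few: "\<And>S. S \<subseteq> S0 \<Longrightarrow> \<theta> ^ r * real (card S0) \<le> real (card S) \<Longrightarrow>
        real (card (sparse_to R \<theta> S V2)) < g"
  shows "j \<le> r \<Longrightarrow> A \<subseteq> V2 \<Longrightarrow> S \<subseteq> S0 \<Longrightarrow> \<theta> ^ (r - j) * real (card S0) \<le> real (card S) \<Longrightarrow>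
    rich R c j A \<Longrightarrow> rich R c' (Suc j) (A \<union> S)"
proof (induction j arbitrary: A S)
  case 0
  have "finite (A \<union> S)" using V 0 by (meson finite_Un finite_subset)
  then have "card S \<le> card (A \<union> S)" by (intro card_mono) auto
  moreover have "\<theta> ^ r * real (card S0) \<le> real (card S)" using 0(4) by simp
  ultimately have "c' \<le> real (card (A \<union> S))" using c(2) by linarith
  moreover have "{x\<in>A \<union> S. rich R c' 0 (red_nbs R x (A \<union> S))} = A \<union> S" by auto
  ultimately show ?case by (metis rich.simps(2))
next
  case (Suc j)
  have fin: "finite (A \<union> S)" using V Suc.prems by (meson finite_Un finite_subset)
  have "\<theta> ^ r \<le> \<theta> ^ (r - Suc j)" using \<theta> by (intro power_decreasing) auto
  then have "\<theta> ^ r * real (card S0) \<le> \<theta> ^ (r - Suc j) * real (card S0)" by (intro mult_right_mono) auto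
  then have few': "real (card (sparse_to R \<theta> S V2)) < g" using few[of S] Suc.prems(3,4) by linarith
  define X where "X = {x\<in>A. rich R c j (red_nbs R x A)}"
  have X: "c \<le> real (card X)" using Suc.prems(5) unfolding X_def by simp
  have "X - sparse_to R \<theta> S V2 \<subseteq> {x\<in>A \<union> S. rich R c' (Suc j) (red_nbs R x (A \<union> S))}"
  proof
    fix x assume x: "x \<in> X - sparse_to R \<theta> S V2"
    then have xA: "x \<in> A" "rich R c j (red_nbs R x A)" unfolding X_def by auto
    have "x \<in> V2" using xA Suc.prems(2) by auto
    then have d: "\<theta> * real (card S) \<le> real (card (red_nbs R x S))"
      using x unfolding sparse_to_def by auto
    have "\<theta> ^ (r - j) * real (card S0) = \<theta> * (\<theta> ^ (r - Suc j) * real (card S0))"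
      using Suc.prems(1) by (metis Suc_diff_le diff_Suc_Suc power_Suc mult.assoc)
    also have "\<dots> \<le> \<theta> * real (card S)" using Suc.prems(4) \<theta> by (intro mult_left_mono) auto
    finally have "\<theta> ^ (r - j) * real (card S0) \<le> real (card (red_nbs R x S))" using d by linarith
    then have "rich R c' (Suc j) (red_nbs R x A \<union> red_nbs R x S)"
      using Suc.prems xA(2) by (intro Suc.IH) (auto simp: red_nbs_def)
    moreover have "red_nbs R x A \<union> red_nbs R x S = red_nbs R x (A \<union> S)" unfolding red_nbs_def by auto
    ultimately show "x \<in> {x\<in>A \<union> S. rich R c' (Suc j) (red_nbs R x (A \<union> S))}"
      using xA(1) by simp
  qed
  then have "card (X - sparse_to R \<theta> S V2) \<le> card {x\<in>A \<union> S. rich R c' (Suc j) (red_nbs R x (A \<union> S))}"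
    using fin by (intro card_mono) auto
  moreover have "finite (sparse_to R \<theta> S V2)"
    using V unfolding sparse_to_def by (simp add: finite_subset)
  then have "card X - card (sparse_to R \<theta> S V2) \<le> card (X - sparse_to R \<theta> S V2)"
    by (rule diff_card_le_card_Diff)
  ultimately have "c' \<le> real (card {x\<in>A \<union> S. rich R c' (Suc j) (red_nbs R x (A \<union> S))})"
    using X few' c(1) by linarith
  then show ?case by (subst rich.simps)
qed

text \<open>Double counting: at least half of \<open>S\<close> has red degree at most
  \<open>2 * \<sigma> * card D\<close> into \<open>D\<close>, and that half is large enough to
  contain a blue clique of order \<open>K\<close>.\<close>

lemma blue_clique_of_sparse:
  fixes \<sigma> :: real
  assumes R: "red_graph R" and f: "finite D" "finite S" and \<sigma>: "0 < \<sigma>"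
    and sp: "\<And>w. w \<in> D \<Longrightarrow> real (card (red_nbs R w S)) \<le> \<sigma> * real (card S)"
    and cl: "blue_cliques_from R K s S" and s: "1 \<le> s" "2 * s \<le> card S"
  shows "\<exists>Q\<subseteq>S. card Q = K \<and> blue_clique R Q \<and>
           (1 - 2 * real K * \<sigma>) * real (card D) \<le> real (card (blue_nbs R Q D))"
proof -
  define S' where "S' = {x\<in>S. real (card (red_nbs R x D)) \<le> 2 * \<sigma> * real (card D)}"
  have fS': "finite S'" "S' \<subseteq> S" unfolding S'_def using f by auto
  have "s \<le> card S'"
  proof (cases "D = {}")
    case True
    then have "S' = S" unfolding S'_def red_nbs_def by auto
    then show ?thesis using s by simp
  next
    case False
    then have D0: "0 < \<sigma> * real (card D)" using f \<sigma> by (simp add: card_gt_0_iff)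
    have "(\<Sum>x\<in>S. card {w\<in>D. R x w}) = (\<Sum>w\<in>D. card {x\<in>S. R x w})"
      using sum_multicount_gen[OF f(2) f(1), of R "\<lambda>w. card {x\<in>S. R x w}"] by simp
    also have "\<dots> = (\<Sum>w\<in>D. card {x\<in>S. R w x})"
    proof -
      have "{x\<in>S. R x w} = {x\<in>S. R w x}" for w using red_graphD(1)[OF R] by blast
      then show ?thesis by simp
    qed
    finally have dc: "(\<Sum>x\<in>S. card (red_nbs R x D)) = (\<Sum>w\<in>D. card (red_nbs R w S))"
      unfolding red_nbs_def .
    have "real (card (S - S')) * (2 * \<sigma> * real (card D)) \<le> (\<Sum>x\<in>S - S'. real (card (red_nbs R x D)))"
      by (rule sum_bounded_below) (auto simp: S'_def)
    also have "\<dots> \<le> (\<Sum>x\<in>S. real (card (red_nbs R x D)))" using f by (intro sum_mono2) auto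
    also have "\<dots> = real (\<Sum>x\<in>S. card (red_nbs R x D))" by simp
    also have "\<dots> = (\<Sum>w\<in>D. real (card (red_nbs R w S)))" unfolding dc by simp
    also have "\<dots> \<le> real (card D) * (\<sigma> * real (card S))" by (rule sum_bounded_above) (rule sp)
    finally have "(\<sigma> * real (card D)) * (2 * real (card (S - S'))) \<le> (\<sigma> * real (card D)) * real (card S)"
      by (simp add: ac_simps)
    then have "2 * real (card (S - S')) \<le> real (card S)" using D0 by (rule mult_left_le_imp_le)
    moreover have "card (S - S') = card S - card S'" using fS' by (simp add: card_Diff_subset)
    ultimately show ?thesis using s(2) by linarith
  qed
  then obtain Q where Q: "Q \<subseteq> S'" "card Q = K" "blue_clique R Q"
    using cl fS' unfolding blue_cliques_from_def by blast
  have "real (card (red_nbs R q D)) \<le> 2 * \<sigma> * real (card D)" if "q \<in> Q" for q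
    using Q(1) that unfolding S'_def by auto
  then have "real (card D) - real (card Q) * (2 * \<sigma> * real (card D)) \<le> real (card (blue_nbs R Q D))"
    using f Q(1) fS' finite_subset by (intro card_blue_nbs_ge) auto
  then have "(1 - 2 * real K * \<sigma>) * real (card D) \<le> real (card (blue_nbs R Q D))"
    unfolding Q(2) by (simp add: algebra_simps)
  then show ?thesis using Q fS' by (intro exI[of _ Q]) auto
qed

text \<open>This replaces the regularity lemma.  If \<open>V\<close> has few red cliques of order \<open>r + 1\<close> while the
  vertices that are not sparse to \<open>S\<close> contain many of order \<open>r\<close>, then by \<open>rich_extend\<close> some subset
  of \<open>S\<close> has \<open>c / 2 * N\<close> new vertices sparse to it.  The threshold \<open>\<theta>\<close> must grow along the
  way, so that vertices sparse to \<open>S\<close> remain sparse to its subset.\<close>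

lemma sparse_chain:
  fixes \<sigma> \<eta> c :: real
  assumes \<sigma>: "0 < \<sigma>" "\<sigma> \<le> 1" and \<eta>: "0 < \<eta>" and c: "0 < c"
  shows "\<forall>\<theta>. 0 < \<theta> \<and> \<theta> \<le> \<sigma> \<longrightarrow> (\<exists>\<kappa>>0. \<forall>(R :: 'a \<Rightarrow> 'a \<Rightarrow> bool) V S0 N c'.
     finite V \<and> S0 \<subseteq> V \<and> \<eta> * N \<le> real (card S0) \<and> 0 < N \<and> c' \<le> \<kappa> \<and> c' \<le> c / 2 \<and>
     \<not> rich R (c' * N) (Suc r) V \<and>
     (\<forall>S\<subseteq>S0. \<kappa> * N \<le> real (card S) \<longrightarrow> rich R (c * N) r (V - sparse_to R \<sigma> S V)) \<longrightarrow>
     (\<exists>S\<subseteq>S0. \<kappa> * N \<le> real (card S) \<and> real j * (c / 2 * N) \<le> real (card (sparse_to R \<theta> S V))))"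
proof (induction j)
  case 0
  show ?case using \<eta> by (intro allI impI exI[of _ \<eta>]) auto
next
  case (Suc j)
  show ?case
  proof (intro allI impI)
    fix \<theta> :: real assume \<theta>: "0 < \<theta> \<and> \<theta> \<le> \<sigma>"
    \<comment> \<open>The factor by which \<open>rich_extend\<close> may shrink \<open>S\<close>.
      Density below \<open>\<tau> * \<theta>\<close> into \<open>S\<close> implies density below
      \<open>\<theta>\<close> into a subset of that size, so the induction hypothesis is used at
      \<open>\<tau> * \<theta>\<close>.\<close>
    define \<tau> where "\<tau> = \<theta> ^ r"
    have \<tau>: "0 < \<tau>" "\<tau> \<le> 1" unfolding \<tau>_def using \<theta> \<sigma> by (auto intro: power_le_one)
    have "\<tau> * \<theta> \<le> 1 * \<theta>" using \<tau> \<theta> by (intro mult_right_mono) auto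
    then have t2: "\<tau> * \<theta> \<le> \<sigma>" using \<theta> by linarith
    have "0 < \<tau> * \<theta>" using \<tau> \<theta> by simp
    note t = this t2
    obtain \<kappa>' where k': "\<kappa>' > 0" "\<And>(R :: 'a \<Rightarrow> 'a \<Rightarrow> bool) V S0 N c'.
     finite V \<and> S0 \<subseteq> V \<and> \<eta> * N \<le> real (card S0) \<and> 0 < N \<and> c' \<le> \<kappa>' \<and> c' \<le> c / 2 \<and>
     \<not> rich R (c' * N) (Suc r) V \<and>
     (\<forall>S\<subseteq>S0. \<kappa>' * N \<le> real (card S) \<longrightarrow> rich R (c * N) r (V - sparse_to R \<sigma> S V)) \<Longrightarrow>
     (\<exists>S\<subseteq>S0. \<kappa>' * N \<le> real (card S) \<and> real j * (c / 2 * N) \<le> real (card (sparse_to R (\<tau> * \<theta>) S V)))"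
      using Suc.IH[rule_format, OF conjI[OF t]] by metis
    define \<kappa> where "\<kappa> = \<tau> * \<kappa>'"
    have k: "0 < \<kappa>" "\<kappa> \<le> \<kappa>'" unfolding \<kappa>_def using \<tau> k'(1) by auto
    have main: "\<exists>S\<subseteq>S0. \<kappa> * N \<le> real (card S) \<and> real (Suc j) * (c / 2 * N) \<le> real (card (sparse_to R \<theta> S V))"
      if V: "finite V" "S0 \<subseteq> V" and S0: "\<eta> * N \<le> real (card S0)" and N: "0 < N"
       and c': "c' \<le> \<kappa>" "c' \<le> c / 2" and nr: "\<not> rich R (c' * N) (Suc r) V"
       and ri: "\<And>S. S \<subseteq> S0 \<Longrightarrow> \<kappa> * N \<le> real (card S) \<Longrightarrow> rich R (c * N) r (V - sparse_to R \<sigma> S V)"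
      for R :: "'a \<Rightarrow> 'a \<Rightarrow> bool" and V S0 N c'
    proof -
      have kN: "\<kappa> * N \<le> \<kappa>' * N" using k N by (intro mult_right_mono) auto
      have "\<exists>S\<subseteq>S0. \<kappa>' * N \<le> real (card S) \<and> real j * (c / 2 * N) \<le> real (card (sparse_to R (\<tau> * \<theta>) S V))"
      proof (rule k'(2), intro conjI allI impI)
        show "rich R (c * N) r (V - sparse_to R \<sigma> S V)" if "S \<subseteq> S0" "\<kappa>' * N \<le> real (card S)" for S
          using ri[of S] that kN by linarith
      qed (use V S0 N c' nr k in auto)
      then obtain S where S: "S \<subseteq> S0" "\<kappa>' * N \<le> real (card S)"
          "real j * (c / 2 * N) \<le> real (card (sparse_to R (\<tau> * \<theta>) S V))" by blast
      have SV: "S \<subseteq> V" using S(1) V(2) by blast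
      define V2 where "V2 = V - sparse_to R \<sigma> S V"
      have r2: "rich R (c * N) r V2" unfolding V2_def using ri[OF S(1)] S(2) kN by linarith
      have kS: "\<kappa> * N \<le> \<tau> * real (card S)"
        using mult_left_mono[OF S(2), of \<tau>] \<tau> unfolding \<kappa>_def by (simp add: ac_simps)
      \<comment> \<open>If no such \<open>S'\<close> existed, the red cliques of order
        \<open>r\<close> in \<open>V2\<close> could all be extended into \<open>S\<close>, and
        \<open>V\<close> would have many of order \<open>r + 1\<close>.\<close>
      have "\<exists>S'\<subseteq>S. \<tau> * real (card S) \<le> real (card S') \<and> c / 2 * N \<le> real (card (sparse_to R \<theta> S' V2))"
      proof (rule ccontr)
        assume neg: "\<not> ?thesis"
        have "rich R (c' * N) (Suc r) (V2 \<union> S)"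
        proof (rule rich_extend[where V=V and ?V2.0=V2 and ?S0.0=S and \<theta>=\<theta> and c="c * N" and g="c / 2 * N" and r=r])
          show "c' * N \<le> c * N - c / 2 * N" using mult_right_mono[OF c'(2), of N] N by simp
          have "c' * N \<le> \<kappa> * N" using c'(1) N by simp
          then show "c' * N \<le> \<theta> ^ r * real (card S)" using kS unfolding \<tau>_def by linarith
          show "real (card (sparse_to R \<theta> S' V2)) < c / 2 * N"
            if "S' \<subseteq> S" "\<theta> ^ r * real (card S) \<le> real (card S')" for S'
          proof -
            have "\<not> c / 2 * N \<le> real (card (sparse_to R \<theta> S' V2))"
              using neg that unfolding \<tau>_def by blast
            then show ?thesis by simp
          qed
        qed (use V SV \<theta> \<sigma> r2 in \<open>auto simp: V2_def\<close>)
        moreover have "V2 \<union> S \<subseteq> V" unfolding V2_def using SV by blast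
        ultimately show False using nr rich_mono V(1) by blast
      qed
      then obtain S' where S': "S' \<subseteq> S" "\<tau> * real (card S) \<le> real (card S')"
        "c / 2 * N \<le> real (card (sparse_to R \<theta> S' V2))" by blast
      have fS: "finite S" using SV V(1) finite_subset by blast
      have sub1: "sparse_to R (\<tau> * \<theta>) S V \<subseteq> sparse_to R \<theta> S' V"
      proof
        fix w assume w: "w \<in> sparse_to R (\<tau> * \<theta>) S V"
        have "real (card (red_nbs R w S')) \<le> real (card (red_nbs R w S))"
          using S'(1) fS by (intro of_nat_mono card_mono) (auto simp: red_nbs_def)
        also have "real (card (red_nbs R w S)) < \<theta> * (\<tau> * real (card S))"
          using w unfolding sparse_to_def by (simp add: ac_simps)
        also have "\<dots> \<le> \<theta> * real (card S')" using S'(2) \<theta> by (intro mult_left_mono) auto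
        finally show "w \<in> sparse_to R \<theta> S' V" using w unfolding sparse_to_def by auto
      qed
      have sub2: "sparse_to R \<theta> S' V2 \<subseteq> sparse_to R \<theta> S' V" unfolding sparse_to_def V2_def by auto
      \<comment> \<open>Old exceptional vertices are sparse to \<open>S\<close> at a level at most
        \<open>\<sigma>\<close>, hence were removed from \<open>V2\<close>; this is why those found
        in \<open>V2\<close> are new.\<close>
      have dis: "sparse_to R (\<tau> * \<theta>) S V \<inter> sparse_to R \<theta> S' V2 = {}"
      proof -
        have "\<tau> * \<theta> * real (card S) \<le> \<sigma> * real (card S)" using t by (intro mult_right_mono) auto
        then show ?thesis unfolding V2_def sparse_to_def by auto
      qed
      have fsp: "finite (sparse_to R x T W)" if "finite W" for x T W using that unfolding sparse_to_def by simp
      have fV2: "finite V2" unfolding V2_def using V(1) by simp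
      have "card (sparse_to R (\<tau> * \<theta>) S V) + card (sparse_to R \<theta> S' V2)
          = card (sparse_to R (\<tau> * \<theta>) S V \<union> sparse_to R \<theta> S' V2)"
        using dis fsp V(1) fV2 by (simp add: card_Un_disjoint)
      also have "\<dots> \<le> card (sparse_to R \<theta> S' V)"
        using sub1 sub2 fsp[OF V(1)] by (intro card_mono) auto
      finally have "real (card (sparse_to R (\<tau> * \<theta>) S V)) + real (card (sparse_to R \<theta> S' V2))
          \<le> real (card (sparse_to R \<theta> S' V))" by linarith
      then have "real (Suc j) * (c / 2 * N) \<le> real (card (sparse_to R \<theta> S' V))"
        using S(3) S'(3) by (simp add: distrib_right)
      moreover have "S' \<subseteq> S0" "\<kappa> * N \<le> real (card S')" using S' S(1) kS by auto
      ultimately show ?thesis by (intro exI[of _ S']) auto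
    qed
    show "\<exists>\<kappa>>0. \<forall>(R :: 'a \<Rightarrow> 'a \<Rightarrow> bool) V S0 N c'.
     finite V \<and> S0 \<subseteq> V \<and> \<eta> * N \<le> real (card S0) \<and> 0 < N \<and> c' \<le> \<kappa> \<and> c' \<le> c / 2 \<and>
     \<not> rich R (c' * N) (Suc r) V \<and>
     (\<forall>S\<subseteq>S0. \<kappa> * N \<le> real (card S) \<longrightarrow> rich R (c * N) r (V - sparse_to R \<sigma> S V)) \<longrightarrow>
     (\<exists>S\<subseteq>S0. \<kappa> * N \<le> real (card S) \<and> real (Suc j) * (c / 2 * N) \<le> real (card (sparse_to R \<theta> S V)))"
      by (rule exI[of _ \<kappa>], intro conjI allI impI, rule k(1), elim conjE, rule main; (assumption | blast))
  qed
qed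

text \<open>A blue clique inside a large subset \<open>S\<close> of the bad set is blue to nearly
  all vertices sparse to \<open>S\<close>, so at most \<open>(1 + \<epsilon>) * N\<close> vertices
  are. If deleting them always left many red cliques of order \<open>r\<close>,
  \<open>sparse_chain\<close> would yield more exceptional vertices than \<open>V\<close>
  contains.\<close>

lemma few_cliques_step:
  fixes c \<epsilon> B :: real
  assumes c: "0 < c" and \<epsilon>: "0 < \<epsilon>" "\<epsilon> \<le> 1" and s: "1 \<le> s"
  shows "\<exists>c'>0. \<exists>N0. \<forall>(R :: 'a \<Rightarrow> 'a \<Rightarrow> bool) V N.
     red_graph R \<and> finite V \<and> real (card V) \<le> B * N \<and> N0 \<le> N \<and> 0 < N \<and> blue_cliques_from R K s V \<and>
     \<not> rich R (c' * N) (Suc r) V \<and>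
     (\<exists>S\<subseteq>V. \<epsilon> / 3 * N \<le> real (card S) \<and>
        (\<forall>Q\<subseteq>S. card Q = K \<and> blue_clique R Q \<longrightarrow> real (card (blue_nbs R Q V)) < N + \<epsilon> / 3 * N)) \<longrightarrow>
     (\<exists>V2\<subseteq>V. real (card V) - (1 + \<epsilon>) * N \<le> real (card V2) \<and> \<not> rich R (c * N) r V2)"
proof -
  define \<sigma> where "\<sigma> = \<epsilon> / (8 * (real K + 1))"
  have \<sigma>0: "0 < \<sigma>" unfolding \<sigma>_def using \<epsilon> by simp
  have \<sigma>1: "\<sigma> \<le> 1" unfolding \<sigma>_def using \<epsilon> by (simp add: field_simps)
  have "2 * real K * \<epsilon> \<le> \<epsilon> / 4 * (8 * (real K + 1))" using \<epsilon> by (simp add: field_simps)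
  then have \<sigma>K: "2 * real K * \<sigma> \<le> \<epsilon> / 4" unfolding \<sigma>_def by (simp add: field_simps)
  \<comment> \<open>After \<open>j\<close> rounds of \<open>c / 2 * N\<close> new vertices each, the
    count exceeds the bound \<open>B * N\<close> on \<open>card V\<close>.\<close>
  obtain j :: nat where j: "B / (c / 2) < real j" using reals_Archimedean2 by blast
  then have j: "B < real j * (c / 2)" using c by (simp add: field_simps)
  have "\<epsilon> / 3 > 0" using \<epsilon> by simp
  then obtain \<kappa> where \<kappa>: "\<kappa> > 0" "\<And>(R :: 'a \<Rightarrow> 'a \<Rightarrow> bool) V S0 N c'.
     finite V \<and> S0 \<subseteq> V \<and> \<epsilon> / 3 * N \<le> real (card S0) \<and> 0 < N \<and> c' \<le> \<kappa> \<and> c' \<le> c / 2 \<and>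
     \<not> rich R (c' * N) (Suc r) V \<and>
     (\<forall>S\<subseteq>S0. \<kappa> * N \<le> real (card S) \<longrightarrow> rich R (c * N) r (V - sparse_to R \<sigma> S V)) \<Longrightarrow>
     (\<exists>S\<subseteq>S0. \<kappa> * N \<le> real (card S) \<and> real j * (c / 2 * N) \<le> real (card (sparse_to R \<sigma> S V)))"
    using sparse_chain[OF \<sigma>0 \<sigma>1 _ c, of "\<epsilon> / 3" r j] \<sigma>0 by (metis order_refl)
  define c' where "c' = min \<kappa> (c / 2)"
  have c': "0 < c'" "c' \<le> \<kappa>" "c' \<le> c / 2" unfolding c'_def using \<kappa> c by auto
  have main: "\<exists>V2\<subseteq>V. real (card V) - (1 + \<epsilon>) * N \<le> real (card V2) \<and> \<not> rich R (c * N) r V2"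
    if R: "red_graph R" and V: "finite V" "real (card V) \<le> B * N" and N: "2 * real s / \<kappa> \<le> N" "0 < N"
      and cl: "blue_cliques_from R K s V" and nr: "\<not> rich R (c' * N) (Suc r) V"
      and S0: "S0 \<subseteq> V" "\<epsilon> / 3 * N \<le> real (card S0)"
       "\<And>Q. Q \<subseteq> S0 \<Longrightarrow> card Q = K \<and> blue_clique R Q \<Longrightarrow> real (card (blue_nbs R Q V)) < N + \<epsilon> / 3 * N"
    for R :: "'a \<Rightarrow> 'a \<Rightarrow> bool" and V S0 N
  proof (rule ccontr)
    assume neg: "\<not> ?thesis"
    have ri: "rich R (c * N) r (V - sparse_to R \<sigma> S V)"
      if S: "S \<subseteq> S0" "\<kappa> * N \<le> real (card S)" for S
    proof -
      define D where "D = sparse_to R \<sigma> S V"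
      have DV: "D \<subseteq> V" unfolding D_def sparse_to_def by auto
      have SV: "S \<subseteq> V" using S(1) S0(1) by blast
      have fS: "finite S" "finite D" using SV DV V(1) finite_subset by auto
      have "2 * real s \<le> \<kappa> * N" using N(1) \<kappa>(1) by (simp add: field_simps)
      then have s2: "2 * s \<le> card S" using S(2) by linarith
      obtain Q where Q: "Q \<subseteq> S" "card Q = K" "blue_clique R Q"
         "(1 - 2 * real K * \<sigma>) * real (card D) \<le> real (card (blue_nbs R Q D))"
        using blue_clique_of_sparse[OF R fS(2,1) \<sigma>0 _ blue_cliques_from_subset[OF cl SV] s s2]
        unfolding D_def sparse_to_def by force
      have "Q \<subseteq> S0" using Q(1) S(1) by blast
      then have "real (card (blue_nbs R Q V)) < N + \<epsilon> / 3 * N" using S0(3) Q by blast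
      moreover have "card (blue_nbs R Q D) \<le> card (blue_nbs R Q V)"
        using V(1) DV by (intro card_mono blue_nbs_mono) auto
      moreover have "(1 - \<epsilon> / 4) * real (card D) \<le> (1 - 2 * real K * \<sigma>) * real (card D)"
        using \<sigma>K by (intro mult_right_mono) auto
      ultimately have D: "(1 - \<epsilon> / 4) * real (card D) < N + \<epsilon> / 3 * N" using Q(4) by linarith
      \<comment> \<open>For \<open>\<epsilon> \<le> 1\<close> the product
        \<open>(1 - \<epsilon> / 4) * (1 + \<epsilon>)\<close> is at least
        \<open>1 + \<epsilon> / 2\<close>, above the bound
        \<open>1 + \<epsilon> / 3\<close>.\<close>
      have "real (card D) \<le> (1 + \<epsilon>) * N"
      proof (rule ccontr)
        assume "\<not> real (card D) \<le> (1 + \<epsilon>) * N"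
        then have "(1 - \<epsilon> / 4) * ((1 + \<epsilon>) * N) \<le> (1 - \<epsilon> / 4) * real (card D)"
          using \<epsilon> by (intro mult_left_mono) auto
        then have "(1 - \<epsilon> / 4) * (1 + \<epsilon>) * N < (1 + \<epsilon> / 3) * N" using D by (simp add: algebra_simps)
        then have "(1 - \<epsilon> / 4) * (1 + \<epsilon>) < 1 + \<epsilon> / 3" using N(2) by simp
        moreover have "(1 - \<epsilon> / 4) * (1 + \<epsilon>) = 1 + 3 * \<epsilon> / 4 - \<epsilon> * \<epsilon> / 4" by (simp add: field_simps)
        moreover have "\<epsilon> * \<epsilon> \<le> \<epsilon>" using \<epsilon> by (simp add: mult_left_le)
        ultimately show False using \<epsilon>(1) by linarith
      qed
      moreover have "card (V - D) = card V - card D" "card D \<le> card V"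
        using DV fS V(1) by (simp_all add: card_Diff_subset card_mono)
      ultimately have "real (card V) - (1 + \<epsilon>) * N \<le> real (card (V - D))" by linarith
      moreover have "V - D \<subseteq> V" by blast
      ultimately show ?thesis using neg unfolding D_def by blast
    qed
    have "\<exists>S\<subseteq>S0. \<kappa> * N \<le> real (card S) \<and> real j * (c / 2 * N) \<le> real (card (sparse_to R \<sigma> S V))"
      by (rule \<kappa>(2)) (use V S0 N c' nr ri in auto)
    then obtain S where "real j * (c / 2 * N) \<le> real (card (sparse_to R \<sigma> S V))" by blast
    also have "\<dots> \<le> real (card V)" using V(1) unfolding sparse_to_def by (intro of_nat_mono card_mono) auto
    also have "\<dots> \<le> B * N" by (rule V(2))
    finally have "(real j * (c / 2)) * N \<le> B * N" by (simp add: mult.assoc)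
    then show False using j N(2) by simp
  qed
  show ?thesis
    by (rule exI[of _ c'], intro conjI exI[of _ "2 * real s / \<kappa>"] allI impI, rule c'(1), elim conjE exE,
        rule main; (assumption | blast))
qed

text \<open>Each round of \<open>few_cliques_step\<close> lowers the order of the rare red cliques
  by one and costs little more than \<open>sum k I\<close> vertices. The remaining set admits no
  embedding either, so it has a bad set of its own.\<close>

lemma not_embeds_imp_few_red_edges:
  fixes B :: real
  assumes s: "1 \<le> s"
  shows "\<forall>\<epsilon> c. 0 < \<epsilon> \<and> 0 < c \<longrightarrow> (\<exists>c'>0. \<exists>\<delta>>0. \<exists>N0.
    \<forall>(R :: 'a \<Rightarrow> 'a \<Rightarrow> bool) V I (E :: 'v \<Rightarrow> 'v \<Rightarrow> bool) k.
     red_graph R \<and> finite V \<and> blue_cliques_from R K s V \<and> rootable I E \<and> (\<forall>i\<in>I. k i \<le> K) \<and>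
     N0 \<le> real (sum k I) \<and> (real (Suc r) - \<delta>) * real (sum k I) \<le> real (card V) \<and>
     real (card V) \<le> B * real (sum k I) \<and>
     \<not> rich R (c' * real (sum k I)) (Suc (Suc r)) V \<and> \<not> embeds R I E k V \<longrightarrow>
     (\<exists>U\<subseteq>V. (1 - \<epsilon>) * real (sum k I) \<le> real (card U) \<and> \<not> rich R (c * real (sum k I)) 2 U))"
proof (induction r)
  case 0
  show ?case
  proof (intro allI impI)
    fix \<epsilon> c :: real assume "0 < \<epsilon> \<and> 0 < c"
    then show "\<exists>c'>0. \<exists>\<delta>>0. \<exists>N0.
    \<forall>(R :: 'a \<Rightarrow> 'a \<Rightarrow> bool) V I (E :: 'v \<Rightarrow> 'v \<Rightarrow> bool) k.
     red_graph R \<and> finite V \<and> blue_cliques_from R K s V \<and> rootable I E \<and> (\<forall>i\<in>I. k i \<le> K) \<and>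
     N0 \<le> real (sum k I) \<and> (real (Suc 0) - \<delta>) * real (sum k I) \<le> real (card V) \<and>
     real (card V) \<le> B * real (sum k I) \<and>
     \<not> rich R (c' * real (sum k I)) (Suc (Suc 0)) V \<and> \<not> embeds R I E k V \<longrightarrow>
     (\<exists>U\<subseteq>V. (1 - \<epsilon>) * real (sum k I) \<le> real (card U) \<and> \<not> rich R (c * real (sum k I)) 2 U)"
      by (intro exI[of _ c] exI[of _ \<epsilon>] conjI) (auto simp: numeral_2_eq_2 simp del: rich.simps)
  qed
next
  case (Suc r)
  show ?case
  proof (intro allI impI)
    fix \<epsilon> c :: real assume ec: "0 < \<epsilon> \<and> 0 < c"
    from Suc.IH[rule_format, OF ec] obtain c1 \<delta>1 N1 where IH: "c1 > 0" "\<delta>1 > 0"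
     "\<forall>(R :: 'a \<Rightarrow> 'a \<Rightarrow> bool) V I (E :: 'v \<Rightarrow> 'v \<Rightarrow> bool) k.
     red_graph R \<and> finite V \<and> blue_cliques_from R K s V \<and> rootable I E \<and> (\<forall>i\<in>I. k i \<le> K) \<and>
     N1 \<le> real (sum k I) \<and> (real (Suc r) - \<delta>1) * real (sum k I) \<le> real (card V) \<and>
     real (card V) \<le> B * real (sum k I) \<and>
     \<not> rich R (c1 * real (sum k I)) (Suc (Suc r)) V \<and> \<not> embeds R I E k V \<longrightarrow>
     (\<exists>U\<subseteq>V. (1 - \<epsilon>) * real (sum k I) \<le> real (card U) \<and> \<not> rich R (c * real (sum k I)) 2 U)"
      by - (elim exE conjE, rule that; assumption)
    define \<epsilon>1 where "\<epsilon>1 = min 1 (\<delta>1 / 2)"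
    have e1: "0 < \<epsilon>1" "\<epsilon>1 \<le> 1" "\<epsilon>1 \<le> \<delta>1 / 2" unfolding \<epsilon>1_def using IH(2) by auto
    from few_cliques_step[OF IH(1) e1(1,2) s, of B K "Suc (Suc r)"]
    obtain c2 N2 where st: "c2 > 0" "\<forall>(R :: 'a \<Rightarrow> 'a \<Rightarrow> bool) V N.
     red_graph R \<and> finite V \<and> real (card V) \<le> B * N \<and> N2 \<le> N \<and> 0 < N \<and> blue_cliques_from R K s V \<and>
     \<not> rich R (c2 * N) (Suc (Suc (Suc r))) V \<and>
     (\<exists>S\<subseteq>V. \<epsilon>1 / 3 * N \<le> real (card S) \<and>
        (\<forall>Q\<subseteq>S. card Q = K \<and> blue_clique R Q \<longrightarrow> real (card (blue_nbs R Q V)) < N + \<epsilon>1 / 3 * N)) \<longrightarrow>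
     (\<exists>V2\<subseteq>V. real (card V) - (1 + \<epsilon>1) * N \<le> real (card V2) \<and> \<not> rich R (c1 * N) (Suc (Suc r)) V2)"
      by - (elim exE conjE, rule that; assumption)
    \<comment> \<open>\<open>\<delta>\<close> and \<open>\<epsilon>1\<close> together stay within
      the tolerance \<open>\<delta>1\<close> of the smaller case; \<open>1 / 2\<close> keeps
      \<open>V\<close> large enough to contain a bad set.\<close>
    define \<delta> where "\<delta> = min (1 / 2) (\<delta>1 / 2)"
    have \<delta>: "0 < \<delta>" "\<delta> \<le> 1 / 2" "\<delta> \<le> \<delta>1 / 2" unfolding \<delta>_def using IH(2) by auto
    define N0 where "N0 = max 1 (max N1 N2)"
    have main: "\<exists>U\<subseteq>V. (1 - \<epsilon>) * real (sum k I) \<le> real (card U) \<and> \<not> rich R (c * real (sum k I)) 2 U"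
      if R: "red_graph R" and V: "finite V" and cl: "blue_cliques_from R K s V" and T: "rootable I E"
        and k: "\<forall>i\<in>I. k i \<le> K"
        and N0: "N0 \<le> real (sum k I)" and big: "(real (Suc (Suc r)) - \<delta>) * real (sum k I) \<le> real (card V)"
        and B: "real (card V) \<le> B * real (sum k I)"
        and nr: "\<not> rich R (c2 * real (sum k I)) (Suc (Suc (Suc r))) V" and ne: "\<not> embeds R I E k V"
      for R :: "'a \<Rightarrow> 'a \<Rightarrow> bool" and V I and E :: "'v \<Rightarrow> 'v \<Rightarrow> bool" and k
    proof -
      define N where "N = real (sum k I)"
      have N: "1 \<le> N" "N1 \<le> N" "N2 \<le> N" using N0 unfolding N_def N0_def by auto
      have "(1 + \<epsilon>1 / 3) * N \<le> (real (Suc (Suc r)) - \<delta>) * N"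
        using N e1 \<delta> by (intro mult_right_mono) auto
      then have bigV: "N + \<epsilon>1 / 3 * N \<le> real (card V)" using big unfolding N_def[symmetric] by (simp add: algebra_simps)
      have "\<exists>S\<subseteq>V. \<epsilon>1 / 3 * N \<le> real (card S) \<and>
          (\<forall>Q\<subseteq>S. card Q = K \<and> blue_clique R Q \<longrightarrow> real (card (blue_nbs R Q V)) < N + \<epsilon>1 / 3 * N)"
        unfolding N_def
        by (rule not_embeds_imp_bad_set[OF R V T bspec[OF k] ne bigV[unfolded N_def]])
      then obtain V2 where V2: "V2 \<subseteq> V" "real (card V) - (1 + \<epsilon>1) * N \<le> real (card V2)"
          "\<not> rich R (c1 * N) (Suc (Suc r)) V2"
        using st(2)[rule_format, of R V N] R V B N cl nr unfolding N_def[symmetric] by auto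
      have "(real (Suc r) - \<delta>1) * N \<le> (real (Suc (Suc r)) - \<delta> - (1 + \<epsilon>1)) * N"
        using N e1 \<delta> by (intro mult_right_mono) auto
      also have "\<dots> = (real (Suc (Suc r)) - \<delta>) * N - (1 + \<epsilon>1) * N" by (simp add: algebra_simps)
      also have "\<dots> \<le> real (card V2)" using big V2(2) unfolding N_def[symmetric] by linarith
      finally have b2: "(real (Suc r) - \<delta>1) * N \<le> real (card V2)" .
      have "card V2 \<le> card V" using V V2(1) by (rule card_mono)
      then have "\<exists>U\<subseteq>V2. (1 - \<epsilon>) * real (sum k I) \<le> real (card U) \<and> \<not> rich R (c * real (sum k I)) 2 U"
        using R finite_subset[OF V2(1) V] blue_cliques_from_subset[OF cl V2(1)] T k N(2) b2 B V2(3)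
          embeds_mono[of R I E k V2 V] V2(1) ne unfolding N_def by (intro IH(3)[rule_format]) auto
      then show ?thesis using V2(1) by (meson subset_trans)
    qed
    show "\<exists>c'>0. \<exists>\<delta>>0. \<exists>N0.
    \<forall>(R :: 'a \<Rightarrow> 'a \<Rightarrow> bool) V I (E :: 'v \<Rightarrow> 'v \<Rightarrow> bool) k.
     red_graph R \<and> finite V \<and> blue_cliques_from R K s V \<and> rootable I E \<and> (\<forall>i\<in>I. k i \<le> K) \<and>
     N0 \<le> real (sum k I) \<and> (real (Suc (Suc r)) - \<delta>) * real (sum k I) \<le> real (card V) \<and>
     real (card V) \<le> B * real (sum k I) \<and>
     \<not> rich R (c' * real (sum k I)) (Suc (Suc (Suc r))) V \<and> \<not> embeds R I E k V \<longrightarrow>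
     (\<exists>U\<subseteq>V. (1 - \<epsilon>) * real (sum k I) \<le> real (card U) \<and> \<not> rich R (c * real (sum k I)) 2 U)"
      by (rule exI[of _ c2], intro exI[of _ \<delta>] exI[of _ N0] conjI allI impI, rule st(1), rule \<delta>(1),
          elim conjE, rule main; assumption)
  qed
qed

section \<open>Stability\<close>

text \<open>Among \<open>L\<close> vertices with linearly many blue neighbours outside
  \<open>C\<close>, \<open>common_blue_nbs\<close> finds a clique \<open>Q\<close> with linearly
  many common ones, and \<open>excess_embedding\<close> applies. \<open>L\<close> does not depend on
  the order of the tree: this is the bound on the number of exceptional vertices.\<close>

lemma excess_embedding_asymptotic:
  fixes d B :: real
  assumes d: "0 < d" "d \<le> 1" and B: "0 \<le> B"
  shows "\<exists>\<gamma>>0. \<exists>L N0. \<forall>(R :: 'a \<Rightarrow> 'a \<Rightarrow> bool) V I (E :: 'v \<Rightarrow> 'v \<Rightarrow> bool) k C X.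
     red_graph R \<and> finite V \<and> rootable I E \<and> (\<forall>i\<in>I. k i \<le> K) \<and> red_free R p V \<and>
     blue_cliques_from R K s V \<and> N0 \<le> real (sum k I) \<and> real (card V) \<le> B * real (sum k I) \<and>
     C \<subseteq> V \<and> (1 - \<gamma>) * real (sum k I) \<le> real (card C) \<and>
     (\<forall>x\<in>C. real (card (red_nbs R x C)) \<le> \<gamma> * real (sum k I)) \<and>
     X \<subseteq> V \<and> L \<le> card X \<and>
     (\<forall>x\<in>X. real (card (red_nbs R x C)) \<le> \<gamma> * real (sum k I) \<and>
            d * real (sum k I) \<le> real (card (blue_nbs R {x} (V - C)))) \<longrightarrow>
     embeds R I E k V"
proof -
  \<comment> \<open>The size at which the averaging condition of \<open>common_blue_nbs\<close>
    holds; it is fixed by \<open>s\<close>, \<open>B\<close> and \<open>d\<close> alone.\<close>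
  obtain L0 :: nat where L0: "2 * real s * B / d < real L0" using reals_Archimedean2 by blast
  define L where "L = Suc L0"
  have L: "2 * real s * B \<le> d * real L" using L0 d unfolding L_def by (simp add: field_simps)
  define c where "c = d / 2 / 2 ^ L"
  have c0: "0 < c" unfolding c_def using d by simp
  have "c \<le> d / 2 / 1" unfolding c_def using d by (intro divide_left_mono) auto
  then have c1: "c \<le> 1 / 2" using d by simp
  define M where "M = (K + 1) ^ p"
  have M1: "1 \<le> real M" unfolding M_def by simp
  \<comment> \<open>A weight of about \<open>(K + 2) * \<gamma> * N\<close> will leave
    \<open>C\<close>: one share for the shortfall of \<open>C\<close>, \<open>K\<close> shares for
    red neighbours of a clique, one for \<open>s + K\<close>. The factor \<open>4 * M\<close> lets
    the moved part, inflated by \<open>robust_subset\<close>, fit into the \<open>c * N\<close>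
    common neighbours outside \<open>C\<close>.\<close>
  define \<gamma> where "\<gamma> = c / (4 * real M * (real K + 2))"
  have g0: "0 < \<gamma>" unfolding \<gamma>_def using c0 M1 by simp
  define \<beta> where "\<beta> = (real K + 2) * \<gamma>"
  have b0: "0 < \<beta>" unfolding \<beta>_def using g0 by (simp add: add_nonneg_pos)
  have "x * (c / (4 * real M * x)) = c / (4 * real M)" if "0 < x" for x using that M1 by (simp add: field_simps)
  then have "\<beta> = c / (4 * real M)" unfolding \<beta>_def \<gamma>_def by (simp add: add_nonneg_pos)
  then have bM: "2 * real M * \<beta> = c / 2" using M1 by simp
  have "2 * 1 * \<beta> \<le> 2 * real M * \<beta>" using M1 b0 by (intro mult_right_mono) auto
  then have b1: "\<beta> \<le> 1 / 2" using bM c1 by linarith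
  define N0 where "N0 = Max {1, 2 * (real K + 1), (real s + real K + 1) / \<gamma>,
     2 * (real M * (2 + real s) + real K) / c}"
  have N0: "1 \<le> N0" "2 * (real K + 1) \<le> N0" "(real s + real K + 1) / \<gamma> \<le> N0"
     "2 * (real M * (2 + real s) + real K) / c \<le> N0"
    unfolding N0_def by (rule Max_ge; simp)+
  have main: "embeds R I E k V"
    if R: "red_graph R" and V: "finite V" and T: "rootable I E" and k: "\<forall>i\<in>I. k i \<le> K"
      and p: "red_free R p V" and cl: "blue_cliques_from R K s V"
      and NN: "N0 \<le> real (sum k I)" and VB: "real (card V) \<le> B * real (sum k I)"
      and C: "C \<subseteq> V" "(1 - \<gamma>) * real (sum k I) \<le> real (card C)"
      and Cr: "\<forall>x\<in>C. real (card (red_nbs R x C)) \<le> \<gamma> * real (sum k I)"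
      and X: "X \<subseteq> V" "L \<le> card X"
      and Xr: "\<forall>x\<in>X. real (card (red_nbs R x C)) \<le> \<gamma> * real (sum k I) \<and>
            d * real (sum k I) \<le> real (card (blue_nbs R {x} (V - C)))"
    for R :: "'a \<Rightarrow> 'a \<Rightarrow> bool" and V I and E :: "'v \<Rightarrow> 'v \<Rightarrow> bool" and k C X
  proof -
    define N where "N = real (sum k I)"
    have N: "1 \<le> N" "2 * real K + 2 \<le> N" using N0 NN unfolding N_def by (auto simp: distrib_left)
    have "(real s + real K + 1) / \<gamma> \<le> N" using N0 NN unfolding N_def by linarith
    then have Ng: "real s + real K + 1 \<le> \<gamma> * N" using g0 by (simp add: field_simps)
    have "2 * (real M * (2 + real s) + real K) / c \<le> N" using N0 NN unfolding N_def by linarith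
    then have Nc: "real M * (2 + real s) + real K \<le> c / 2 * N" using c0 by (simp add: field_simps)
    \<comment> \<open>Exactly \<open>L\<close> vertices are kept, so that the loss
      \<open>2 ^ card X'\<close> is a constant.\<close>
    obtain X' where X': "X' \<subseteq> X" "card X' = L" using obtain_subset_card[OF X(2)] by blast
    have X'V: "X' \<subseteq> V" using X' X(1) by blast
    have fX: "finite X'" "X' \<noteq> {}" "X' \<subseteq> V" using X'V X'(2) finite_subset[OF X'V V] unfolding L_def by auto
    have fC: "finite C" using C V finite_subset by blast
    have "card (V - C) \<le> card V" using V by (intro card_mono) auto
    then have "real (card (V - C)) \<le> B * N" using VB unfolding N_def by linarith
    then have "2 * real s * real (card (V - C)) \<le> 2 * real s * (B * N)" by (intro mult_left_mono) auto
    also have "\<dots> = (2 * real s * B) * N" by simp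
    also have "\<dots> \<le> (d * real L) * N" using L N by (intro mult_right_mono) auto
    finally have cond: "2 * real s * real (card (V - C)) \<le> d * N * real (card X')"
      using X'(2) by (simp add: ac_simps)
    have "\<exists>Q\<subseteq>X'. card Q = K \<and> blue_clique R Q \<and> d * N / 2 / 2 ^ card X' \<le> real (card (blue_nbs R Q (V - C)))"
      by (rule common_blue_nbs[OF fX(1) _ blue_cliques_from_subset[OF cl fX(3)] _ _ fX(2) cond])
         (use V d N X' Xr in \<open>auto simp: N_def\<close>)
    then obtain Q where Q: "Q \<subseteq> X'" "card Q = K" "blue_clique R Q"
      "d * N / 2 / 2 ^ L \<le> real (card (blue_nbs R Q (V - C)))" using X'(2) by blast
    have Qc: "c * N \<le> real (card (blue_nbs R Q (V - C)))" using Q(4) unfolding c_def by simp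
    define a where "a = nat \<lceil>\<beta> * N\<rceil>"
    have a: "\<beta> * N \<le> real a" "real a \<le> \<beta> * N + 1" 
    proof -
      have "0 \<le> \<beta> * N" using b0 N by simp
      then have "real a = of_int \<lceil>\<beta> * N\<rceil>" unfolding a_def by simp
      then show "\<beta> * N \<le> real a" "real a \<le> \<beta> * N + 1" using ceiling_correct[of "\<beta> * N"] by linarith+
    qed
    have bN: "\<beta> * N = (real K + 2) * (\<gamma> * N)" unfolding \<beta>_def by simp
    have gN: "1 \<le> \<gamma> * N" using Ng by linarith
    have K1: "real K * 1 \<le> real K * (\<gamma> * N)" using gN by (intro mult_left_mono) auto
    have bK: "\<beta> * N = real K * (\<gamma> * N) + 2 * (\<gamma> * N)" unfolding bN by (simp add: algebra_simps)
    have "\<beta> * N \<le> 1 / 2 * N" using b1 N by (intro mult_right_mono) auto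
    then have "\<beta> * N \<le> N / 2" by simp
    then have "real a + real K \<le> N" using a(2) N by linarith
    then have aK: "real (a + K) \<le> N" by simp
    have aK': "a + K \<le> sum k I" using aK unfolding N_def by linarith
    have sa: "real (sum k I - a) = N - real a" unfolding N_def using aK' by simp
    have C': "N - \<gamma> * N \<le> real (card C)" using C(2) unfolding N_def by (simp add: algebra_simps)
    have QV: "Q \<subseteq> V" "finite Q" using Q(1) X'V finite_subset[OF Q(1) fX(1)] by auto
    have "real (card C) - real (card Q) * (\<gamma> * N) \<le> real (card (blue_nbs R Q C))"
      using fC QV Xr Q(1) X'(1) unfolding N_def by (intro card_blue_nbs_ge) auto
    then have QC: "real (card C) - real K * (\<gamma> * N) \<le> real (card (blue_nbs R Q C))" unfolding Q(2) .
    have low: "N - real a + real s + real K \<le> real (card C) - real K * (\<gamma> * N)"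
      using C' a(1) bK Ng by linarith
    have "real (M * (2 * a + s) + K) \<le> real M * (2 * (\<beta> * N) + (2 + real s)) + real K"
      using a(2) M1 by simp
    also have "\<dots> = 2 * real M * \<beta> * N + (real M * (2 + real s) + real K)" by (simp add: algebra_simps)
    also have "\<dots> \<le> c / 2 * N + c / 2 * N" unfolding bM using Nc by linarith
    also have "\<dots> \<le> real (card (blue_nbs R Q (V - C)))" using Qc by (simp add: mult.commute)
    finally have h3: "M * (2 * a + s) + K \<le> card (blue_nbs R Q (V - C))" by linarith
    show ?thesis
    proof (rule excess_embedding[OF R V T bspec[OF k] p cl C(1) QV(1) Q(2,3) _ _ _ aK'])
      show "real (card (red_nbs R x C)) \<le> \<gamma> * N" if "x \<in> C" for x using Cr that unfolding N_def by blast
      show "K \<le> a" using a(1) bK K1 gN by linarith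
      show "1 \<le> a" using a(1) bK K1 gN by linarith
      show "real (sum k I - a) + real s + real K \<le> real (card (blue_nbs R Q C))"
        unfolding sa using low QC by linarith
      show "real (sum k I - a) + real s + real K \<le> real (card C) - real K * (\<gamma> * N)"
        unfolding sa using low by linarith
      show "(K + 1) ^ p * (2 * a + s) + K \<le> card (blue_nbs R Q (V - C))" using h3 unfolding M_def .
    qed
  qed
  show ?thesis
    by (rule exI[of _ \<gamma>], intro exI[of _ L] exI[of _ N0] conjI allI impI, rule g0,
        elim conjE, rule main; assumption)
qed

text \<open>Blueness inside a block is left to be derived: with \<open>q\<close> blocks, small
  \<open>\<epsilon>\<close> and no red clique of order \<open>q + 1\<close>, a red edge inside one
  block would extend through the other blocks to such a clique.\<close>

definition blue_blocks ::
  "('a \<Rightarrow> 'a \<Rightarrow> bool) \<Rightarrow> real \<Rightarrow> real \<Rightarrow> nat \<Rightarrow> 'a set \<Rightarrow> (nat \<Rightarrow> 'a set) \<Rightarrow> bool" where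
  "blue_blocks R \<epsilon> N q V C \<longleftrightarrow> (\<forall>i<q. C i \<subseteq> V \<and> (1 - \<epsilon>) * N \<le> real (card (C i))) \<and>
     (\<forall>i<q. \<forall>j<q. i \<noteq> j \<longrightarrow> C i \<inter> C j = {} \<and> (\<forall>x\<in>C i. real (card (blue_nbs R {x} (C j))) \<le> \<epsilon> * N))"

text \<open>Markov's inequality for the non-red pairs between \<open>A\<close> and
  \<open>A'\<close>, counted from both sides.\<close>

lemma few_large_blue_degrees:
  fixes e t :: real
  assumes R: "red_graph R" and f: "finite A" "finite A'"
    and A: "\<And>x. x \<in> A \<Longrightarrow> real (card (blue_nbs R {x} A')) \<le> e"
  shows "real (card {y\<in>A'. t < real (card (blue_nbs R {y} A))}) * t \<le> real (card A) * e"
proof -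
  define D where "D = {y\<in>A'. t < real (card (blue_nbs R {y} A))}"
  have bn: "blue_nbs R {x} W = {w\<in>W. \<not> R x w}" for x W unfolding blue_nbs_def by auto
  have sw: "{x\<in>A. \<not> R x y} = {x\<in>A. \<not> R y x}" for y using red_graphD(1)[OF R] by blast
  have "(\<Sum>x\<in>A. card {y\<in>A'. \<not> R x y}) = (\<Sum>y\<in>A'. card {x\<in>A. \<not> R x y})"
    using sum_multicount_gen[OF f, of "\<lambda>x y. \<not> R x y" "\<lambda>y. card {x\<in>A. \<not> R x y}"] by simp
  then have dc: "(\<Sum>x\<in>A. card (blue_nbs R {x} A')) = (\<Sum>y\<in>A'. card (blue_nbs R {y} A))"
    unfolding bn sw .
  have "real (card D) * t \<le> (\<Sum>y\<in>D. real (card (blue_nbs R {y} A)))"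
    by (rule sum_bounded_below) (auto simp: D_def)
  also have "\<dots> \<le> (\<Sum>y\<in>A'. real (card (blue_nbs R {y} A)))"
    using f by (intro sum_mono2) (auto simp: D_def)
  also have "\<dots> = real (\<Sum>x\<in>A. card (blue_nbs R {x} A'))" unfolding dc by simp
  also have "\<dots> = (\<Sum>x\<in>A. real (card (blue_nbs R {x} A')))" by simp
  also have "\<dots> \<le> real (card A) * e" by (rule sum_bounded_above) (rule A)
  finally show ?thesis unfolding D_def .
qed

text \<open>Unfolded, the hypothesis says that fewer than \<open>c\<close> vertices of
  \<open>U\<close> have red degree at least \<open>c\<close>; these are deleted.\<close>

lemma near_clique_of_few_red_edges:
  assumes U: "finite U" and nr: "\<not> rich R c 2 U"
  shows "\<exists>C\<subseteq>U. real (card U) - c \<le> real (card C) \<and> (\<forall>x\<in>C. real (card (red_nbs R x C)) \<le> c)"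
proof -
  define Z where "Z = {x\<in>U. c \<le> real (card (red_nbs R x U))}"
  have "{y \<in> red_nbs R x U. rich R c 0 (red_nbs R y (red_nbs R x U))} = red_nbs R x U" for x by auto
  then have "{x\<in>U. rich R c 1 (red_nbs R x U)} = Z" unfolding Z_def One_nat_def rich.simps(2) by simp
  then have Z: "real (card Z) < c" using nr unfolding numeral_2_eq_2 One_nat_def rich.simps(2)[of R c "Suc 0"] by simp
  have ZU: "Z \<subseteq> U" unfolding Z_def by auto
  then have "finite Z" using U finite_subset by blast
  then have "card (U - Z) = card U - card Z" "card Z \<le> card U"
    using U ZU by (auto simp: card_Diff_subset card_mono)
  then have 1: "real (card U) - c \<le> real (card (U - Z))" using Z by linarith
  have "real (card (red_nbs R x (U - Z))) \<le> c" if "x \<in> U - Z" for x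
  proof -
    have "card (red_nbs R x (U - Z)) \<le> card (red_nbs R x U)"
      using U by (intro card_mono) (auto simp: red_nbs_def)
    then show ?thesis using that unfolding Z_def by auto
  qed
  then show ?thesis using 1 by (intro exI[of _ "U - Z"]) auto
qed

text \<open>A near-clique \<open>C\<close> of about N vertices is split off, and the induction
  continues in the red neighbourhood, outside \<open>C\<close>, of one typical vertex of
  \<open>C\<close>. There the forbidden red clique is smaller by one, and only few vertices outside
  \<open>C\<close> are missing.\<close>

lemma stability:
  fixes B :: real
  assumes B: "0 \<le> B"
  shows "\<forall>\<epsilon>. 0 < \<epsilon> \<longrightarrow> (\<exists>\<delta>>0. \<exists>N0.
    \<forall>(R :: 'a \<Rightarrow> 'a \<Rightarrow> bool) V I (E :: 'v \<Rightarrow> 'v \<Rightarrow> bool) k.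
     red_graph R \<and> finite V \<and> red_free R (Suc q) V \<and> rootable I E \<and> (\<forall>i\<in>I. k i \<le> K) \<and>
     N0 \<le> real (sum k I) \<and> (real q - \<delta>) * real (sum k I) \<le> real (card V) \<and>
     real (card V) \<le> B * real (sum k I) \<and> \<not> embeds R I E k V \<longrightarrow>
     (\<exists>C. blue_blocks R \<epsilon> (real (sum k I)) q V C))"
proof (induction q)
  case 0
  show ?case by (intro allI impI exI[of _ 1] conjI) (auto simp: blue_blocks_def)
next
  case (Suc q)
  show ?case
  proof (intro allI impI)
    fix \<epsilon> :: real assume \<epsilon>: "0 < \<epsilon>"
    then have "0 < \<epsilon> / 2" by simp
    from Suc.IH[rule_format, OF this] obtain \<delta>1 N1 where IH: "\<delta>1 > 0"
      "\<forall>(R :: 'a \<Rightarrow> 'a \<Rightarrow> bool) V I (E :: 'v \<Rightarrow> 'v \<Rightarrow> bool) k.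
     red_graph R \<and> finite V \<and> red_free R (Suc q) V \<and> rootable I E \<and> (\<forall>i\<in>I. k i \<le> K) \<and>
     N1 \<le> real (sum k I) \<and> (real q - \<delta>1) * real (sum k I) \<le> real (card V) \<and>
     real (card V) \<le> B * real (sum k I) \<and> \<not> embeds R I E k V \<longrightarrow>
     (\<exists>C. blue_blocks R (\<epsilon> / 2) (real (sum k I)) q V C)"
      by - (elim exE conjE, rule that; assumption)
    \<comment> \<open>\<open>\<epsilon> * \<epsilon> / 2\<close> will limit the vertices deleted
      from each later block to \<open>\<epsilon> / 2 * N\<close>; \<open>\<delta>1 / 2\<close>
      limits the loss in passing to \<open>V'\<close>.\<close>
    define \<epsilon>2 where "\<epsilon>2 = Min {1, \<epsilon>, \<epsilon> * \<epsilon> / 2, \<delta>1 / 2}"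
    have e2: "\<epsilon>2 \<le> 1" "\<epsilon>2 \<le> \<epsilon>" "\<epsilon>2 \<le> \<epsilon> * \<epsilon> / 2" "\<epsilon>2 \<le> \<delta>1 / 2"
      unfolding \<epsilon>2_def by (rule Min_le; simp)+
    have e20: "0 < \<epsilon>2" unfolding \<epsilon>2_def using \<epsilon> IH(1) by simp
    obtain s where s: "s \<ge> 1" "\<And>(R :: 'a \<Rightarrow> 'a \<Rightarrow> bool) V.
        red_graph R \<and> finite V \<and> red_free R (Suc (Suc q)) V \<Longrightarrow> blue_cliques_from R K s V"
      using blue_cliques_exist[of "Suc (Suc q)" K] by blast
    from excess_embedding_asymptotic[OF e20 e2(1) B, of K "Suc (Suc q)" s]
    obtain \<gamma>0 L N2 where ex: "\<gamma>0 > 0" "\<forall>(R :: 'a \<Rightarrow> 'a \<Rightarrow> bool) V I (E :: 'v \<Rightarrow> 'v \<Rightarrow> bool) k C X.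
     red_graph R \<and> finite V \<and> rootable I E \<and> (\<forall>i\<in>I. k i \<le> K) \<and> red_free R (Suc (Suc q)) V \<and>
     blue_cliques_from R K s V \<and> N2 \<le> real (sum k I) \<and> real (card V) \<le> B * real (sum k I) \<and>
     C \<subseteq> V \<and> (1 - \<gamma>0) * real (sum k I) \<le> real (card C) \<and>
     (\<forall>x\<in>C. real (card (red_nbs R x C)) \<le> \<gamma>0 * real (sum k I)) \<and>
     X \<subseteq> V \<and> L \<le> card X \<and>
     (\<forall>x\<in>X. real (card (red_nbs R x C)) \<le> \<gamma>0 * real (sum k I) \<and>
            \<epsilon>2 * real (sum k I) \<le> real (card (blue_nbs R {x} (V - C)))) \<longrightarrow>
     embeds R I E k V"
      by - (elim exE conjE, rule that; assumption)
    \<comment> \<open>The last block misses at most \<open>\<gamma> * N\<close> vertices: two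
      quarters from finding the near-clique, half from the fewer than \<open>L\<close> vertices of
      \<open>X\<close>.\<close>
    define \<gamma> where "\<gamma> = Min {\<gamma>0, \<epsilon>, 1 / 2}"
    have g: "\<gamma> \<le> \<gamma>0" "\<gamma> \<le> \<epsilon>" "\<gamma> \<le> 1 / 2" unfolding \<gamma>_def by (rule Min_le; simp)+
    have g0: "0 < \<gamma>" unfolding \<gamma>_def using ex(1) \<epsilon> by simp
    have g4: "0 < \<gamma> / 4 \<and> 0 < \<gamma> / 4" using g0 by simp
    from not_embeds_imp_few_red_edges[OF s(1), where K=K and B=B and r=q, rule_format, OF g4]
    obtain c' \<delta>2 N3 where fe: "c' > 0" "\<delta>2 > 0" "\<forall>(R :: 'a \<Rightarrow> 'a \<Rightarrow> bool) V I (E :: 'v \<Rightarrow> 'v \<Rightarrow> bool) k.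
     red_graph R \<and> finite V \<and> blue_cliques_from R K s V \<and> rootable I E \<and> (\<forall>i\<in>I. k i \<le> K) \<and>
     N3 \<le> real (sum k I) \<and> (real (Suc q) - \<delta>2) * real (sum k I) \<le> real (card V) \<and>
     real (card V) \<le> B * real (sum k I) \<and>
     \<not> rich R (c' * real (sum k I)) (Suc (Suc q)) V \<and> \<not> embeds R I E k V \<longrightarrow>
     (\<exists>U\<subseteq>V. (1 - \<gamma> / 4) * real (sum k I) \<le> real (card U) \<and> \<not> rich R (\<gamma> / 4 * real (sum k I)) 2 U)"
      by - (elim exE conjE, rule that; assumption)
    define \<delta> where "\<delta> = min (\<delta>1 / 2) \<delta>2"
    have \<delta>: "0 < \<delta>" "\<delta> \<le> \<delta>1 / 2" "\<delta> \<le> \<delta>2" unfolding \<delta>_def using IH(1) fe(2) by auto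
    define N0 where "N0 = Max {1, N1, N2, N3, 2 * real L / \<gamma>}"
    have N0: "1 \<le> N0" "N1 \<le> N0" "N2 \<le> N0" "N3 \<le> N0" "2 * real L / \<gamma> \<le> N0"
      unfolding N0_def by (rule Max_ge; simp)+
    have main: "\<exists>C. blue_blocks R \<epsilon> (real (sum k I)) (Suc q) V C"
      if R: "red_graph R" and V: "finite V" and rf: "red_free R (Suc (Suc q)) V" and T: "rootable I E"
        and k: "\<forall>i\<in>I. k i \<le> K" and NN: "N0 \<le> real (sum k I)"
        and big: "(real (Suc q) - \<delta>) * real (sum k I) \<le> real (card V)"
        and VB: "real (card V) \<le> B * real (sum k I)" and ne: "\<not> embeds R I E k V"
      for R :: "'a \<Rightarrow> 'a \<Rightarrow> bool" and V I and E :: "'v \<Rightarrow> 'v \<Rightarrow> bool" and k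
    proof -
      define N where "N = real (sum k I)"
      have N: "1 \<le> N" "N1 \<le> N" "N2 \<le> N" "N3 \<le> N" using N0 NN unfolding N_def by auto
      have "2 * real L / \<gamma> \<le> N" using N0 NN unfolding N_def by linarith
      then have NL: "real L \<le> \<gamma> / 2 * N" using g0 by (simp add: field_simps)
      have cl: "blue_cliques_from R K s V" using s(2) R V rf by blast
      have gN: "0 < \<gamma> * N" "\<gamma> * N \<le> \<gamma>0 * N" "\<gamma> * N \<le> \<epsilon> * N" "\<gamma> * N \<le> 1 / 2 * N"
        using g0 g N by (auto intro: mult_right_mono)
      have "0 < c' * N" using fe(1) N by simp
      then have nr: "\<not> rich R (c' * N) (Suc (Suc q)) V" using rich_not_red_free[OF R] rf by blast
      have "\<delta> * N \<le> \<delta>2 * N" using \<delta> N by (intro mult_right_mono) auto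
      then have big2: "(real (Suc q) - \<delta>2) * N \<le> real (card V)"
        using big unfolding N_def[symmetric] by (simp add: left_diff_distrib)
      have "\<exists>U\<subseteq>V. (1 - \<gamma> / 4) * N \<le> real (card U) \<and> \<not> rich R (\<gamma> / 4 * N) 2 U"
        unfolding N_def using R V cl T k N(4) big2 VB nr ne unfolding N_def by (intro fe(3)[rule_format] conjI) auto
      then obtain U where U: "U \<subseteq> V" "(1 - \<gamma> / 4) * N \<le> real (card U)" "\<not> rich R (\<gamma> / 4 * N) 2 U" by blast
      have fU: "finite U" using U V finite_subset by blast
      obtain C1 where C1: "C1 \<subseteq> U" "real (card U) - \<gamma> / 4 * N \<le> real (card C1)"
          "\<And>x. x \<in> C1 \<Longrightarrow> real (card (red_nbs R x C1)) \<le> \<gamma> / 4 * N"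
        using near_clique_of_few_red_edges[OF fU U(3)] by blast
      have fC1: "finite C1" using C1 fU finite_subset by blast
      have C1N: "N - \<gamma> / 2 * N \<le> real (card C1)" using C1(2) U(2) by (simp add: left_diff_distrib)
      \<comment> \<open>Cutting the near-clique down to at most N vertices keeps
        \<open>V - C\<close> large enough for \<open>q\<close> further blocks.\<close>
      obtain C where C: "C \<subseteq> C1" "real (card C) \<le> N" "N - \<gamma> / 2 * N \<le> real (card C)"
      proof (cases "sum k I \<le> card C1")
        case True
        then obtain C where "C \<subseteq> C1" "card C = sum k I" using obtain_subset_card by blast
        then show ?thesis using that[of C] gN unfolding N_def by simp
      next
        case False
        then have "real (card C1) \<le> N" unfolding N_def by linarith
        then show ?thesis using that[of C1] C1N by blast
      qed
      have CV: "C \<subseteq> V" using C C1 U by blast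
      have fC: "finite C" using CV V finite_subset by blast
      have Cr: "real (card (red_nbs R x C)) \<le> \<gamma>0 * N" if "x \<in> C" for x
      proof -
        have "card (red_nbs R x C) \<le> card (red_nbs R x C1)"
          using fC1 C(1) by (intro card_mono) (auto simp: red_nbs_def)
        moreover have "real (card (red_nbs R x C1)) \<le> \<gamma> / 4 * N" using C1(3) that C(1) by blast
        ultimately show ?thesis using gN(1,2) by linarith
      qed
      define X where "X = {x\<in>C. \<epsilon>2 * N \<le> real (card (blue_nbs R {x} (V - C)))}"
      have XL: "card X < L"
      proof (rule ccontr)
        assume "\<not> card X < L"
        moreover have "(1 - \<gamma>0) * N \<le> real (card C)" using C(3) gN(1,2) unfolding left_diff_distrib by linarith
        ultimately have "embeds R I E k V"
          using R V T k rf cl N(3) VB CV Cr unfolding N_def X_def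
          by (intro ex(2)[rule_format, of R V I E k C X] conjI) (auto simp: X_def N_def)
        then show False using ne by blast
      qed
      define C0 where "C0 = C - X"
      have fX: "finite X" "X \<subseteq> C" unfolding X_def using fC by auto
      then have "card C0 = card C - card X" "card X \<le> card C"
        unfolding C0_def using fC by (auto simp: card_Diff_subset card_mono)
      then have C0N: "N - \<gamma> * N \<le> real (card C0)" using C(3) XL NL by linarith
      then have "0 < real (card C0)" using gN N by linarith
      then have "C0 \<noteq> {}" by (metis card.empty of_nat_0 less_irrefl)
      then obtain x where x: "x \<in> C0" by blast
      have C0b: "real (card (blue_nbs R {y} (V - C))) \<le> \<epsilon>2 * N" if "y \<in> C0" for y
        using that unfolding C0_def X_def by auto
      have C0c: "card C0 \<le> card C" unfolding C0_def using fC by (intro card_mono) auto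
      define V' where "V' = red_nbs R x (V - C)"
      have V'V: "V' \<subseteq> V - C" unfolding V'_def red_nbs_def by auto
      have fV': "finite V'" using V'V V finite_subset by blast
      have "V - C = V' \<union> blue_nbs R {x} (V - C)" unfolding V'_def red_nbs_def blue_nbs_def by auto
      then have "card (V - C) \<le> card V' + card (blue_nbs R {x} (V - C))" by (metis card_Un_le)
      moreover have "card (V - C) = card V - card C" "card C \<le> card V"
        using CV fC V by (auto simp: card_Diff_subset card_mono)
      ultimately have "real (card V) - N - \<epsilon>2 * N \<le> real (card V')" using C0b[OF x] C(2) by linarith
      moreover have "\<delta> * N \<le> \<delta>1 / 2 * N" "\<epsilon>2 * N \<le> \<delta>1 / 2 * N"
        using \<delta> e2 N by (auto intro: mult_right_mono)
      ultimately have V'big: "(real q - \<delta>1) * N \<le> real (card V')"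
        using big unfolding N_def[symmetric] by (simp add: algebra_simps)
      have "x \<in> V" using x CV unfolding C0_def by blast
      then have rf': "red_free R (Suc q) V'"
        by (rule red_free_red_nbs[OF R _ _ rf]) (auto simp: V'_def red_nbs_def)
      have "card V' \<le> card V" using V'V V by (intro card_mono) auto
      moreover have "\<not> embeds R I E k V'" using ne embeds_mono V'V by blast
      ultimately have "\<exists>C. blue_blocks R (\<epsilon> / 2) N q V' C"
        using R fV' rf' T k N(2) V'big VB unfolding N_def by (intro IH(2)[rule_format] conjI) auto
      then obtain C' where bb: "blue_blocks R (\<epsilon> / 2) N q V' C'" by blast
      have C': "\<And>i. i < q \<Longrightarrow> C' i \<subseteq> V'" "\<And>i. i < q \<Longrightarrow> (1 - \<epsilon> / 2) * N \<le> real (card (C' i))"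
         "\<And>i j. i < q \<Longrightarrow> j < q \<Longrightarrow> i \<noteq> j \<Longrightarrow> C' i \<inter> C' j = {}"
         "\<And>i j y. i < q \<Longrightarrow> j < q \<Longrightarrow> i \<noteq> j \<Longrightarrow> y \<in> C' i \<Longrightarrow> real (card (blue_nbs R {y} (C' j))) \<le> \<epsilon> / 2 * N"
        using bb unfolding blue_blocks_def by blast+
      \<comment> \<open>\<open>C0\<close> becomes block number \<open>q\<close>. It is red to nearly
        everything outside \<open>C\<close>, but single vertices of the other blocks may still have
        many blue neighbours in it and are dropped.\<close>
      define D where "D i = (if i < q then {y\<in>C' i. real (card (blue_nbs R {y} C0)) \<le> \<epsilon> * N} else C0)" for i
      have Dsub: "D i \<subseteq> C' i" if "i < q" for i using that unfolding D_def by auto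
      have DVC: "D i \<subseteq> V - C" if "i < q" for i using Dsub[OF that] C'(1)[OF that] V'V by blast
      have fC': "finite (C' i)" if "i < q" for i using C'(1)[OF that] fV' finite_subset by blast
      have Dcard: "(1 - \<epsilon>) * N \<le> real (card (D i))" if i: "i < q" for i
      proof -
        define Y where "Y = {y\<in>C' i. \<epsilon> * N < real (card (blue_nbs R {y} C0))}"
        have "real (card (blue_nbs R {y} (C' i))) \<le> \<epsilon>2 * N" if "y \<in> C0" for y
        proof -
          have "card (blue_nbs R {y} (C' i)) \<le> card (blue_nbs R {y} (V - C))"
            using V C'(1)[OF i] V'V by (intro card_mono blue_nbs_mono) auto
          then show ?thesis using C0b[OF that] by linarith
        qed
        then have "real (card Y) * (\<epsilon> * N) \<le> real (card C0) * (\<epsilon>2 * N)"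
          unfolding Y_def using fC' i fC by (intro few_large_blue_degrees[OF R]) (auto simp: C0_def)
        also have "\<dots> \<le> N * (\<epsilon>2 * N)" using C0c C(2) e20 N by (intro mult_right_mono) auto
        also have "\<dots> \<le> N * (\<epsilon> * \<epsilon> / 2 * N)" using e2(3) N by (intro mult_left_mono mult_right_mono) auto
        also have "\<dots> = (\<epsilon> / 2 * N) * (\<epsilon> * N)" by simp
        finally have Y: "real (card Y) \<le> \<epsilon> / 2 * N" using \<epsilon> N by (simp add: mult_le_cancel_right)
        have DY: "D i = C' i - Y" "Y \<subseteq> C' i" unfolding D_def Y_def using i by auto
        have "finite Y" using DY(2) fC'[OF i] finite_subset by blast
        then have "card (D i) = card (C' i) - card Y" "card Y \<le> card (C' i)"
          using fC'[OF i] DY by (auto simp: card_Diff_subset card_mono)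
        then show ?thesis using C'(2)[OF i] Y by (simp add: left_diff_distrib)
      qed
      have "blue_blocks R \<epsilon> N (Suc q) V D"
        unfolding blue_blocks_def
      proof (intro conjI allI impI ballI)
        fix i assume i: "i < Suc q"
        show "D i \<subseteq> V"
          using DVC[of i] CV unfolding C0_def by (cases "i < q") (auto simp: D_def C0_def)
        show "(1 - \<epsilon>) * N \<le> real (card (D i))"
        proof (cases "i < q")
          case False
          then have "D i = C0" unfolding D_def by simp
          then show ?thesis using C0N gN(3) by (simp only: left_diff_distrib)
        qed (rule Dcard)
        fix j assume j: "j < Suc q" "i \<noteq> j"
        have "D i \<inter> D q = {}" if "i < q" for i using DVC[OF that] unfolding D_def C0_def by auto
        then show "D i \<inter> D j = {}"
          using i j C'(3)[of i j] Dsub[of i] Dsub[of j] by (cases "i < q"; cases "j < q") (auto simp: less_Suc_eq)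
        fix y assume y: "y \<in> D i"
        show "real (card (blue_nbs R {y} (D j))) \<le> \<epsilon> * N"
        proof (cases "j < q")
          case jq: True
          show ?thesis
          proof (cases "i < q")
            case True
            have "card (blue_nbs R {y} (D j)) \<le> card (blue_nbs R {y} (C' j))"
              using fC'[OF jq] Dsub[OF jq] by (intro card_mono blue_nbs_mono) auto
            moreover have "real (card (blue_nbs R {y} (C' j))) \<le> \<epsilon> / 2 * N"
              using C'(4)[OF True jq j(2)] y Dsub[OF True] by blast
            moreover have "0 < \<epsilon> * N" using \<epsilon> N by simp
            ultimately show ?thesis by simp
          next
            case False
            then have "y \<in> C0" using y unfolding D_def by simp
            have "card (blue_nbs R {y} (D j)) \<le> card (blue_nbs R {y} (V - C))"
              using V DVC[OF jq] by (intro card_mono blue_nbs_mono) auto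
            moreover have "\<epsilon>2 * N \<le> \<epsilon> * N" using e2 N by (intro mult_right_mono) auto
            ultimately show ?thesis using C0b[OF \<open>y \<in> C0\<close>] by linarith
          qed
        next
          case False
          then have "j = q" "i < q" using i j by auto
          then show ?thesis using y unfolding D_def by auto
        qed
      qed
      then show ?thesis unfolding N_def by blast
    qed
    show "\<exists>\<delta>>0. \<exists>N0.
    \<forall>(R :: 'a \<Rightarrow> 'a \<Rightarrow> bool) V I (E :: 'v \<Rightarrow> 'v \<Rightarrow> bool) k.
     red_graph R \<and> finite V \<and> red_free R (Suc (Suc q)) V \<and> rootable I E \<and> (\<forall>i\<in>I. k i \<le> K) \<and>
     N0 \<le> real (sum k I) \<and> (real (Suc q) - \<delta>) * real (sum k I) \<le> real (card V) \<and>
     real (card V) \<le> B * real (sum k I) \<and> \<not> embeds R I E k V \<longrightarrow>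
     (\<exists>C. blue_blocks R \<epsilon> (real (sum k I)) (Suc q) V C)"
      by (rule exI[of _ \<delta>], intro exI[of _ N0] conjI allI impI, rule \<delta>(1),
          elim conjE, rule main; assumption)
  qed
qed

section \<open>Embedding at the exact order\<close>

text \<open>Greedy choice: each earlier vertex rules out at most \<open>e\<close> vertices of the
  next set. The blue degrees are measured in the blocks \<open>C\<close>, of which the
  \<open>Z\<close> are arbitrary sufficiently large subsets.\<close>

lemma red_transversal:
  fixes e :: real
  assumes R: "red_graph R" and J: "finite J" and e: "0 \<le> e"
  shows "(\<And>i. i \<in> J \<Longrightarrow> Z i \<subseteq> C i \<and> finite (C i) \<and> real (card J) * e < real (card (Z i))) \<Longrightarrow>
    (\<And>i j x. i \<in> J \<Longrightarrow> j \<in> J \<Longrightarrow> i \<noteq> j \<Longrightarrow> x \<in> C i \<Longrightarrow> real (card (blue_nbs R {x} (C j))) \<le> e) \<Longrightarrow>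
    \<exists>z. (\<forall>i\<in>J. z i \<in> Z i) \<and> (\<forall>i\<in>J. \<forall>j\<in>J. i \<noteq> j \<longrightarrow> R (z i) (z j))"
  using J
proof (induction J rule: finite_induct)
  case empty
  then show ?case by simp
next
  case (insert a J)
  have cJ: "real (card (insert a J)) = real (card J) + 1" using insert.hyps by simp
  then have le: "real (card J) * e \<le> real (card (insert a J)) * e" using e by (simp add: distrib_right)
  have "\<exists>z. (\<forall>i\<in>J. z i \<in> Z i) \<and> (\<forall>i\<in>J. \<forall>j\<in>J. i \<noteq> j \<longrightarrow> R (z i) (z j))"
  proof (rule insert.IH)
    fix i assume i: "i \<in> J"
    then have "Z i \<subseteq> C i \<and> finite (C i) \<and> real (card (insert a J)) * e < real (card (Z i))"
      using insert.prems(1)[of i] by blast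
    then show "Z i \<subseteq> C i \<and> finite (C i) \<and> real (card J) * e < real (card (Z i))" using le by linarith
  next
    fix i j x assume "i \<in> J" "j \<in> J" "i \<noteq> j" "x \<in> C i"
    then show "real (card (blue_nbs R {x} (C j))) \<le> e" using insert.prems(2)[of i j x] by blast
  qed
  then obtain z where z: "\<forall>i\<in>J. z i \<in> Z i" "\<forall>i\<in>J. \<forall>j\<in>J. i \<noteq> j \<longrightarrow> R (z i) (z j)" by blast
  define Y where "Y = (\<Union>j\<in>J. blue_nbs R {z j} (C a))"
  have a: "Z a \<subseteq> C a" "finite (C a)" "real (card (insert a J)) * e < real (card (Z a))"
    using insert.prems(1)[of a] by auto
  have "card Y \<le> (\<Sum>j\<in>J. card (blue_nbs R {z j} (C a)))"
    unfolding Y_def using insert.hyps by (intro card_UN_le)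
  then have "real (card Y) \<le> real (\<Sum>j\<in>J. card (blue_nbs R {z j} (C a)))" by (rule of_nat_mono)
  also have "\<dots> = (\<Sum>j\<in>J. real (card (blue_nbs R {z j} (C a))))" by simp
  also have "\<dots> \<le> real (card J) * e"
  proof (rule sum_bounded_above)
    fix j assume j: "j \<in> J"
    then have "z j \<in> C j" "j \<noteq> a" using z(1) insert.prems(1)[of j] insert.hyps by auto
    then show "real (card (blue_nbs R {z j} (C a))) \<le> e" using insert.prems(2)[of j a "z j"] j by blast
  qed
  finally have "card Y < card (Z a)" using le a(3) by linarith
  moreover have "finite Y" unfolding Y_def using insert.hyps a(2) by simp
  ultimately have "\<not> Z a \<subseteq> Y" using card_mono[of Y "Z a"] by linarith
  then obtain w where w: "w \<in> Z a" "w \<notin> Y" by blast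
  have wR: "R (z j) w" "R w (z j)" if "j \<in> J" for j
  proof -
    have "w \<notin> blue_nbs R {z j} (C a)" using w(2) that unfolding Y_def by blast
    then show "R (z j) w" using w(1) a(1) unfolding blue_nbs_def by auto
    then show "R w (z j)" by (rule red_graphD(1)[OF R])
  qed
  have na: "j \<noteq> a" if "j \<in> J" for j using that insert.hyps by blast
  have 1: "\<forall>i\<in>insert a J. (z(a := w)) i \<in> Z i" using z(1) w(1) by auto
  have 2: "\<forall>i\<in>insert a J. \<forall>j\<in>insert a J. i \<noteq> j \<longrightarrow> R ((z(a := w)) i) ((z(a := w)) j)"
    using z(2) wR by auto
  show ?case by (rule exI[of _ "z(a := w)"]) (intro conjI 1 2)
qed

text \<open>Applied to a single vertex with all \<open>q\<close> blocks, and to a red edge with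
  \<open>q - 1\<close> blocks; both give a red clique of order \<open>q + 1\<close>.\<close>

lemma transversal_not_red_free:
  fixes e :: real
  assumes R: "red_graph R" and J: "finite J" and e: "0 \<le> e"
    and Z: "\<And>i. i \<in> J \<Longrightarrow> Z i \<subseteq> C i \<and> finite (C i) \<and> C i \<subseteq> V \<and> real (card J) * e < real (card (Z i))"
    and C: "\<And>i j x. i \<in> J \<Longrightarrow> j \<in> J \<Longrightarrow> i \<noteq> j \<Longrightarrow> x \<in> C i \<Longrightarrow> real (card (blue_nbs R {x} (C j))) \<le> e"
    and A: "A \<subseteq> V" "finite A" "red_clique R A"
    and AZ: "\<And>i x w. i \<in> J \<Longrightarrow> x \<in> A \<Longrightarrow> w \<in> Z i \<Longrightarrow> R x w"
  shows "\<not> red_free R (card A + card J) V"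
proof -
  have "\<exists>z. (\<forall>i\<in>J. z i \<in> Z i) \<and> (\<forall>i\<in>J. \<forall>j\<in>J. i \<noteq> j \<longrightarrow> R (z i) (z j))"
    by (rule red_transversal[OF R J e, where C=C]) (use Z C in auto)
  then obtain z where z: "\<And>i. i \<in> J \<Longrightarrow> z i \<in> Z i" "\<And>i j. i \<in> J \<Longrightarrow> j \<in> J \<Longrightarrow> i \<noteq> j \<Longrightarrow> R (z i) (z j)"
    by blast
  have "inj_on z J"
  proof (rule inj_onI, rule ccontr)
    fix i j assume ij: "i \<in> J" "j \<in> J" "z i = z j" "i \<noteq> j"
    then show False using z(2)[of i j] red_graphD(2)[OF R] by simp
  qed
  then have cz: "card (z ` J) = card J" by (rule card_image)
  have Az: "R x (z i)" "R (z i) x" if "x \<in> A" "i \<in> J" for x i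
    using AZ[OF that(2,1) z(1)[OF that(2)]] red_graphD(1)[OF R] by blast+
  have "A \<inter> z ` J = {}"
  proof (rule ccontr)
    assume "A \<inter> z ` J \<noteq> {}"
    then obtain i where "i \<in> J" "z i \<in> A" by blast
    then show False using Az[of "z i" i] red_graphD(2)[OF R] by blast
  qed
  then have "card (A \<union> z ` J) = card A + card J" using cz A(2) J by (simp add: card_Un_disjoint)
  moreover have "red_clique R (A \<union> z ` J)"
    unfolding red_clique_def
  proof (intro ballI impI)
    fix x y assume xy: "x \<in> A \<union> z ` J" "y \<in> A \<union> z ` J" "x \<noteq> y"
    then consider "x \<in> A" "y \<in> A" | "x \<in> A" "y \<in> z ` J" | "x \<in> z ` J" "y \<in> A" | "x \<in> z ` J" "y \<in> z ` J"
      by blast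
    then show "R x y"
    proof cases
      case 1 then show ?thesis using A(3) xy(3) unfolding red_clique_def by blast
    next
      case 2 then show ?thesis using Az by auto
    next
      case 3 then show ?thesis using Az by auto
    next
      case 4
      then obtain i j where ij: "i \<in> J" "x = z i" "j \<in> J" "y = z j" by blast
      then have "i \<noteq> j" using xy(3) by blast
      then show ?thesis using ij z(2) by blast
    qed
  qed
  moreover have "A \<union> z ` J \<subseteq> V"
  proof -
    have "z i \<in> V" if "i \<in> J" for i using z(1)[OF that] Z[OF that] by blast
    then show ?thesis using A(1) by blast
  qed
  moreover have "finite (A \<union> z ` J)" using A(2) J by simp
  ultimately show ?thesis unfolding red_free_def by blast
qed

section \<open>Tree vertices of small degree and the almost complete case\<close>

lemma independent_subset:
  assumes sym: "\<And>u v. E u v \<Longrightarrow> E v u" and irr: "\<And>u. \<not> E u u"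
  shows "finite S \<Longrightarrow> (\<And>u. u \<in> S \<Longrightarrow> finite {v. E u v} \<and> card {v. E u v} \<le> 3) \<Longrightarrow> 4 * L \<le> card S \<Longrightarrow>
    \<exists>J\<subseteq>S. card J = L \<and> (\<forall>u\<in>J. \<forall>v\<in>J. \<not> E u v)"
proof (induction L arbitrary: S)
  case 0
  show ?case by (rule exI[of _ "{}"]) simp
next
  case (Suc L)
  have "0 < card S" using Suc.prems(3) by simp
  then obtain u where u: "u \<in> S" by (metis card_gt_0_iff ex_in_conv)
  define S' where "S' = S - insert u {v. E u v}"
  have "card (insert u {v. E u v}) \<le> 4" using Suc.prems(2)[OF u] card_insert_le_m1[of 4 "{v. E u v}" u] by simp
  moreover have "card S - card (insert u {v. E u v}) \<le> card S'"
    unfolding S'_def using Suc.prems(2)[OF u] by (intro diff_card_le_card_Diff) auto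
  moreover have "4 * L + 4 \<le> card S" using Suc.prems(3) by simp
  ultimately have "4 * L \<le> card S'" by linarith
  then have "\<exists>J\<subseteq>S'. card J = L \<and> (\<forall>u\<in>J. \<forall>v\<in>J. \<not> E u v)"
    using Suc.prems(1,2) by (intro Suc.IH) (auto simp: S'_def)
  then obtain J where J: "J \<subseteq> S'" "card J = L" "\<forall>u\<in>J. \<forall>v\<in>J. \<not> E u v" by blast
  have fJ: "finite J" using J(1) Suc.prems(1) unfolding S'_def by (meson finite_Diff finite_subset)
  have uJ: "u \<notin> J" "\<And>v. v \<in> J \<Longrightarrow> \<not> E u v" using J(1) unfolding S'_def by auto
  have "card (insert u J) = Suc L" using uJ fJ J(2) by simp
  moreover have "\<forall>a\<in>insert u J. \<forall>b\<in>insert u J. \<not> E a b"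
  proof (intro ballI)
    fix a b assume "a \<in> insert u J" "b \<in> insert u J"
    then show "\<not> E a b" using uJ(2)[of a] uJ(2)[of b] J(3) sym[of a b] irr[of u] by auto
  qed
  moreover have "insert u J \<subseteq> S" using u J(1) unfolding S'_def by blast
  ultimately show ?case by (intro exI[of _ "insert u J"]) simp
qed

text \<open>The numbers of children sum to less than \<open>card I\<close>, so at most a third of
  the vertices have three or more. The other two thirds, at least \<open>4 * L\<close> vertices,
  have degree at most 3, and a greedy choice keeps a quarter of them.\<close>

lemma rooted_low_degree_independent:
  assumes T: "rooted I E r par ord" and fI: "finite I" and L: "6 * L \<le> card I"
  shows "\<exists>J\<subseteq>I. card J = L \<and> (\<forall>u\<in>J. \<forall>v\<in>J. \<not> E u v) \<and> (\<forall>u\<in>J. card {v. E u v} \<le> 3)"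
proof -
  define ch where "ch u = {v \<in> I - {r}. par v = u}" for u
  have rI: "r \<in> I" and par: "\<And>v. v \<in> I - {r} \<Longrightarrow> par v \<in> I \<and> ord (par v) < ord v"
    using T unfolding rooted_def by auto
  define S where "S = {u\<in>I. card (ch u) \<le> 2}"
  have fS: "finite S" "S \<subseteq> I" unfolding S_def using fI by auto
  have "(\<Union>u\<in>I. ch u) = I - {r}" unfolding ch_def using par by auto
  moreover have "card (\<Union>u\<in>I. ch u) = (\<Sum>u\<in>I. card (ch u))"
    using fI by (intro card_UN_disjoint) (auto simp: ch_def)
  ultimately have s: "(\<Sum>u\<in>I. card (ch u)) \<le> card I" using fI by (metis card_Diff1_le)
  have "card (I - S) * 3 \<le> (\<Sum>u\<in>I - S. card (ch u))"
  proof -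
    have "of_nat (card (I - S)) * 3 \<le> (\<Sum>u\<in>I - S. card (ch u))"
      by (rule sum_bounded_below) (auto simp: S_def)
    then show ?thesis by simp
  qed
  also have "\<dots> \<le> (\<Sum>u\<in>I. card (ch u))" using fI by (intro sum_mono2) auto
  finally have "card (I - S) * 3 \<le> card I" using s by linarith
  moreover have "card (I - S) = card I - card S" "card S \<le> card I"
    using fS fI by (auto simp: card_Diff_subset card_mono)
  ultimately have cS: "4 * L \<le> card S" using L by linarith
  have deg: "finite {v. E u v} \<and> card {v. E u v} \<le> 3" if u: "u \<in> S" for u
  proof -
    have sub: "{v. E u v} \<subseteq> insert (par u) (ch u)" using T unfolding rooted_def ch_def by auto
    have f: "finite (ch u)" unfolding ch_def using fI by simp
    have "card {v. E u v} \<le> card (insert (par u) (ch u))" using sub f by (intro card_mono) auto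
    also have "\<dots> \<le> Suc (card (ch u))" using f by (simp add: card_insert_if)
    also have "\<dots> \<le> 3" using u unfolding S_def by simp
    finally show ?thesis using finite_subset[OF sub] f by simp
  qed
  have sym: "E v u" if "E u v" for u v using T that unfolding rooted_def by blast
  have irr: "\<not> E u u" for u
  proof
    assume "E u u"
    then have "u \<in> I - {r}" "u = par u" using T unfolding rooted_def by auto
    then show False using par[of u] by simp
  qed
  obtain J where J: "J \<subseteq> S" "card J = L" "\<forall>u\<in>J. \<forall>v\<in>J. \<not> E u v"
    using independent_subset[of E S L, OF sym irr fS(1) deg cS] by blast
  have "card {v. E u v} \<le> 3" if "u \<in> J" for u using deg that J(1) by blast
  then show ?thesis using J fS(2) by (intro exI[of _ J]) auto
qed

text \<open>Each vertex of \<open>X\<close> receives one vertex from the clique of a tree vertex of degree at most 3;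
  these tree vertices are pairwise non-adjacent, so that only boundedly many vertices have to be
  placed into \<open>F\<close>.\<close>

lemma clique_plus_few_embedding:
  assumes R: "red_graph R" and T: "rooted I E r par ord" and fI: "finite I"
    and k: "\<And>i. i \<in> I \<Longrightarrow> 0 < k i \<and> k i \<le> K"
    and D: "finite D" "blue_clique R D" and X: "finite X" "D \<inter> X = {}"
    and size: "sum k I \<le> card D + card X"
    and F: "F \<subseteq> D" "\<And>f x. f \<in> F \<Longrightarrow> x \<in> X \<Longrightarrow> \<not> R f x" "4 * card X * K \<le> card F"
    and I: "6 * card X \<le> card I"
  shows "embeds R I E k (D \<union> X)"
proof -
  obtain J where J: "J \<subseteq> I" "card J = card X" "\<And>u v. u \<in> J \<Longrightarrow> v \<in> J \<Longrightarrow> \<not> E u v"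
     "\<And>u. u \<in> J \<Longrightarrow> card {v. E u v} \<le> 3"
    using rooted_low_degree_independent[OF T fI I] by blast
  have fJ: "finite J" using J(1) fI finite_subset by blast
  define S where "S = (SIGMA i:I. {1..k i})"
  have fS: "finite S" unfolding S_def using fI by auto
  have cS: "card S = sum k I" unfolding S_def using fI by (simp add: card_SigmaI)
  \<comment> \<open>One member of each chosen clique goes into \<open>X\<close>; the index 1 exists
    because \<open>k\<close> is positive.\<close>
  define HX where "HX = (\<lambda>u. (u, 1::nat)) ` J"
  define P where "P = J \<union> (\<Union>u\<in>J. {v. E u v})"
  \<comment> \<open>All blow-up neighbours of \<open>HX\<close> lie here, since \<open>J\<close> is
    independent. There are at most \<open>4 * card X * K\<close> of them, and only they need images
    in \<open>F\<close>.\<close>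
  define Near where "Near = (SIGMA i:P. {1..k i}) - HX"
  define Rest where "Rest = S - HX - Near"
  have HXS: "HX \<subseteq> S" unfolding HX_def S_def using J(1) k by (force simp: Suc_le_eq)
  have PI: "P \<subseteq> I" unfolding P_def using J(1) T unfolding rooted_def by auto
  have fP: "finite P" using PI fI finite_subset by blast
  have NS: "Near \<subseteq> S" unfolding Near_def S_def using PI by auto
  have fin: "finite HX" "finite Near" "finite Rest" using HXS NS fS finite_subset unfolding Rest_def by auto
  have dis: "HX \<inter> Near = {}" "HX \<inter> Rest = {}" "Near \<inter> Rest = {}" unfolding Near_def Rest_def by auto
  have S: "S = HX \<union> (Near \<union> Rest)" unfolding Rest_def using HXS NS by auto
  have cHX: "card HX = card X" unfolding HX_def using J(2) by (simp add: card_image inj_on_def)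
  have "card (\<Union>u\<in>J. {v. E u v}) \<le> (\<Sum>u\<in>J. card {v. E u v})" using fJ by (rule card_UN_le)
  also have "\<dots> \<le> card J * 3" using sum_bounded_above[of J "\<lambda>u. card {v. E u v}" 3] J(4) by simp
  finally have "card P \<le> card J + card J * 3" unfolding P_def by (meson add_left_mono card_Un_le le_trans)
  then have cP: "card P \<le> 4 * card X" using J(2) by simp
  have "card Near \<le> card (SIGMA i:P. {1..k i})" unfolding Near_def using fP by (intro card_mono) auto
  also have "\<dots> = sum k P" using fP by (simp add: card_SigmaI)
  also have "\<dots> \<le> card P * K" using sum_bounded_above[of P k K] PI k by auto
  also have "\<dots> \<le> 4 * card X * K" using cP by (intro mult_right_mono) auto
  finally have cN: "card Near \<le> card F" using F(3) by linarith
  have fF: "finite F" using F(1) D(1) finite_subset by blast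
  obtain b where b: "b ` HX \<subseteq> X" "inj_on b HX"
    using card_le_inj[OF fin(1) X(1)] cHX by auto
  obtain g where g: "g ` Near \<subseteq> F" "inj_on g Near" using card_le_inj[OF fin(2) fF cN] by blast
  have "card (g ` Near) = card Near" using g(2) by (rule card_image)
  moreover have gD: "g ` Near \<subseteq> D" using g(1) F(1) by blast
  ultimately have cD: "card (D - g ` Near) = card D - card Near"
    using fin(2) by (simp add: card_Diff_subset)
  have "card S = card HX + (card Near + card Rest)"
    unfolding S using dis fin by (simp add: card_Un_disjoint Int_Un_distrib)
  then have "card Rest \<le> card (D - g ` Near)" using cD cS size cHX by linarith
  then obtain h where h: "h ` Rest \<subseteq> D - g ` Near" "inj_on h Rest"
    using card_le_inj[OF fin(3), of "D - g ` Near"] D(1) by auto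
  define f1 where "f1 = (\<lambda>x. if x \<in> Near then g x else h x)"
  define f where "f = (\<lambda>x. if x \<in> HX then b x else f1 x)"
  have "g ` Near \<inter> h ` Rest = {}" using h(1) by blast
  then have i1: "inj_on f1 (Near \<union> Rest)" unfolding f1_def using g(2) h(2) by (intro inj_on_disjoint_Un)
  have f1D: "f1 ` (Near \<union> Rest) \<subseteq> D" unfolding f1_def using gD h(1) by auto
  then have "b ` HX \<inter> f1 ` (Near \<union> Rest) = {}" using b(1) X(2) by blast
  then have inj: "inj_on f S" unfolding f_def S using b(2) i1 by (intro inj_on_disjoint_Un)
  have fHX: "f x \<in> X" if "x \<in> HX" for x using that b(1) unfolding f_def by auto
  have fD: "f x \<in> D" if "x \<in> S" "x \<notin> HX" for x using that f1D S unfolding f_def by auto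
  have fN: "f x \<in> F" if "x \<in> Near" for x
  proof -
    have "x \<notin> HX" using that dis(1) by blast
    then show ?thesis using that g(1) unfolding f_def f1_def by auto
  qed
  have img: "f ` S \<subseteq> D \<union> X" using fHX fD by blast
  have sym: "E v u" if "E u v" for u v using T that unfolding rooted_def by blast
  have nearI: "y \<in> Near" if xy: "x \<in> HX" "y \<in> S" "x \<noteq> y" "fst x = fst y \<or> E (fst x) (fst y)" for x y
  proof -
    have x: "x = (fst x, 1)" "fst x \<in> J" using xy(1) unfolding HX_def by auto
    have "fst y \<in> P" using xy(4) x(2) unfolding P_def by auto
    moreover have "snd y \<in> {1..k (fst y)}" using xy(2) unfolding S_def by auto
    ultimately have "y \<in> (SIGMA i:P. {1..k i})" by (cases y) auto
    moreover have "y \<notin> HX"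
    proof
      assume "y \<in> HX"
      then have y: "y = (fst y, 1)" "fst y \<in> J" unfolding HX_def by auto
      then have "\<not> E (fst x) (fst y)" using J(3) x(2) by blast
      then have "fst x = fst y" using xy(4) by blast
      then show False using x(1) y(1) xy(3) by metis
    qed
    ultimately show ?thesis unfolding Near_def by blast
  qed
  have edge: "\<not> R (f x) (f y)" if xy: "x \<in> S" "y \<in> S" "x \<noteq> y" "fst x = fst y \<or> E (fst x) (fst y)" for x y
  proof -
    consider "x \<in> HX" | "y \<in> HX" | "x \<notin> HX" "y \<notin> HX" by blast
    then show ?thesis
    proof cases
      case 1
      then have "f y \<in> F" "f x \<in> X" using nearI[OF 1 xy(2,3,4)] fN fHX by auto
      then show ?thesis using F(2) red_graphD(1)[OF R] by blast
    next
      case 2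
      have "fst y = fst x \<or> E (fst y) (fst x)" using xy(4) sym by auto
      then have "f x \<in> F" "f y \<in> X" using nearI[OF 2 xy(1) xy(3)[symmetric]] fN fHX 2 by auto
      then show ?thesis using F(2) by blast
    next
      case 3
      then show ?thesis using fD xy(1,2) D(2) unfolding blue_clique_def by blast
    qed
  qed
  show ?thesis unfolding embeds_def S_def[symmetric]
    using inj img edge by (intro exI[of _ f] conjI ballI impI) auto
qed

text \<open>The exact value of \<open>card V\<close> is used in the pigeonhole step, which gives
  some class at least \<open>sum k I\<close> vertices; \<open>stability\<close> only needs an
  approximate order.\<close>

lemma embeds_of_order:
  assumes K: "1 \<le> K" and q: "1 \<le> q"
  shows "\<exists>N0. \<forall>(R :: 'a \<Rightarrow> 'a \<Rightarrow> bool) V I (E :: 'v \<Rightarrow> 'v \<Rightarrow> bool) k.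
     red_graph R \<and> finite V \<and> red_free R (Suc q) V \<and> rootable I E \<and> (\<forall>i\<in>I. 0 < k i \<and> k i \<le> K) \<and>
     N0 \<le> real (sum k I) \<and> card V = q * (sum k I - 1) + 1 \<longrightarrow> embeds R I E k V"
proof -
  define B where "B = real q"
  have B: "0 \<le> B" unfolding B_def by simp
  obtain s where s: "\<And>(R :: 'a \<Rightarrow> 'a \<Rightarrow> bool) V.
      red_graph R \<and> finite V \<and> red_free R (Suc q) V \<Longrightarrow> blue_cliques_from R K s V"
    using blue_cliques_exist[of "Suc q" K] by blast
  have d: "(0::real) < 1 / 4" "(1::real) / 4 \<le> 1" by simp_all
  from excess_embedding_asymptotic[OF d B, of K "Suc q" s]
  obtain \<gamma> L N1 where ex: "\<gamma> > 0" "\<forall>(R :: 'a \<Rightarrow> 'a \<Rightarrow> bool) V I (E :: 'v \<Rightarrow> 'v \<Rightarrow> bool) k C X.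
     red_graph R \<and> finite V \<and> rootable I E \<and> (\<forall>i\<in>I. k i \<le> K) \<and> red_free R (Suc q) V \<and>
     blue_cliques_from R K s V \<and> N1 \<le> real (sum k I) \<and> real (card V) \<le> B * real (sum k I) \<and>
     C \<subseteq> V \<and> (1 - \<gamma>) * real (sum k I) \<le> real (card C) \<and>
     (\<forall>x\<in>C. real (card (red_nbs R x C)) \<le> \<gamma> * real (sum k I)) \<and>
     X \<subseteq> V \<and> L \<le> card X \<and>
     (\<forall>x\<in>X. real (card (red_nbs R x C)) \<le> \<gamma> * real (sum k I) \<and>
            1 / 4 * real (sum k I) \<le> real (card (blue_nbs R {x} (V - C)))) \<longrightarrow>
     embeds R I E k V"
    by - (elim exE conjE, rule that; assumption)
  \<comment> \<open>\<open>\<gamma>\<close> serves the excess embedding, \<open>1 / 8\<close> the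
    choice of red transversals; the last bound ensures that at most \<open>L\<close> vertices
    exclude at most a quarter of N from a block.\<close>
  define \<zeta> where "\<zeta> = Min {\<gamma>, 1 / 8, 1 / (4 * (real L + 1))}"
  have z: "\<zeta> \<le> \<gamma>" "\<zeta> \<le> 1 / 8" "\<zeta> \<le> 1 / (4 * (real L + 1))" unfolding \<zeta>_def by (rule Min_le; simp)+
  have z0: "0 < \<zeta>" unfolding \<zeta>_def using ex(1) by simp
  \<comment> \<open>With the factor \<open>q + 1\<close>, the \<open>q\<close> choices of a red
    transversal exclude fewer than \<open>\<zeta> * N\<close> vertices of each block.\<close>
  define \<epsilon> where "\<epsilon> = \<zeta> / (real q + 1)"
  have e0: "0 < \<epsilon>" unfolding \<epsilon>_def using z0 by simp
  have "(real q + 1) * \<epsilon> = \<zeta>" unfolding \<epsilon>_def by simp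
  then have qe: "real q * \<epsilon> + \<epsilon> = \<zeta>" by (simp add: distrib_right)
  then have ez: "\<epsilon> \<le> \<zeta>" "real q * \<epsilon> < \<zeta>" using e0 by auto
  have zL: "real L * \<zeta> \<le> 1 / 4"
  proof -
    have "real L * \<zeta> \<le> (real L + 1) * (1 / (4 * (real L + 1)))" using z(3) z0 by (intro mult_mono) auto
    also have "\<dots> = 1 / 4" by simp
    finally show ?thesis .
  qed
  from stability[OF B, of q K, rule_format, OF e0]
  obtain \<delta> N2 where st: "\<delta> > 0" "\<forall>(R :: 'a \<Rightarrow> 'a \<Rightarrow> bool) V I (E :: 'v \<Rightarrow> 'v \<Rightarrow> bool) k.
     red_graph R \<and> finite V \<and> red_free R (Suc q) V \<and> rootable I E \<and> (\<forall>i\<in>I. k i \<le> K) \<and>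
     N2 \<le> real (sum k I) \<and> (real q - \<delta>) * real (sum k I) \<le> real (card V) \<and>
     real (card V) \<le> B * real (sum k I) \<and> \<not> embeds R I E k V \<longrightarrow>
     (\<exists>C. blue_blocks R \<epsilon> (real (sum k I)) q V C)"
    by - (elim exE conjE, rule that; assumption)
  \<comment> \<open>\<open>real q / \<delta>\<close> absorbs the difference between
    \<open>q * (N - 1) + 1\<close> and \<open>q * N\<close>; the last entry makes \<open>F\<close>
    and the tree large enough for \<open>clique_plus_few_embedding\<close>.\<close>
  define N0 where "N0 = Max {1, N1, N2, real q / \<delta>, 8 * real (L * K)}"
  have N0: "1 \<le> N0" "N1 \<le> N0" "N2 \<le> N0" "real q / \<delta> \<le> N0" "8 * real (L * K) \<le> N0"
    unfolding N0_def by (rule Max_ge; simp)+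
  have main: "embeds R I E k V"
    if R: "red_graph R" and V: "finite V" and rf: "red_free R (Suc q) V" and T: "rootable I E"
      and k: "\<forall>i\<in>I. 0 < k i \<and> k i \<le> K" and NN: "N0 \<le> real (sum k I)"
      and cV: "card V = q * (sum k I - 1) + 1"
    for R :: "'a \<Rightarrow> 'a \<Rightarrow> bool" and V I and E :: "'v \<Rightarrow> 'v \<Rightarrow> bool" and k
  proof (rule ccontr)
    assume ne: "\<not> embeds R I E k V"
    define N where "N = real (sum k I)"
    have N: "1 \<le> N" "N1 \<le> N" "N2 \<le> N" "8 * real (L * K) \<le> N" using N0 NN unfolding N_def by auto
    have "real q / \<delta> \<le> N" using N0 NN unfolding N_def by linarith
    then have Nd: "real q \<le> \<delta> * N" using st(1) by (simp add: field_simps)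
    have s1: "1 \<le> sum k I" using N(1) unfolding N_def by linarith
    have cl: "blue_cliques_from R K s V" using s R V rf by blast
    have kK: "\<forall>i\<in>I. k i \<le> K" using k by blast
    have fI: "finite I" using T unfolding rootable_def by blast
    have "real (card V) = real q * (N - 1) + 1" unfolding cV N_def using s1 by (simp add: of_nat_diff)
    then have cVr: "real (card V) = real q * N - real q + 1" by (simp add: algebra_simps)
    have VB: "real (card V) \<le> B * N" unfolding B_def using cVr q by simp
    have Vbig: "(real q - \<delta>) * N \<le> real (card V)" using cVr Nd by (simp add: left_diff_distrib)
    have "\<exists>C. blue_blocks R \<epsilon> N q V C"
      using R V rf T kK N(3) Vbig VB ne unfolding N_def by (intro st(2)[rule_format] conjI) auto
    then obtain C where bb: "blue_blocks R \<epsilon> N q V C" by blast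
    have C: "\<And>i. i < q \<Longrightarrow> C i \<subseteq> V" "\<And>i. i < q \<Longrightarrow> (1 - \<epsilon>) * N \<le> real (card (C i))"
         "\<And>i j. i < q \<Longrightarrow> j < q \<Longrightarrow> i \<noteq> j \<Longrightarrow> C i \<inter> C j = {}"
         "\<And>i j y. i < q \<Longrightarrow> j < q \<Longrightarrow> i \<noteq> j \<Longrightarrow> y \<in> C i \<Longrightarrow> real (card (blue_nbs R {y} (C j))) \<le> \<epsilon> * N"
      using bb unfolding blue_blocks_def by blast+
    have fC: "finite (C i)" if "i < q" for i using C(1)[OF that] V finite_subset by blast
    have eN: "0 \<le> \<epsilon> * N" using e0 N by simp
    have zN: "\<zeta> * N \<le> \<gamma> * N" "\<zeta> * N \<le> 1 / 8 * N" "\<epsilon> * N \<le> \<zeta> * N"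
      using z ez N by (auto intro: mult_right_mono)
    have qeN: "real q * (\<epsilon> * N) + \<epsilon> * N = \<zeta> * N"
      unfolding qe[symmetric] by (simp add: algebra_simps)
    have eN0: "0 < \<epsilon> * N" using e0 N by simp
    have CN: "N - \<epsilon> * N \<le> real (card (C i))" if "i < q" for i
      using C(2)[OF that] by (simp add: left_diff_distrib)
    \<comment> \<open>Otherwise \<open>x\<close> and a red transversal of its red neighbourhoods in
      all blocks would form a red clique of order \<open>q + 1\<close>.\<close>
    have "\<exists>i<q. real (card (red_nbs R x (C i))) \<le> \<zeta> * N" if x: "x \<in> V" for x
    proof (rule ccontr)
      assume neg: "\<not> ?thesis"
      have "\<not> red_free R (card {x} + card {..<q}) V"
      proof (rule transversal_not_red_free[OF R _ eN, where Z="\<lambda>i. red_nbs R x (C i)" and C=C])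
        fix i assume i: "i \<in> {..<q}"
        then have "\<zeta> * N < real (card (red_nbs R x (C i)))" using neg by (meson lessThan_iff not_le)
        then have "real (card {..<q}) * (\<epsilon> * N) < real (card (red_nbs R x (C i)))"
          using qeN eN0 by simp
        then show "red_nbs R x (C i) \<subseteq> C i \<and> finite (C i) \<and> C i \<subseteq> V \<and>
            real (card {..<q}) * (\<epsilon> * N) < real (card (red_nbs R x (C i)))"
          using i fC C(1) red_nbs_sub[of R x "C i"] by auto
      qed (use x C(4) in \<open>auto simp: red_clique_def red_nbs_def\<close>)
      then show False using rf by simp
    qed
    then obtain cls where cls: "\<And>x. x \<in> V \<Longrightarrow> cls x < q \<and> real (card (red_nbs R x (C (cls x)))) \<le> \<zeta> * N"
      by metis
    have "\<exists>i<q. sum k I \<le> card {x\<in>V. cls x = i}"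
    proof (rule ccontr)
      assume neg: "\<not> ?thesis"
      have "V = (\<Union>i<q. {x\<in>V. cls x = i})" using cls by auto
      then have "card V \<le> (\<Sum>i<q. card {x\<in>V. cls x = i})" using card_UN_le[of "{..<q}"] by (metis finite_lessThan)
      also have "\<dots> \<le> (\<Sum>i<q. sum k I - 1)" using neg by (intro sum_mono) (auto simp: not_le)
      also have "\<dots> = q * (sum k I - 1)" by simp
      finally show False using cV by simp
    qed
    then obtain i where i: "i < q" "sum k I \<le> card {x\<in>V. cls x = i}" by blast
    \<comment> \<open>\<open>cls\<close> may have put vertices of block \<open>i\<close> into
      another class; adding the block makes sure that the whole near-clique lies in
      \<open>W\<close>.\<close>
    define W where "W = C i \<union> {x\<in>V. cls x = i}"
    have WV: "W \<subseteq> V" unfolding W_def using C(1)[OF i(1)] by auto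
    have fW: "finite W" using WV V finite_subset by blast
    have "card {x\<in>V. cls x = i} \<le> card W" using fW unfolding W_def by (intro card_mono) auto
    then have cW: "sum k I \<le> card W" using i(2) by linarith
    \<comment> \<open>With the bound \<open>1 / 4\<close>, any two vertices of \<open>D\<close> have
      more than about half of every other block as common red neighbours, so a red edge in
      \<open>D\<close> would extend to a red clique of order \<open>q + 1\<close>.\<close>
    define D where "D = {x\<in>W. \<forall>j<q. j \<noteq> i \<longrightarrow> real (card (blue_nbs R {x} (C j))) < 1 / 4 * N}"
    have DW: "D \<subseteq> W" unfolding D_def by auto
    have Dclique: "blue_clique R D"
      unfolding blue_clique_def
    proof (intro ballI notI)
      fix x y assume xy: "x \<in> D" "y \<in> D" "R x y"
      then have "x \<noteq> y" using red_graphD(2)[OF R] by blast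
      then have c2: "card {x, y} = 2" by simp
      have cJ: "card ({..<q} - {i}) = q - 1" using i(1) by simp
      have "\<not> red_free R (card {x, y} + card ({..<q} - {i})) V"
      proof (rule transversal_not_red_free[OF R _ eN, where Z="\<lambda>j. C j - (blue_nbs R {x} (C j) \<union> blue_nbs R {y} (C j))" and C=C])
        fix j assume "j \<in> {..<q} - {i}"
        then have j: "j < q" "j \<noteq> i" by auto
        define Y where "Y = blue_nbs R {x} (C j) \<union> blue_nbs R {y} (C j)"
        have "real (card (blue_nbs R {x} (C j))) < 1 / 4 * N" "real (card (blue_nbs R {y} (C j))) < 1 / 4 * N"
          using xy(1,2) j unfolding D_def by auto
        moreover have "card Y \<le> card (blue_nbs R {x} (C j)) + card (blue_nbs R {y} (C j))"
          unfolding Y_def by (rule card_Un_le)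
        ultimately have "real (card Y) < 1 / 2 * N" by linarith
        moreover have "card (C j) - card Y \<le> card (C j - Y)"
          using fC[OF j(1)] unfolding Y_def by (intro diff_card_le_card_Diff) auto
        ultimately have "N - \<epsilon> * N - 1 / 2 * N < real (card (C j - Y))" using CN[OF j(1)] by linarith
        moreover have "real (card ({..<q} - {i})) * (\<epsilon> * N) \<le> real q * (\<epsilon> * N)"
          using eN cJ by (intro mult_right_mono) auto
        ultimately have "real (card ({..<q} - {i})) * (\<epsilon> * N) < real (card (C j - Y))"
          using qeN zN(2) eN0 N(1) by linarith
        then show "C j - (blue_nbs R {x} (C j) \<union> blue_nbs R {y} (C j)) \<subseteq> C j \<and> finite (C j) \<and> C j \<subseteq> V \<and>
            real (card ({..<q} - {i})) * (\<epsilon> * N) < real (card (C j - (blue_nbs R {x} (C j) \<union> blue_nbs R {y} (C j))))"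
          unfolding Y_def using fC[OF j(1)] C(1)[OF j(1)] by blast
      next
        show "{x, y} \<subseteq> V" using xy DW WV by blast
        show "red_clique R {x, y}" unfolding red_clique_def using xy(3) red_graphD(1)[OF R] by auto
      qed (use C(4) in \<open>auto simp: blue_nbs_def\<close>)
      moreover have "card {x, y} + card ({..<q} - {i}) = Suc q" using c2 cJ q by simp
      ultimately show False using rf by simp
    qed
    have CD: "C i \<subseteq> D"
    proof
      fix x assume x: "x \<in> C i"
      have "real (card (blue_nbs R {x} (C j))) < 1 / 4 * N" if "j < q" "j \<noteq> i" for j
      proof -
        have "real (card (blue_nbs R {x} (C j))) \<le> \<epsilon> * N"
          using C(4)[OF i(1) that(1) that(2)[symmetric] x] .
        then show ?thesis using zN N(1) by linarith
      qed
      then show "x \<in> D" using x unfolding D_def W_def by auto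
    qed
    have Wred: "real (card (red_nbs R x (C i))) \<le> \<zeta> * N" if x: "x \<in> W" for x
    proof (cases "x \<in> C i")
      case True
      then have "red_nbs R x (C i) = {}" using CD Dclique unfolding red_nbs_def blue_clique_def by blast
      then show ?thesis using z0 N by simp
    next
      case False
      then show ?thesis using x cls[of x] unfolding W_def by auto
    qed
    define X where "X = W - D"
    have fX: "finite X" "X \<subseteq> W" "X \<subseteq> V" using fW WV unfolding X_def by auto
    show False
    proof (cases "L \<le> card X")
      case True
      have big: "1 / 4 * N \<le> real (card (blue_nbs R {x} (V - C i)))" if x: "x \<in> X" for x
      proof -
        obtain j where j: "j < q" "j \<noteq> i" "1 / 4 * N \<le> real (card (blue_nbs R {x} (C j)))"
          using x unfolding X_def D_def by (auto simp: not_less)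
        have "C j \<subseteq> V - C i" using C(1)[OF j(1)] C(3)[OF i(1) j(1)] j(2) by blast
        then have "card (blue_nbs R {x} (C j)) \<le> card (blue_nbs R {x} (V - C i))"
          using V by (intro card_mono blue_nbs_mono) auto
        then show ?thesis using j(3) by linarith
      qed
      have red: "real (card (red_nbs R x (C i))) \<le> \<gamma> * N" if "x \<in> W" for x
        using Wred[OF that] zN(1) by linarith
      have "(1 - \<gamma>) * N \<le> real (card (C i))"
        using CN[OF i(1)] zN(1,3) unfolding left_diff_distrib mult_1 by linarith
      then have "embeds R I E k V"
        using R V T kK rf cl N(2) VB C(1)[OF i(1)] fX(3) True big red fX(2)
        unfolding N_def by (intro ex(2)[rule_format, of R V I E k "C i" X] conjI ballI) (auto simp: W_def)
      then show False using ne by blast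
    next
      case False
      then have XL: "card X \<le> L" by simp
      obtain r par ord where r: "rooted I E r par ord" using T unfolding rootable_def by blast
      \<comment> \<open>The part of the block that is blue to all of \<open>X\<close>; having at
        least \<open>N / 2\<close> vertices, it can receive all neighbours of what is placed in
        \<open>X\<close>.\<close>
      define F where "F = blue_nbs R X (C i)"
      have "real (card (C i)) - real (card X) * (\<zeta> * N) \<le> real (card F)"
        unfolding F_def using fC[OF i(1)] fX Wred by (intro card_blue_nbs_ge) auto
      moreover have "real (card X) * (\<zeta> * N) \<le> real L * (\<zeta> * N)"
        using XL z0 N by (intro mult_right_mono) auto
      moreover have "real L * (\<zeta> * N) \<le> 1 / 4 * N"
        using mult_right_mono[OF zL, of N] N by (simp add: mult.assoc)
      ultimately have Fbig: "N / 2 \<le> real (card F)" using CN[OF i(1)] zN N(1) by linarith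
      have XK: "card X * K \<le> L * K" using XL by simp
      have "8 * (L * K) \<le> sum k I" using N(4) unfolding N_def by linarith
      moreover have "sum k I \<le> card I * K" using sum_bounded_above[of I k K] kK by auto
      ultimately have "(8 * card X) * K \<le> card I * K" using XK by linarith
      then have cI: "6 * card X \<le> card I" using K by simp
      have "real (8 * (card X * K)) \<le> N" using N(4) XK by linarith
      then have cF: "4 * card X * K \<le> card F" using Fbig by linarith
      have "embeds R I E k (D \<union> X)"
      proof (rule clique_plus_few_embedding[OF R r fI _ _ Dclique fX(1) _ _ _ _ cF cI])
        show "0 < k i \<and> k i \<le> K" if "i \<in> I" for i using k that by blast
        show "finite D" using DW fW finite_subset by blast
        show "D \<inter> X = {}" unfolding X_def by blast
        have "card W \<le> card D + card X" using card_Un_le[of D X] DW unfolding X_def by (metis Un_Diff_cancel sup.absorb2)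
        then show "sum k I \<le> card D + card X" using cW by linarith
        show "F \<subseteq> D" unfolding F_def using CD blue_nbs_sub[of R X "C i"] by blast
        show "\<not> R f x" if "f \<in> F" "x \<in> X" for f x
          using that red_graphD(1)[OF R] unfolding F_def blue_nbs_def by blast
      qed
      moreover have "D \<union> X \<subseteq> V" using DW WV fX by blast
      ultimately show False using ne embeds_mono by blast
    qed
  qed
  show ?thesis
    by (rule exI[of _ N0], intro allI impI, elim conjE, rule main; assumption)
qed

section \<open>Ramsey numbers of blown-up trees\<close>

lemma pair_graphI:
  assumes "finite (pverts G)"
    and "\<And>x y. (x, y) \<in> parcs G \<Longrightarrow> x \<in> pverts G \<and> y \<in> pverts G \<and> x \<noteq> y \<and> (y, x) \<in> parcs G"
  shows "pair_graph G"
proof -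
  have "parcs G \<subseteq> pverts G \<times> pverts G" using assms(2) by auto
  then have "finite (parcs G)" using assms(1) by (meson finite_SigmaI finite_subset)
  then show ?thesis
    using assms by unfold_locales (auto simp: symmetric_def intro!: symI)
qed

lemma pair_graphD:
  assumes "pair_graph G"
  shows "finite (pverts G)"
    and "(x, y) \<in> parcs G \<Longrightarrow> x \<in> pverts G \<and> y \<in> pverts G \<and> x \<noteq> y \<and> (y, x) \<in> parcs G"
proof -
  interpret pair_graph G by fact
  show "finite (pverts G)" by (rule pair_finite_verts)
  show "(x, y) \<in> parcs G \<Longrightarrow> x \<in> pverts G \<and> y \<in> pverts G \<and> x \<noteq> y \<and> (y, x) \<in> parcs G"
    using in_arcsD1 in_arcsD2 no_loops' arcs_symmetric by blast
qed

lemma connected_pair_graph_iff: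
  assumes "pair_graph G"
  shows "Digraph_Component.connected G \<longleftrightarrow>
    pverts G \<noteq> {} \<and> (\<forall>u\<in>pverts G. \<forall>v\<in>pverts G. (u, v) \<in> (parcs G)\<^sup>*)"
proof -
  interpret pair_graph G by fact
  have "symmetric (with_proj G)" by (rule sym_arcs)
  then show ?thesis
    unfolding connected_def strongly_connected_def
    by (simp add: reachable_mk_symmetric_eq reachable_conv)
qed

lemma rtrancl_crossing:
  assumes "(r, w) \<in> R\<^sup>*" "r \<in> D" "w \<notin> D"
  shows "\<exists>a\<in>D. \<exists>b. b \<notin> D \<and> (a, b) \<in> R"
  using assms by (induction rule: rtrancl_induct) auto

lemma pawalk_verts_append_two:
  "pcas a p b \<Longrightarrow> pawalk_verts a (p @ [(b, v), (v, c)]) = pawalk_verts a p @ [v, c]"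
  by (induction p arbitrary: a) auto

text \<open>A path from \<open>a\<close> to \<open>b\<close> inside \<open>D\<close> closes up
  through \<open>v\<close>; since \<open>a\<close> and \<open>b\<close> differ it has an arc, so the
  cycle has length at least 3.\<close>

lemma cycle_of_two_neighbours:
  assumes G: "pair_graph G" and D: "D \<subseteq> pverts G"
    and ab: "a \<in> D" "b \<in> D" "a \<noteq> b" "(a, b) \<in> (parcs G \<inter> D \<times> D)\<^sup>*"
    and v: "v \<notin> D" "(b, v) \<in> parcs G" "(v, a) \<in> parcs G"
  shows "\<exists>c. pre_digraph.cycle (with_proj G) c \<and> 3 \<le> length c"
proof -
  interpret G: pair_graph G by fact
  define G' where "G' = \<lparr>pverts = D, parcs = parcs G \<inter> D \<times> D\<rparr>"
  interpret G': pair_wf_digraph G' by unfold_locales (auto simp: G'_def)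
  have "reachable (with_proj G') a b" unfolding G'.reachable_conv using ab by (auto simp: G'_def)
  then obtain p where p: "G'.apath a p b" using G'.reachable_apath by blast
  have p1: "set p \<subseteq> parcs G" "pcas a p b" "distinct (pawalk_verts a p)" "set (pawalk_verts a p) \<subseteq> D"
  proof -
    have aw: "a \<in> pverts G'" "set p \<subseteq> parcs G'" "pcas a p b" and "distinct (pawalk_verts a p)"
      using p unfolding G'.apath_def G'.awalk_def by auto
    then show "set p \<subseteq> parcs G" "pcas a p b" "distinct (pawalk_verts a p)" unfolding G'_def by auto
    show "set (pawalk_verts a p) \<subseteq> D"
      using G'.awalk_verts_in_verts[OF aw(1,2)] unfolding G'_def by auto
  qed
  define c where "c = p @ [(b, v), (v, a)]"
  have cas: "pcas a c a" using p1(2) unfolding c_def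
  proof -
    have "pcas x (p @ [(b, v), (v, y)]) y" if "pcas x p b" for x y
      using that by (induction p arbitrary: x) auto
    then show "pcas a (p @ [(b, v), (v, a)]) a" using p1(2) by blast
  qed
  have aV: "a \<in> pverts G" using ab(1) D by blast
  have aw: "G.awalk a c a"
    unfolding G.awalk_def using aV cas p1(1) v(2,3) by (auto simp: c_def)
  have pv: "pawalk_verts a c = pawalk_verts a p @ [v, a]"
    unfolding c_def by (rule pawalk_verts_append_two[OF p1(2)])
  have hd: "pawalk_verts a p = a # tl (pawalk_verts a p)" using p1(2) by (cases p) auto
  then have at: "a \<notin> set (tl (pawalk_verts a p))" "distinct (tl (pawalk_verts a p))"
    using p1(3) by (metis distinct.simps(2))+
  have "set (tl (pawalk_verts a p)) \<subseteq> set (pawalk_verts a p)" using hd by (metis set_subset_Cons)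
  then have vt: "v \<notin> set (tl (pawalk_verts a p))" using p1(4) v(1) by blast
  have "tl (pawalk_verts a c) = tl (pawalk_verts a p) @ [v, a]" unfolding pv using hd by (metis append_Cons list.sel(3))
  then have dist: "distinct (tl (pawalk_verts a c))" using at vt v(1) ab(1) by auto
  have "p \<noteq> []" using p1(2) ab(3) by auto
  then have "3 \<le> length c" unfolding c_def by (cases p) auto
  moreover have "G.cycle c" unfolding G.cycle_def using aw dist by (auto simp: c_def)
  ultimately show ?thesis by blast
qed

text \<open>A subtree grows from \<open>r\<close> vertex by vertex. Connectivity supplies an arc
  leaving it, and by acyclicity the outer end has only one neighbour inside, which becomes its
  parent.\<close>

lemma tree_graph_rootable:
  assumes T: "tree_graph T"
  shows "rootable (pverts T) (\<lambda>u v. (u, v) \<in> parcs T)"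
proof -
  have G: "pair_graph T" and con: "Digraph_Component.connected T"
    and acyc: "\<not> (\<exists>c. pre_digraph.cycle (with_proj T) c \<and> 3 \<le> length c)"
    using T unfolding tree_graph_def by auto
  define V where "V = pverts T"
  define A where "A = parcs T"
  have fV: "finite V" and A: "\<And>x y. (x, y) \<in> A \<Longrightarrow> x \<in> V \<and> y \<in> V \<and> x \<noteq> y \<and> (y, x) \<in> A"
    unfolding V_def A_def using pair_graphD[OF G] by auto
  have ne: "V \<noteq> {}" and reach: "\<And>u v. u \<in> V \<Longrightarrow> v \<in> V \<Longrightarrow> (u, v) \<in> A\<^sup>*"
    using con unfolding connected_pair_graph_iff[OF G] V_def A_def by auto
  have "\<exists>par ord. rooted V (\<lambda>u v. (u, v) \<in> A) r par ord" if r: "r \<in> V" for r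
  proof -
    define E where "E D = (\<lambda>u v. (u, v) \<in> A \<inter> D \<times> D)" for D
    \<comment> \<open>Reachability within \<open>D\<close> is carried along to provide the path
      needed by \<open>cycle_of_two_neighbours\<close>.\<close>
    have grow: "n < card V \<longrightarrow> (\<exists>D par ord. D \<subseteq> V \<and> card D = Suc n \<and> rooted D (E D) r par ord \<and>
        (\<forall>a\<in>D. (r, a) \<in> (A \<inter> D \<times> D)\<^sup>*))" for n
    proof (induction n)
      case 0
      have "rooted {r} (E {r}) r id (\<lambda>_. 0)" unfolding rooted_def E_def using A by auto
      then show ?case using r by (intro impI exI[of _ "{r}"]) auto
    next
      case (Suc n)
      show ?case
      proof
        assume n: "Suc n < card V"
        then obtain D par ord where D: "D \<subseteq> V" "card D = Suc n" "rooted D (E D) r par ord"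
          "\<And>a. a \<in> D \<Longrightarrow> (r, a) \<in> (A \<inter> D \<times> D)\<^sup>*" using Suc.IH by auto
        have fD: "finite D" using D(1) fV finite_subset by blast
        have rD: "r \<in> D" using D(3) unfolding rooted_def by blast
        have "D \<noteq> V" using D(2) n by auto
        then obtain w where w: "w \<in> V" "w \<notin> D" using D(1) by blast
        obtain a v where av: "a \<in> D" "v \<notin> D" "(a, v) \<in> A"
          using rtrancl_crossing[OF reach[OF r w(1)] rD w(2)] by blast
        have vV: "v \<in> V" "(v, a) \<in> A" "v \<noteq> r" using A[OF av(3)] av(2) rD by auto
        have sym: "sym (A \<inter> D \<times> D)" using A by (auto intro!: symI)
        have uniq: "b = a" if b: "b \<in> D" "(b, v) \<in> A" for b
        proof (rule ccontr)
          assume ba: "b \<noteq> a"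
          have "(a, r) \<in> (A \<inter> D \<times> D)\<^sup>*" using D(4)[OF av(1)] sym by (metis sym_rtrancl symD)
          then have "(a, b) \<in> (A \<inter> D \<times> D)\<^sup>*" using D(4)[OF b(1)] by (rule rtrancl_trans)
          then show False
            using cycle_of_two_neighbours[OF G, of D a b v] D(1) av(1,2) b ba vV(2) acyc
            unfolding V_def A_def by blast
        qed
        define D' where "D' = insert v D"
        define par' where "par' = par(v := a)"
        define ord' where "ord' = ord(v := Suc (ord a))"
        have sub: "A \<inter> D \<times> D \<subseteq> A \<inter> D' \<times> D'" unfolding D'_def by auto
        have ED: "E D u w \<longleftrightarrow> u \<in> D \<and> w \<in> D \<and> (u \<noteq> r \<and> w = par u \<or> w \<noteq> r \<and> u = par w)" for u w
          using D(3) unfolding rooted_def by blast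
        have parD: "par u \<in> D" "ord (par u) < ord u" if "u \<in> D" "u \<noteq> r" for u
          using D(3) that unfolding rooted_def by auto
        have nv: "u \<noteq> v" if "u \<in> D" for u using that av(2) by blast
        have "rooted D' (E D') r par' ord'"
          unfolding rooted_def
        proof (intro conjI ballI allI)
          show "r \<in> D'" using rD unfolding D'_def by simp
        next
          fix u assume u: "u \<in> D' - {r}"
          show "par' u \<in> D'" "ord' (par' u) < ord' u"
            using u av(1) parD[of u] nv[of a] nv[of "par u"] nv[of u]
            unfolding D'_def par'_def ord'_def by (cases "u = v"; auto)+
        next
          fix u w
          show "E D' u w \<longleftrightarrow> u \<in> D' \<and> w \<in> D' \<and> (u \<noteq> r \<and> w = par' u \<or> w \<noteq> r \<and> u = par' w)"
          proof (cases "u = v \<or> w = v")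
            case False
            then have "E D' u w \<longleftrightarrow> E D u w" unfolding E_def D'_def by auto
            then show ?thesis using ED[of u w] False unfolding D'_def par'_def by auto
          next
            case True
            have "(v, v) \<notin> A" using A by blast
            moreover have "(x, v) \<in> A \<longleftrightarrow> x = a" if "x \<in> D" for x using uniq[OF that] av(3) by blast
            moreover have "(v, x) \<in> A \<longleftrightarrow> x = a" if "x \<in> D" for x
              using uniq[OF that] A[of v x] vV(2) by blast
            moreover have "par x \<noteq> v" if "x \<in> D" "x \<noteq> r" for x using parD(1)[OF that] av(2) by blast
            ultimately show ?thesis
              using True av(1,2) vV(3) unfolding E_def D'_def par'_def by auto
          qed
        qed
        moreover have "(r, x) \<in> (A \<inter> D' \<times> D')\<^sup>*" if "x \<in> D'" for x
        proof -
          have old: "(r, y) \<in> (A \<inter> D' \<times> D')\<^sup>*" if "y \<in> D" for y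
            using D(4)[OF that] rtrancl_mono[OF sub] by blast
          have "(a, v) \<in> A \<inter> D' \<times> D'" using av unfolding D'_def by auto
          then have "(r, v) \<in> (A \<inter> D' \<times> D')\<^sup>*" using old[OF av(1)] by (rule rtrancl_into_rtrancl[rotated])
          then show ?thesis using old that unfolding D'_def by auto
        qed
        moreover have "D' \<subseteq> V" "card D' = Suc (Suc n)" unfolding D'_def using D(1,2) vV(1) fD av(2) by auto
        ultimately show "\<exists>D par ord. D \<subseteq> V \<and> card D = Suc (Suc n) \<and> rooted D (E D) r par ord \<and>
            (\<forall>a\<in>D. (r, a) \<in> (A \<inter> D \<times> D)\<^sup>*)"
          by (intro exI[of _ D'] exI[of _ par'] exI[of _ ord']) auto
      qed
    qed
    have "card V - 1 < card V" using fV ne by (simp add: card_gt_0_iff)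
    then obtain D par ord where D: "D \<subseteq> V" "card D = Suc (card V - 1)" "rooted D (E D) r par ord"
      using grow[of "card V - 1"] by blast
    have "card D = card V" using D(2) fV ne by (simp add: card_gt_0_iff)
    then have "D = V" using D(1) fV card_subset_eq by blast
    moreover have "E V = (\<lambda>u v. (u, v) \<in> A)" unfolding E_def using A by auto
    ultimately show ?thesis using D(3) by auto
  qed
  then show ?thesis unfolding rootable_def using fV ne unfolding V_def A_def by blast
qed

text \<open>Since tails and heads are the projections on both sides, an isomorphism acts on an arc
  by its vertex map at both ends, so a copy amounts to an injective edge-preserving map.\<close>

lemma contains_copy_iff:
  fixes G :: "'a pair_pre_digraph" and H :: "'b pair_pre_digraph"
  assumes G: "pair_graph G" and H: "pair_graph H"
  shows "contains_copy G H \<longleftrightarrow>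
    (\<exists>f. inj_on f (pverts H) \<and> f ` pverts H \<subseteq> pverts G \<and> (\<forall>x y. (x, y) \<in> parcs H \<longrightarrow> (f x, f y) \<in> parcs G))"
proof
  interpret G: pair_graph G by fact
  interpret H: pair_graph H by fact
  assume "contains_copy G H"
  then obtain H' :: "'a pair_pre_digraph" and h
    where s: "subgraph (with_proj H') (with_proj G)"
      and h: "H.digraph_isomorphism h" "with_proj H' = app_iso h (with_proj H)"
    unfolding contains_copy_def digraph_iso_def by blast
  define f where "f = iso_verts h"
  have v: "pverts H' = f ` pverts H" using arg_cong[OF h(2), of verts] by (simp add: f_def)
  have a: "parcs H' = iso_arcs h ` parcs H" using arg_cong[OF h(2), of arcs] by simp
  have t: "iso_tail h = fst" using arg_cong[OF h(2), of tail] by simp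
  have hd: "iso_head h = snd" using arg_cong[OF h(2), of head] by simp
  have sub: "pverts H' \<subseteq> pverts G" "parcs H' \<subseteq> parcs G" using s unfolding subgraph_def by auto
  have "inj_on f (pverts H)" using h(1) unfolding H.digraph_isomorphism_def f_def by auto
  moreover have "(f x, f y) \<in> parcs G" if xy: "(x, y) \<in> parcs H" for x y
  proof -
    have "f x = fst (iso_arcs h (x, y))" "f y = snd (iso_arcs h (x, y))"
      using h(1) xy t hd unfolding H.digraph_isomorphism_def f_def by fastforce+
    then have "(f x, f y) = iso_arcs h (x, y)" by simp
    then show ?thesis using xy a sub(2) by auto
  qed
  ultimately show "\<exists>f. inj_on f (pverts H) \<and> f ` pverts H \<subseteq> pverts G \<and>
      (\<forall>x y. (x, y) \<in> parcs H \<longrightarrow> (f x, f y) \<in> parcs G)" using v sub(1) by blast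
next
  interpret G: pair_graph G by fact
  interpret H: pair_graph H by fact
  assume "\<exists>f. inj_on f (pverts H) \<and> f ` pverts H \<subseteq> pverts G \<and>
      (\<forall>x y. (x, y) \<in> parcs H \<longrightarrow> (f x, f y) \<in> parcs G)"
  then obtain f where f: "inj_on f (pverts H)" "f ` pverts H \<subseteq> pverts G"
      "\<And>x y. (x, y) \<in> parcs H \<Longrightarrow> (f x, f y) \<in> parcs G" by blast
  define H' where "H' = \<lparr>pverts = f ` pverts H, parcs = map_prod f f ` parcs H\<rparr>"
  define h where "h = \<lparr>iso_verts = f, iso_arcs = map_prod f f, iso_head = snd, iso_tail = fst\<rparr>"
  have Hp: "parcs H \<subseteq> pverts H \<times> pverts H" using pair_graphD(2)[OF H] by auto
  have inj: "inj_on (map_prod f f) (parcs H)"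
    using map_prod_inj_on[OF f(1) f(1)] Hp by (rule inj_on_subset)
  have "wf_digraph (with_proj H)" by unfold_locales
  then have "H.digraph_isomorphism h"
    unfolding H.digraph_isomorphism_def using f(1) inj by (auto simp: h_def)
  moreover have "with_proj H' = app_iso h (with_proj H)"
    unfolding H'_def h_def app_iso_def with_proj_def by simp
  ultimately have "digraph_iso (with_proj H) (with_proj H')" unfolding digraph_iso_def by blast
  moreover have "subgraph (with_proj H') (with_proj G)"
  proof -
    have "pair_wf_digraph H'" by unfold_locales (auto simp: H'_def dest: pair_graphD(2)[OF H])
    then have "wf_digraph (with_proj H')" using wf_digraph_wp_iff by blast
    moreover have "wf_digraph (with_proj G)" by unfold_locales
    ultimately show ?thesis unfolding subgraph_def compatible_def using f(2,3) by (auto simp: H'_def)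
  qed
  ultimately show "contains_copy G H" unfolding contains_copy_def by blast
qed

lemma pair_graph_complete_graph: "finite V \<Longrightarrow> pair_graph (complete_graph V)"
  by (rule pair_graphI) (auto simp: complete_graph_def)

lemma blowup_simps:
  "pverts (blowup G k) = (SIGMA i:pverts G. {1..k i})"
  "(x, y) \<in> parcs (blowup G k) \<longleftrightarrow> x \<in> (SIGMA i:pverts G. {1..k i}) \<and> y \<in> (SIGMA i:pverts G. {1..k i}) \<and>
     (fst x = fst y \<and> snd x \<noteq> snd y \<or> (fst x, fst y) \<in> parcs G)"
  unfolding blowup_def Let_def by auto

lemma pair_graph_blowup:
  assumes G: "pair_graph G"
  shows "pair_graph (blowup G k)"
proof (rule pair_graphI)
  show "finite (pverts (blowup G k))" unfolding blowup_simps using pair_graphD(1)[OF G] by simp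
  fix x y assume xy: "(x, y) \<in> parcs (blowup G k)"
  then have "x \<noteq> y" unfolding blowup_simps using pair_graphD(2)[OF G] by metis
  then show "x \<in> pverts (blowup G k) \<and> y \<in> pverts (blowup G k) \<and> x \<noteq> y \<and> (y, x) \<in> parcs (blowup G k)"
    using xy pair_graphD(2)[OF G, of "fst x" "fst y"] unfolding blowup_simps by metis
qed

text \<open>Paths of \<open>G\<close> lift to the members with index 1, and all other members are
  adjacent to those within their own clique.\<close>

lemma connected_blowup:
  assumes G: "pair_graph G" and con: "Digraph_Component.connected G"
    and k: "\<And>i. i \<in> pverts G \<Longrightarrow> 0 < k i"
  shows "Digraph_Component.connected (blowup G k)"
proof -
  define V where "V = pverts (blowup G k)"
  have V: "(i, s) \<in> V \<longleftrightarrow> i \<in> pverts G \<and> s \<in> {1..k i}" for i s unfolding V_def blowup_simps by auto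
  have arc: "((i, s), (j, t)) \<in> parcs (blowup G k)"
    if "(i, s) \<in> V" "(j, t) \<in> V" "i = j \<and> s \<noteq> t \<or> (i, j) \<in> parcs G" for i s j t
    using that unfolding V_def blowup_simps by auto
  have one: "(i, 1) \<in> V" if "i \<in> pverts G" for i using k[OF that] that unfolding V by auto
  have cls: "((i, s), (i, t)) \<in> (parcs (blowup G k))\<^sup>*" if "(i, s) \<in> V" "(i, t) \<in> V" for i s t
    using arc[OF that] by (cases "s = t") auto
  have step: "((i, s), (j, 1)) \<in> (parcs (blowup G k))\<^sup>*" if "(i, j) \<in> (parcs G)\<^sup>*" "(i, s) \<in> V" for i j s
    using that(1)
  proof (induction rule: rtrancl_induct)
    case base
    show ?case using cls[OF that(2) one] that(2) V by auto
  next
    case (step y z)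
    have "((y, 1), (z, 1)) \<in> parcs (blowup G k)"
      using arc[OF one one] pair_graphD(2)[OF G step(2)] step(2) by blast
    then show ?case using step.IH by (rule rtrancl_into_rtrancl[rotated])
  qed
  have ne: "pverts G \<noteq> {}" and reach: "\<And>i j. i \<in> pverts G \<Longrightarrow> j \<in> pverts G \<Longrightarrow> (i, j) \<in> (parcs G)\<^sup>*"
    using con unfolding connected_pair_graph_iff[OF G] by auto
  have "((i, s), (j, t)) \<in> (parcs (blowup G k))\<^sup>*" if "(i, s) \<in> V" "(j, t) \<in> V" for i s j t
  proof -
    have "i \<in> pverts G" "j \<in> pverts G" using that V by auto
    then show ?thesis using step[OF reach that(1)] cls[OF one that(2)] by (meson rtrancl_trans)
  qed
  then have "\<forall>x\<in>V. \<forall>y\<in>V. (x, y) \<in> (parcs (blowup G k))\<^sup>*" by auto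
  moreover have "V \<noteq> {}" using ne one by blast
  ultimately show ?thesis
    unfolding connected_pair_graph_iff[OF pair_graph_blowup[OF G]] V_def by blast
qed

section \<open>The lower bound and the Ramsey number\<close>

lemma no_copies_in_small_complete_graph:
  fixes H :: "'b pair_pre_digraph"
  assumes H: "pair_graph H" "Digraph_Component.connected H" "2 \<le> card (pverts H)" and p: "1 \<le> p"
    and m: "m \<le> (p - 1) * (card (pverts H) - 1)"
  shows "\<exists>R B. edge_partition (complete_graph {1..m}) R B \<and>
    \<not> contains_copy R (complete_graph {1..p}) \<and> \<not> contains_copy B H"
proof -
  \<comment> \<open>\<open>p - 1\<close> disjoint blue cliques with one vertex fewer than \<open>H\<close>\<close>
  define M where "M = card (pverts H) - 1"
  have M: "0 < M" "M < card (pverts H)" using H(3) unfolding M_def by auto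
  \<comment> \<open>Vertices are numbered from 1, hence \<open>v - 1\<close>: the classes are
    intervals of \<open>M\<close> consecutive numbers.\<close>
  define c where "c v = (v - 1) div M" for v :: nat
  define R where "R = \<lparr>pverts = {1..m}, parcs = {(u, v). u \<in> {1..m} \<and> v \<in> {1..m} \<and> c u \<noteq> c v}\<rparr>"
  define B where "B = \<lparr>pverts = {1..m}, parcs = {(u, v). u \<in> {1..m} \<and> v \<in> {1..m} \<and> u \<noteq> v \<and> c u = c v}\<rparr>"
  have pR: "pair_graph R" by (rule pair_graphI) (auto simp: R_def)
  have pB: "pair_graph B" by (rule pair_graphI) (auto simp: B_def)
  have "edge_partition (complete_graph {1..m}) R B"
    unfolding edge_partition_def using pR pB by (auto simp: R_def B_def complete_graph_def)
  moreover have "\<not> contains_copy R (complete_graph {1..p})"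
  proof
    assume "contains_copy R (complete_graph {1..p})"
    then obtain f where f: "f ` {1..p} \<subseteq> {1..m}"
      "\<And>x y. x \<in> {1..p} \<Longrightarrow> y \<in> {1..p} \<Longrightarrow> x \<noteq> y \<Longrightarrow> c (f x) \<noteq> c (f y)"
      unfolding contains_copy_iff[OF pR pair_graph_complete_graph[OF finite_atLeastAtMost]]
      by (auto simp: R_def complete_graph_def)
    have "inj_on (c \<circ> f) {1..p}" by (rule inj_onI) (use f(2) in auto)
    then have "card ((c \<circ> f) ` {1..p}) = card {1..p}" by (rule card_image)
    moreover have "(c \<circ> f) ` {1..p} \<subseteq> {..<p - 1}"
    proof
      fix z assume "z \<in> (c \<circ> f) ` {1..p}"
      then obtain x where x: "x \<in> {1..p}" "z = c (f x)" by auto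
      then have "f x \<in> {1..m}" using f(1) by blast
      then have "f x - 1 < (p - 1) * M" using m unfolding M_def by auto
      then show "z \<in> {..<p - 1}" using x(2) unfolding c_def by (simp add: less_mult_imp_div_less)
    qed
    then have "card ((c \<circ> f) ` {1..p}) \<le> card {..<p - 1}" by (rule card_mono[OF finite_lessThan])
    ultimately have "card {1..p} \<le> card {..<p - 1}" by (simp only:)
    then show False using p by simp
  qed
  moreover have "\<not> contains_copy B H"
  proof
    assume "contains_copy B H"
    then obtain f where f: "inj_on f (pverts H)" "f ` pverts H \<subseteq> {1..m}"
      "\<And>x y. (x, y) \<in> parcs H \<Longrightarrow> c (f x) = c (f y)"
      unfolding contains_copy_iff[OF pB H(1)] by (auto simp: B_def)
    have ne: "pverts H \<noteq> {}" and reach: "\<And>x y. x \<in> pverts H \<Longrightarrow> y \<in> pverts H \<Longrightarrow> (x, y) \<in> (parcs H)\<^sup>*"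
      using H(2) unfolding connected_pair_graph_iff[OF H(1)] by auto
    obtain x0 where x0: "x0 \<in> pverts H" using ne by blast
    \<comment> \<open>\<open>H\<close> is connected, so a blue copy stays inside one class, which
      has only \<open>M\<close> vertices.\<close>
    have const: "c (f y) = c (f x0)" if "(x0, y) \<in> (parcs H)\<^sup>*" for y
      using that by (induction rule: rtrancl_induct) (auto dest: f(3))
    have "f ` pverts H \<subseteq> {c (f x0) * M + 1..c (f x0) * M + M}"
    proof
      fix z assume "z \<in> f ` pverts H"
      then obtain y where y: "y \<in> pverts H" "z = f y" by blast
      have cz: "(z - 1) div M = c (f x0)" using const[OF reach[OF x0 y(1)]] y(2) unfolding c_def by simp
      have z1: "1 \<le> z" using y f(2) by auto
      have "z - 1 = c (f x0) * M + (z - 1) mod M" using div_mult_mod_eq[of "z - 1" M] unfolding cz by simp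
      moreover have "(z - 1) mod M < M" using M(1) by simp
      ultimately show "z \<in> {c (f x0) * M + 1..c (f x0) * M + M}"
        unfolding atLeastAtMost_iff using z1 by linarith
    qed
    then have "card (f ` pverts H) \<le> card {c (f x0) * M + 1..c (f x0) * M + M}" by (intro card_mono) auto
    then have "card (pverts H) \<le> M" using f(1) by (simp add: card_image)
    then show False using M(2) by simp
  qed
  ultimately show ?thesis by blast
qed

theorem mainTheorem9:
  fixes K p :: nat
  assumes "K \<ge> 1" and "p \<ge> 3"
  shows "\<exists>n0. \<forall>n \<ge> n0. \<forall>(T :: nat pair_pre_digraph) (k :: nat \<Rightarrow> nat).
           tree_graph T \<and> pverts T = {1..n} \<and> (\<forall>i \<in> {1..n}. 0 < k i \<and> k i \<le> K)
           \<longrightarrow> p_good p (blowup T k)"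
proof -
  define q where "q = p - 1"
  have q: "1 \<le> q" "Suc q = p" using assms(2) unfolding q_def by auto
  from embeds_of_order[OF assms(1) q(1)]
  obtain N0 where N0: "\<forall>(R :: nat \<Rightarrow> nat \<Rightarrow> bool) V I (E :: nat \<Rightarrow> nat \<Rightarrow> bool) k.
     red_graph R \<and> finite V \<and> red_free R (Suc q) V \<and> rootable I E \<and> (\<forall>i\<in>I. 0 < k i \<and> k i \<le> K) \<and>
     N0 \<le> real (sum k I) \<and> card V = q * (sum k I - 1) + 1 \<longrightarrow> embeds R I E k V"
    by - (elim exE, rule that; assumption)
  obtain n1 :: nat where n1: "N0 \<le> real n1" using real_arch_simple by blast
  \<comment> \<open>As every \<open>k i\<close> is at least 1, the blow-up has order at least n. So
    \<open>n1\<close> brings it above the threshold \<open>N0\<close>, and \<open>2\<close> makes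
    the cliques of the lower bound nonempty.\<close>
  have main: "p_good p (blowup T k)"
    if n: "max 2 n1 \<le> n" and T: "tree_graph T" "pverts T = {1..n}" and k: "\<forall>i\<in>{1..n}. 0 < k i \<and> k i \<le> K"
    for n k and T :: "nat pair_pre_digraph"
  proof -
    define H where "H = blowup T k"
    have G: "pair_graph T" "Digraph_Component.connected T" using T(1) unfolding tree_graph_def by auto
    have Hp: "pair_graph H" unfolding H_def using G(1) by (rule pair_graph_blowup)
    have Hc: "Digraph_Component.connected H"
      unfolding H_def using G k T(2) by (intro connected_blowup) auto
    have Hcard: "card (pverts H) = sum k {1..n}" unfolding H_def blowup_simps T(2) by simp
    have "(\<Sum>i\<in>{1..n}. 1) \<le> sum k {1..n}" using k by (intro sum_mono) (auto simp: Suc_le_eq)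
    then have nk: "n \<le> sum k {1..n}" by simp
    define m where "m = (p - 1) * (card (pverts H) - 1) + 1"
    have "contains_copy R (complete_graph {1..p}) \<or> contains_copy B H"
      if ep: "edge_partition (complete_graph {1..m}) R B" for R B
    proof (cases "contains_copy R (complete_graph {1..p})")
      case False
      have R: "pair_graph R" "pverts R = {1..m}" and B: "pair_graph B" "pverts B = {1..m}"
        and un: "parcs R \<union> parcs B = parcs (complete_graph {1..m})"
        using ep unfolding edge_partition_def by (auto simp: complete_graph_def)
      define r where "r = (\<lambda>x y. (x, y) \<in> parcs R)"
      have rg: "red_graph r" unfolding red_graph_def r_def using pair_graphD(2)[OF R(1)] by blast
      have "red_free r (Suc q) {1..m}"
        unfolding red_free_def
      proof
        assume "\<exists>A\<subseteq>{1..m}. finite A \<and> card A = Suc q \<and> red_clique r A"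
        then obtain A where A: "A \<subseteq> {1..m}" "finite A" "card A = p" "red_clique r A" using q(2) by auto
        obtain f where f: "bij_betw f {1..p} A"
          using finite_same_card_bij[of "{1..p}" A] A(2,3) by auto
        have "inj_on f {1..p}" "f ` {1..p} = A" using f unfolding bij_betw_def by auto
        moreover have "(f x, f y) \<in> parcs R" if "x \<in> {1..p}" "y \<in> {1..p}" "x \<noteq> y" for x y
        proof -
          have "f x \<noteq> f y" using \<open>inj_on f {1..p}\<close> that by (meson inj_onD)
          moreover have "f x \<in> A" "f y \<in> A" using \<open>f ` {1..p} = A\<close> that by blast+
          ultimately show ?thesis using A(4) unfolding red_clique_def r_def by blast
        qed
        ultimately have "contains_copy R (complete_graph {1..p})"
          unfolding contains_copy_iff[OF R(1) pair_graph_complete_graph[OF finite_atLeastAtMost]]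
          using A(1) R(2) by (intro exI[of _ f]) (auto simp: complete_graph_def)
        then show False using False by blast
      qed
      moreover have "rootable {1..n} (\<lambda>u v. (u, v) \<in> parcs T)" using tree_graph_rootable[OF T(1)] T(2) by simp
      moreover have "N0 \<le> real (sum k {1..n})" using n1 n nk by linarith
      moreover have "card {1..m} = q * (sum k {1..n} - 1) + 1" unfolding m_def q_def Hcard by simp
      ultimately have "embeds r {1..n} (\<lambda>u v. (u, v) \<in> parcs T) k {1..m}"
        using rg k by (intro N0[rule_format] conjI) auto
      then obtain f where f: "inj_on f (SIGMA i:{1..n}. {1..k i})" "f ` (SIGMA i:{1..n}. {1..k i}) \<subseteq> {1..m}"
        "\<And>x y. x \<in> (SIGMA i:{1..n}. {1..k i}) \<Longrightarrow> y \<in> (SIGMA i:{1..n}. {1..k i}) \<Longrightarrow> x \<noteq> y \<Longrightarrow>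
           fst x = fst y \<or> (fst x, fst y) \<in> parcs T \<Longrightarrow> \<not> r (f x) (f y)"
        unfolding embeds_def by metis
      have VH: "pverts H = (SIGMA i:{1..n}. {1..k i})" unfolding H_def blowup_simps T(2) ..
      have "(f x, f y) \<in> parcs B" if xy: "(x, y) \<in> parcs H" for x y
      proof -
        have x: "x \<in> pverts H" "y \<in> pverts H" "x \<noteq> y" using pair_graphD(2)[OF Hp xy] by auto
        have "fst x = fst y \<or> (fst x, fst y) \<in> parcs T" using xy unfolding H_def blowup_simps by auto
        then have "\<not> r (f x) (f y)" using f(3) x unfolding VH by blast
        moreover have "f x \<noteq> f y" using f(1) x unfolding VH by (meson inj_onD)
        moreover have "f x \<in> {1..m}" "f y \<in> {1..m}" using f(2) x unfolding VH by blast+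
        then have "(f x, f y) \<in> parcs R \<union> parcs B" unfolding un complete_graph_def using \<open>f x \<noteq> f y\<close> by simp
        ultimately show ?thesis unfolding r_def by blast
      qed
      then have "contains_copy B H"
        unfolding contains_copy_iff[OF B(1) Hp] using f(1,2) B(2) unfolding VH by blast
      then show ?thesis ..
    qed simp
    moreover have "m \<le> m'"
      if "\<forall>R B. edge_partition (complete_graph {1..m'}) R B \<longrightarrow>
          contains_copy R (complete_graph {1..p}) \<or> contains_copy B H" for m'
    proof (rule ccontr)
      assume "\<not> m \<le> m'"
      then have "m' \<le> (p - 1) * (card (pverts H) - 1)" unfolding m_def by simp
      moreover have "2 \<le> card (pverts H)" using n nk Hcard by simp
      ultimately show False
        using no_copies_in_small_complete_graph[OF Hp Hc, of p m'] that assms(2) by auto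
    qed
    ultimately have "ramsey_number (complete_graph {1..p}) H = m"
      unfolding ramsey_number_def by (intro Least_equality) auto
    then show ?thesis using Hp Hc unfolding p_good_def H_def m_def by blast
  qed
  show ?thesis by (rule exI[of _ "max 2 n1"], intro allI impI, elim conjE, rule main; assumption)
qed

end
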